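(* Let $T_*>0$, let $H\colon[0,T_*]\times\mathbb{R}^d\times\mathbb{R}^d\to\mathbb{R}$, and let $\mathcal{L}$ be a Lévy operator with triplet $(A,0,\mu)$ and heat kernel $p_t$. Assume: (1) $p_t\in C_b^\infty(\mathbb{R}^d)$ and there exist $\alpha\in(1,2]$ and $c_0>0$ such that $\int_{\mathbb{R}^d}|Dp_t(y)|\,dy\le c_0t^{-1/\alpha}$ for all $t\in(0,T_*]$; (2) $H$ is continuous, there is $H_0>0$ with $|H(t,x,0)|\le H_0$ for all $t\in(0,T_* )$, $x\in\mathbb{R}^d$, and for each $R>0$ there is $L_R>0$ such that $|H(t,x,p)-H(t,x,q)|\le L_R|p-q|$ for all $t\in(0,T_* )$, $x\in\mathbb{R}^d$, $p,q\in B(0,R)$; (3) $u_0\colon\mathbb{R}^d\to\mathbb{R}$ is bounded and Lipschitz. Then there is $T\in(0,T_*]$ for which there exists a unique mild solution $u\in C_b((0,T];C_b^1(\mathbb{R}^d))$ of $$\partial_tu-\mathcal{L}u-H(t,x,Du)=0\ \text{ in }(0,T]\times\mathbb{R}^d,\qquad u(0,x)=u_0(x).$$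
   Context: Lévy operator: $A$ is a nonnegative definite real symmetric $d\times d$ matrix, $\mu\ge 0$ is a Borel measure on $\mathbb{R}^d\setminus\{0\}$ with $\int(1\wedge|z|^2)\,d\mu(z)<\infty$, and $$\mathcal{L}\varphi(x)=\operatorname{div}(AD\varphi(x))+\int_{\mathbb{R}^d}\big[\varphi(x+z)-\varphi(x)-\mathbf{1}_{|z|<1}D\varphi(x)\cdot z\big]\,d\mu(z).$$ Heat kernel: $p_t$, $t>0$, are the probability measures with $\int e^{-i\xi\cdot x}p_t(dx)=e^{-t\psi(\xi)}$, where $\psi(\xi)=\xi\cdot A\xi+\int(1-e^{i\xi\cdot z}+i\xi\cdot z\mathbf{1}_{|z|<1})\,d\mu(z)$; they are assumed absolutely continuous with density again denoted $p_t$. Semigroup: $P_t\varphi=p_t*\varphi$. $C_b^1(\mathbb{R}^d)$: functions with bounded continuous derivatives up to order 1, with norm $\|\varphi\|_\infty+\max_i\|\partial_i\varphi\|_\infty$; $D$ is the spatial gradient. $C_b((0,T];X)$ denotes bounded continuous functions from $(0,T]$ to the normed space $X$. Mild solution: $u\in C((0,T];C_b^1(\mathbb{R}^d))$ such that for all $t\in(0,T]$, $x\in\mathbb{R}^d$, $$u(t,x)=P_t[u_0](x)+\int_0^tP_{t-s}\big[H(s,\cdot,Du(s,\cdot))\big](x)\,ds.$$ *)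

theory Defs
  imports "HOL-Analysis.Analysis" "HOL-Probability.Probability"
begin

definition partial_deriv :: "'n \<Rightarrow> (real^'n::finite \<Rightarrow> real) \<Rightarrow> real^'n \<Rightarrow> real"
  where "partial_deriv i f x = frechet_derivative f (at x) (axis i 1)"

definition grad :: "(real^'n::finite \<Rightarrow> real) \<Rightarrow> real^'n \<Rightarrow> real^'n"
  where "grad f x = (\<chi> i. partial_deriv i f x)"

definition div_field :: "(real^'n::finite \<Rightarrow> real^'n) \<Rightarrow> real^'n \<Rightarrow> real"
  where "div_field F x = (\<Sum>i\<in>UNIV. partial_deriv i (\<lambda>y. F y $ i) x)"

text \<open>The functions with bounded continuous partial derivatives up to order \<open>k\<close>
  (order 0 included). Differentiability is demanded explicitly because the value of
  \<^const>\<open>frechet_derivative\<close> is meaningless without it.\<close>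

primrec Cb :: "nat \<Rightarrow> (real^'n::finite \<Rightarrow> real) set"
  where
    "Cb 0 = {f. continuous_on UNIV f \<and> bounded (range f)}"
  | "Cb (Suc k) = {f. continuous_on UNIV f \<and> bounded (range f) \<and>
       (\<forall>x. f differentiable (at x)) \<and> (\<forall>i. partial_deriv i f \<in> Cb k)}"

definition Cb_infinity :: "(real^'n::finite \<Rightarrow> real) set"
  where "Cb_infinity = (\<Inter>k. Cb k)"

definition sup_norm :: "(real^'n::finite \<Rightarrow> real) \<Rightarrow> real"
  where "sup_norm f = (SUP x. \<bar>f x\<bar>)"

definition Cb1_norm :: "(real^'n::finite \<Rightarrow> real) \<Rightarrow> real"
  where "Cb1_norm f = sup_norm f + Max (range (\<lambda>i. sup_norm (partial_deriv i f)))"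

text \<open>The spaces \<open>C((0,T]; C\<^sub>b\<^sup>1)\<close> and \<open>C\<^sub>b((0,T]; C\<^sub>b\<^sup>1)\<close>. Values of \<open>u\<close> at times outside
  \<open>(0,T]\<close> are irrelevant.\<close>

definition C_time_Cb1 :: "real \<Rightarrow> (real \<Rightarrow> real^'n::finite \<Rightarrow> real) set"
  where "C_time_Cb1 T = {u. (\<forall>t\<in>{0<..T}. u t \<in> Cb 1) \<and>
    (\<forall>t\<in>{0<..T}. ((\<lambda>s. Cb1_norm (\<lambda>x. u s x - u t x)) \<longlongrightarrow> 0) (at t within {0<..T}))}"

definition Cb_time_Cb1 :: "real \<Rightarrow> (real \<Rightarrow> real^'n::finite \<Rightarrow> real) set"
  where "Cb_time_Cb1 T = {u \<in> C_time_Cb1 T. \<exists>M. \<forall>t\<in>{0<..T}. Cb1_norm (u t) \<le> M}"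

definition levy_triplet :: "real^'n^'n::finite \<Rightarrow> (real^'n) measure \<Rightarrow> bool"
  where "levy_triplet A mu \<longleftrightarrow>
    transpose A = A \<and> (\<forall>\<xi>. 0 \<le> \<xi> \<bullet> (A *v \<xi>)) \<and>
    sets mu = sets (restrict_space borel (- {0})) \<and>
    (\<integral>\<^sup>+z. ennreal (min 1 ((norm z)\<^sup>2)) \<partial>mu) < \<infinity>"

text \<open>\<open>L\<close> is the L\'evy operator with triplet \<open>(A, 0, mu)\<close>. The formula is imposed on \<open>C\<^sub>b\<^sup>2\<close>,
  where the singular integral converges absolutely.\<close>

definition levy_operator ::
    "((real^'n::finite \<Rightarrow> real) \<Rightarrow> real^'n \<Rightarrow> real) \<Rightarrow> real^'n^'n \<Rightarrow> (real^'n) measure \<Rightarrow> bool"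
  where "levy_operator L A mu \<longleftrightarrow> levy_triplet A mu \<and>
    (\<forall>\<phi>\<in>Cb 2. \<forall>x. L \<phi> x = div_field (\<lambda>y. A *v grad \<phi> y) x +
       (\<integral>z. (\<phi> (x + z) - \<phi> x - indicator {z. norm z < 1} z * (grad \<phi> x \<bullet> z)) \<partial>mu))"

definition levy_symbol :: "real^'n^'n::finite \<Rightarrow> (real^'n) measure \<Rightarrow> real^'n \<Rightarrow> complex"
  where "levy_symbol A mu \<xi> = complex_of_real (\<xi> \<bullet> (A *v \<xi>)) +
    (\<integral>z. (1 - exp (\<i> * complex_of_real (\<xi> \<bullet> z))
          + \<i> * complex_of_real (\<xi> \<bullet> z) * indicator {z. norm z < 1} z) \<partial>mu)"

text \<open>\<open>p t\<close> is a Lebesgue density of the probability measure with Fourier transform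
  \<open>exp (- t * \<psi>)\<close>. Nonnegativity is stated separately, as \<^const>\<open>ennreal\<close> truncates
  negative values to 0.\<close>

definition heat_kernel ::
    "real^'n^'n::finite \<Rightarrow> (real^'n) measure \<Rightarrow> (real \<Rightarrow> real^'n \<Rightarrow> real) \<Rightarrow> bool"
  where "heat_kernel A mu p \<longleftrightarrow>
    (\<forall>t>0. p t \<in> borel_measurable borel \<and> (\<forall>x. 0 \<le> p t x) \<and>
       prob_space (density lborel (\<lambda>x. ennreal (p t x))) \<and>
       (\<forall>\<xi>. (\<integral>x. exp (- (\<i> * complex_of_real (\<xi> \<bullet> x))) \<partial>density lborel (\<lambda>x. ennreal (p t x)))
            = exp (- (complex_of_real t * levy_symbol A mu \<xi>))))"

definition semigroup ::
    "(real \<Rightarrow> real^'n::finite \<Rightarrow> real) \<Rightarrow> real \<Rightarrow> (real^'n \<Rightarrow> real) \<Rightarrow> real^'n \<Rightarrow> real"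
  where "semigroup p t \<phi> x = (\<integral>y. p t (x - y) * \<phi> y \<partial>lborel)"

text \<open>Mild solutions on \<open>(0,T]\<close> of \<open>\<partial>\<^sub>t u - L u - H(t,x,Du) = 0\<close>, \<open>u(0) = u0\<close>, where \<open>p\<close> is the
  heat kernel of \<open>L\<close>. Integrability in time is part of the definition, since the Bochner
  integral of a non-integrable function is 0 by convention.\<close>

definition mild_solution ::
    "(real \<Rightarrow> real^'n::finite \<Rightarrow> real) \<Rightarrow> (real \<Rightarrow> real^'n \<Rightarrow> real^'n \<Rightarrow> real) \<Rightarrow>
     (real^'n \<Rightarrow> real) \<Rightarrow> real \<Rightarrow> (real \<Rightarrow> real^'n \<Rightarrow> real) \<Rightarrow> bool"
  where "mild_solution p H u0 T u \<longleftrightarrow> u \<in> C_time_Cb1 T \<and>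
    (\<forall>t\<in>{0<..T}. \<forall>x.
       set_integrable lborel {0<..<t}
         (\<lambda>s. semigroup p (t - s) (\<lambda>y. H s y (grad (u s) y)) x) \<and>
       u t x = semigroup p t u0 x +
         (LINT s:{0<..<t}|lborel. semigroup p (t - s) (\<lambda>y. H s y (grad (u s) y)) x))"

end

theory Submission
  imports Defs
begin

text \<open>Write \<open>w = Du\<close>. Differentiating the mild formula under the integral turns the problem into a
fixed point equation for the gradient alone,
\<open>w(t) = Dp\<^sub>t * u\<^sub>0 + \<integral>\<^sub>0\<^sup>t Dp\<^sub>t\<^sub>-\<^sub>s * H(s, \<cdot>, w(s)) ds\<close>,
and \<open>u\<close> is recovered from \<open>w\<close> by the mild formula itself. The bound
\<open>\<parallel>Dp\<^sub>t\<parallel> \<le> c\<^sub>0 t\<^sup>-\<^sup>\<gamma>\<close> in \<open>L\<^sup>1\<close>, with \<open>\<gamma> = 1/\<alpha> < 1\<close>, is an integrable singularity, so the integral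
term is at most a constant times \<open>t\<^sup>1\<^sup>-\<^sup>\<gamma>\<close>. The first term is bounded by the Lipschitz constant
\<open>K\<close> of \<open>u\<^sub>0\<close>, because \<open>p\<^sub>t\<close> is a probability density. Hence for a short time the right-hand side
maps the fields bounded by \<open>K + 1\<close> into themselves and halves distances, and Picard iteration
converges (\<open>grad_map_fixpoint_exists\<close>). Two bounded solutions, of whatever size, agree on
successive time steps whose length depends only on their common bound
(\<open>grad_map_fixpoint_unique\<close>).

The delicate point is regularity in time: the mild formula asks for integrability in \<open>s\<close>, and
solutions must be continuous in \<open>t\<close> with values in \<open>C\<^sub>b\<^sup>1\<close>. Both follow from the continuity of
\<open>t \<mapsto> p\<^sub>t\<close> and \<open>t \<mapsto> Dp\<^sub>t\<close> in \<open>L\<^sup>1\<close>, and this is extracted from the formula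
\<open>exp (- t \<psi>)\<close> for the Fourier transform. Uniqueness of Fourier transforms gives the semigroup law
\<open>p\<^sub>s\<^sub>+\<^sub>t = p\<^sub>s * p\<^sub>t\<close>, so the densities \<open>p\<^sub>s\<close> with \<open>s \<ge> r > 0\<close> share the sup bound and the
Lipschitz constant of \<open>p\<^sub>r\<close>. The convolution of \<open>p\<^sub>s\<close> with a narrow Gaussian is continuous in \<open>s\<close>,
being an integral of \<open>exp (- s \<psi>)\<close> against a finite measure, and it is close to \<open>p\<^sub>s\<close> uniformly in
\<open>s \<ge> r\<close>; so \<open>p\<^sub>s\<close> is pointwise continuous in \<open>s\<close>. Since all masses equal 1, Scheffe's lemma upgrades
this to \<open>L\<^sup>1\<close> (\<open>p_L1_continuous\<close>), and \<open>Dp\<^sub>s = Dp\<^sub>r * p\<^sub>s\<^sub>-\<^sub>r\<close> transfers it to the gradient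
(\<open>Dp_L1_continuous\<close>).

All functions that are convolved with a kernel are bounded and continuous, so dominated
convergence takes care of continuity in space.\<close>

section \<open>Affine changes of variables in Lebesgue integrals\<close>

lemma lborel_integral_affine:
  fixes f :: "'a::euclidean_space \<Rightarrow> 'b::{banach,second_countable_topology}"
  assumes [measurable]: "f \<in> borel_measurable borel" and c: "c \<noteq> 0"
  shows "(\<integral>y. f y \<partial>lborel) = \<bar>c\<bar> ^ DIM('a) *\<^sub>R (\<integral>x. f (t + c *\<^sub>R x) \<partial>lborel)"
  by (subst lborel_affine[OF c, of t]) (simp add: integral_density integral_distr ennreal_power)

lemma lborel_distr_reflect:
  fixes x :: "'a::euclidean_space"
  shows "distr lborel borel (\<lambda>y. x - y) = lborel"
  using lborel_affine[of "-1" x] by (simp add: density_1)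

lemma integral_lborel_reflect:
  fixes f :: "'a::euclidean_space \<Rightarrow> 'b::{banach,second_countable_topology}"
  assumes [measurable]: "f \<in> borel_measurable borel"
  shows "(\<integral>y. f (x - y) \<partial>lborel) = (\<integral>y. f y \<partial>lborel)"
  by (subst (2) lborel_distr_reflect[of x, symmetric]) (simp add: integral_distr)

lemma integral_lborel_shift:
  fixes f :: "'a::euclidean_space \<Rightarrow> 'b::{banach,second_countable_topology}"
  assumes [measurable]: "f \<in> borel_measurable borel"
  shows "(\<integral>y. f (y + x) \<partial>lborel) = (\<integral>y. f y \<partial>lborel)"
  by (subst (2) lborel_distr_plus[of x, symmetric]) (simp add: integral_distr add.commute)

lemma integrable_lborel_reflect:
  fixes f :: "'a::euclidean_space \<Rightarrow> 'b::{banach,second_countable_topology}"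
  assumes "integrable lborel f"
  shows "integrable lborel (\<lambda>y. f (x - y))"
  using assms lborel_distr_reflect[of x] integrable_distr_eq[of "\<lambda>y. x - y" lborel borel f] by simp

lemma integrable_lborel_shift:
  fixes f :: "'a::euclidean_space \<Rightarrow> 'b::{banach,second_countable_topology}"
  assumes "integrable lborel f"
  shows "integrable lborel (\<lambda>y. f (y + x))"
  using assms lborel_distr_plus[of x] integrable_distr_eq[of "(+) x" lborel borel f]
  by (simp add: add.commute)

section \<open>Fourier uniqueness by Gaussian smoothing\<close>

definition gauss :: "'a::euclidean_space \<Rightarrow> real"
  where "gauss x = (\<Prod>b\<in>Basis. std_normal_density (x \<bullet> b))"

lemma gauss_nonneg [simp]: "0 \<le> gauss x"
  by (simp add: gauss_def prod_nonneg)

lemma gauss_0_pos: "0 < gauss 0"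
  by (simp add: gauss_def prod_pos std_normal_density_def)

lemma continuous_on_gauss [continuous_intros]: "continuous_on S gauss"
  unfolding gauss_def normal_density_def by (intro continuous_intros) auto

lemma borel_measurable_gauss [measurable]: "gauss \<in> borel_measurable borel"
  by (intro borel_measurable_continuous_onI continuous_on_gauss)

lemma product_sigma_finite_lborel: "product_sigma_finite (\<lambda>b. lborel)"
  by standard

text \<open>The identification of Lebesgue measure with a product measure, in the form needed for functions
that factor over the coordinates.\<close>

lemma lborel_prod_integral:
  fixes f :: "'a::euclidean_space \<Rightarrow> real \<Rightarrow> complex"
  assumes "\<And>b. b \<in> Basis \<Longrightarrow> integrable lborel (f b)"
  shows "integrable lborel (\<lambda>x::'a. \<Prod>b\<in>Basis. f b (x \<bullet> b))"
    and "(\<integral>x. (\<Prod>b\<in>Basis. f b (x \<bullet> b)) \<partial>lborel) = (\<Prod>b\<in>Basis. (\<integral>x. f b x \<partial>lborel))"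
proof -
  interpret product_sigma_finite "\<lambda>b::'a. lborel :: real measure" by (rule product_sigma_finite_lborel)
  have [measurable]: "f b \<in> borel_measurable borel" if "b \<in> Basis" for b
    using borel_measurable_integrable[OF assms[OF that]] by simp
  have m [measurable]: "(\<lambda>x. \<Prod>b\<in>Basis. f b (x \<bullet> b)) \<in> borel_measurable borel" by measurable
  have "integrable (Pi\<^sub>M Basis (\<lambda>b::'a. lborel)) (\<lambda>x. \<Prod>b\<in>Basis. f b (x b))"
    by (intro product_integrable_prod assms) auto
  then have "integrable (Pi\<^sub>M Basis (\<lambda>b::'a. lborel))
      (\<lambda>x. \<Prod>b\<in>Basis. f b ((\<Sum>c\<in>Basis. x c *\<^sub>R c) \<bullet> b))"
    by (simp cong: prod.cong)
  then show "integrable lborel (\<lambda>x::'a. \<Prod>b\<in>Basis. f b (x \<bullet> b))"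
    by (subst lborel_eq) (simp add: integrable_distr_eq)
  show "(\<integral>x. (\<Prod>b\<in>Basis. f b (x \<bullet> b)) \<partial>lborel) = (\<Prod>b\<in>Basis. (\<integral>x. f b x \<partial>lborel))"
    by (subst lborel_eq, subst integral_distr) (simp_all add: product_integral_prod assms cong: prod.cong)
qed

text \<open>The Gaussian is, up to the factor \<open>gauss 0\<close>, its own Fourier transform: by Fubini this reduces to
the characteristic function of the one-dimensional normal distribution in each coordinate.\<close>

lemma gauss_self_dual:
  fixes x :: "'a::euclidean_space"
  shows "integrable lborel (\<lambda>\<xi>::'a. exp (\<i> * complex_of_real (\<xi> \<bullet> x)) * complex_of_real (gauss \<xi>))"
    and "complex_of_real (gauss x) = complex_of_real (gauss (0::'a)) *
      (\<integral>\<xi>. exp (\<i> * complex_of_real (\<xi> \<bullet> x)) * complex_of_real (gauss \<xi>) \<partial>lborel)"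
proof -
  define f :: "'a \<Rightarrow> real \<Rightarrow> complex" where
    "f b r = exp (\<i> * complex_of_real (r * (x \<bullet> b))) * complex_of_real (std_normal_density r)" for b r
  have eq: "exp (\<i> * complex_of_real (\<xi> \<bullet> x)) * complex_of_real (gauss \<xi>) = (\<Prod>b\<in>Basis. f b (\<xi> \<bullet> b))" for \<xi> :: 'a
    by (simp add: f_def gauss_def prod.distrib euclidean_inner[of \<xi> x] sum_distrib_left exp_sum)
  have int: "integrable lborel (f b)" for b
  proof (rule Bochner_Integration.integrable_bound[of _ std_normal_density])
    show "f b \<in> borel_measurable lborel" unfolding f_def by measurable
  qed (auto simp: f_def norm_mult)
  have "(\<integral>r. f b r \<partial>lborel) = complex_of_real (exp (- (x \<bullet> b)\<^sup>2 / 2))" for b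
  proof -
    have "(\<integral>r. f b r \<partial>lborel) = (\<integral>r. exp (\<i> * complex_of_real ((x \<bullet> b) * r)) \<partial>std_normal_distribution)"
      unfolding f_def by (subst integral_density) (auto simp: mult_ac scaleR_conv_of_real)
    also have "\<dots> = char std_normal_distribution (x \<bullet> b)" by (simp add: char_def)
    finally show ?thesis by (simp add: char_std_normal_distribution)
  qed
  then have f: "(\<integral>r. f b r \<partial>lborel) * complex_of_real (std_normal_density 0) = complex_of_real (std_normal_density (x \<bullet> b))" for b
    by (simp add: std_normal_density_def)
  show "integrable lborel (\<lambda>\<xi>::'a. exp (\<i> * complex_of_real (\<xi> \<bullet> x)) * complex_of_real (gauss \<xi>))"
    unfolding eq by (rule lborel_prod_integral(1)[OF int])
  show "complex_of_real (gauss x) = complex_of_real (gauss (0::'a)) *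
      (\<integral>\<xi>. exp (\<i> * complex_of_real (\<xi> \<bullet> x)) * complex_of_real (gauss \<xi>) \<partial>lborel)"
    unfolding eq lborel_prod_integral(2)[OF int]
    by (simp add: gauss_def f[symmetric] prod.distrib)
qed

lemma gauss_integrable: "integrable lborel (gauss :: 'a::euclidean_space \<Rightarrow> real)"
  and gauss_integral: "(\<integral>x. gauss (x::'a) \<partial>lborel) = 1"
proof -
  have "integrable lborel (\<lambda>\<xi>::'a. complex_of_real (gauss \<xi>))"
    using gauss_self_dual(1)[of "0::'a"] by simp
  then show "integrable lborel (gauss :: 'a \<Rightarrow> real)"
    using complex_of_real_integrable_eq by blast
  have "complex_of_real (gauss (0::'a)) = complex_of_real (gauss (0::'a) * (\<integral>x. gauss (x::'a) \<partial>lborel))"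
    using gauss_self_dual(2)[of "0::'a"] by simp
  then show "(\<integral>x. gauss (x::'a) \<partial>lborel) = 1"
    unfolding of_real_eq_iff using gauss_0_pos[where 'a='a] by simp
qed

definition fourier :: "('a::euclidean_space \<Rightarrow> real) \<Rightarrow> 'a \<Rightarrow> complex"
  where "fourier f \<xi> = (\<integral>x. exp (- (\<i> * complex_of_real (\<xi> \<bullet> x))) * complex_of_real (f x) \<partial>lborel)"

text \<open>The convolution of \<open>f\<close> with the centred normal density of standard deviation \<open>\<epsilon>\<close>, written in the
rescaled variable so that the weight stays fixed as \<open>\<epsilon>\<close> tends to 0.\<close>

definition smooth_by :: "real \<Rightarrow> ('a::euclidean_space \<Rightarrow> real) \<Rightarrow> 'a \<Rightarrow> real"
  where "smooth_by \<epsilon> f x = (\<integral>z. f (x - \<epsilon> *\<^sub>R z) * gauss z \<partial>lborel)"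

text \<open>Inserting the Gaussian as a Fourier integral and exchanging the integrals expresses the smoothed
function through the Fourier transform of \<open>f\<close>. The weight on the right is a finite measure, so
pointwise convergence of bounded transforms carries over to the smoothed functions.\<close>

lemma smooth_by_fourier:
  fixes f :: "'a::euclidean_space \<Rightarrow> real"
  assumes f: "integrable lborel f" and \<epsilon>: "\<epsilon> > 0"
  shows "complex_of_real (\<epsilon> ^ DIM('a) * smooth_by \<epsilon> f x) = complex_of_real (gauss (0::'a)) *
    (\<integral>\<xi>. complex_of_real (gauss \<xi>) * exp (\<i> * complex_of_real (\<xi> \<bullet> x / \<epsilon>)) * fourier f (\<xi> /\<^sub>R \<epsilon>) \<partial>lborel)"
proof -
  have [measurable]: "f \<in> borel_measurable borel" using f by auto
  define E where "E \<xi> y = exp (\<i> * complex_of_real (\<xi> \<bullet> ((x - y) /\<^sub>R \<epsilon>)))" for \<xi> y :: 'a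
  have Em [measurable]: "(\<lambda>(y, \<xi>). E \<xi> y) \<in> borel_measurable (borel \<Otimes>\<^sub>M borel)"
    unfolding E_def split_def by (simp add: borel_prod)
      (intro borel_measurable_continuous_onI continuous_intros)
  have nE: "norm (E \<xi> y) = 1" for \<xi> y by (simp add: E_def)
  have "(\<integral>y. f y * gauss ((x - y) /\<^sub>R \<epsilon>) \<partial>lborel) = \<bar>-\<epsilon>\<bar> ^ DIM('a) *\<^sub>R
      (\<integral>z. f (x + (-\<epsilon>) *\<^sub>R z) * gauss ((x - (x + (-\<epsilon>) *\<^sub>R z)) /\<^sub>R \<epsilon>) \<partial>lborel)"
    using \<epsilon> by (intro lborel_integral_affine) auto
  also have "\<dots> = \<epsilon> ^ DIM('a) * smooth_by \<epsilon> f x"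
    using \<epsilon> by (simp add: smooth_by_def)
  finally have "complex_of_real (\<epsilon> ^ DIM('a) * smooth_by \<epsilon> f x) =
      (\<integral>y. complex_of_real (f y) * complex_of_real (gauss ((x - y) /\<^sub>R \<epsilon>)) \<partial>lborel)"
    by (simp flip: of_real_mult)
  also have "\<dots> = (\<integral>y. complex_of_real (gauss (0::'a)) *
      (\<integral>\<xi>. complex_of_real (f y) * (E \<xi> y * complex_of_real (gauss \<xi>)) \<partial>lborel) \<partial>lborel)"
  proof (rule Bochner_Integration.integral_cong[OF refl])
    fix y :: 'a
    show "complex_of_real (f y) * complex_of_real (gauss ((x - y) /\<^sub>R \<epsilon>)) = complex_of_real (gauss (0::'a)) *
      (\<integral>\<xi>. complex_of_real (f y) * (E \<xi> y * complex_of_real (gauss \<xi>)) \<partial>lborel)"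
      by (subst gauss_self_dual(2)) (simp only: E_def integral_mult_right_zero mult.left_commute)
  qed
  also have "\<dots> = complex_of_real (gauss (0::'a)) * (\<integral>y.
      (\<integral>\<xi>. complex_of_real (f y) * (E \<xi> y * complex_of_real (gauss \<xi>)) \<partial>lborel) \<partial>lborel)"
    by simp
  also have "(\<integral>y. (\<integral>\<xi>. complex_of_real (f y) * (E \<xi> y * complex_of_real (gauss \<xi>)) \<partial>lborel) \<partial>lborel) =
      (\<integral>\<xi>. (\<integral>y. complex_of_real (f y) * (E \<xi> y * complex_of_real (gauss \<xi>)) \<partial>lborel) \<partial>lborel)"
  proof (rule lborel_pair.Fubini_integral[symmetric])
    have "integrable (lborel \<Otimes>\<^sub>M lborel) (\<lambda>(y::'a, \<xi>::'a). f y * gauss \<xi>)"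
      by (intro lborel_pair.Fubini_integrable)
         (auto simp: abs_mult intro!: f[THEN integrable_abs] integrable_mult_left integrable_mult_right gauss_integrable f)
    then show "integrable (lborel \<Otimes>\<^sub>M lborel) (\<lambda>(y::'a, \<xi>). complex_of_real (f y) * (E \<xi> y * complex_of_real (gauss \<xi>)))"
      by (rule Bochner_Integration.integrable_bound) (auto simp: norm_mult nE abs_mult)
  qed
  also have "\<dots> = (\<integral>\<xi>. complex_of_real (gauss \<xi>) * exp (\<i> * complex_of_real (\<xi> \<bullet> x / \<epsilon>)) * fourier f (\<xi> /\<^sub>R \<epsilon>) \<partial>lborel)"
  proof (rule Bochner_Integration.integral_cong[OF refl])
    fix \<xi> :: 'a
    have "E \<xi> y = exp (\<i> * complex_of_real (\<xi> \<bullet> x / \<epsilon>)) * exp (- (\<i> * complex_of_real ((\<xi> /\<^sub>R \<epsilon>) \<bullet> y)))" for y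
      by (simp add: E_def exp_add[symmetric] inner_diff_right field_simps)
    then show "(\<integral>y. complex_of_real (f y) * (E \<xi> y * complex_of_real (gauss \<xi>)) \<partial>lborel) =
       complex_of_real (gauss \<xi>) * exp (\<i> * complex_of_real (\<xi> \<bullet> x / \<epsilon>)) * fourier f (\<xi> /\<^sub>R \<epsilon>)"
      unfolding fourier_def by (subst integral_mult_right_zero[symmetric]) (simp add: mult_ac)
  qed
  finally show ?thesis .
qed

lemma smooth_by_tendsto:
  fixes f :: "'a::euclidean_space \<Rightarrow> real"
  assumes f: "continuous_on UNIV f" and B: "\<And>x. \<bar>f x\<bar> \<le> B"
  shows "(\<lambda>n. smooth_by (1 / real (Suc n)) f x) \<longlonglongrightarrow> f x"
proof -
  have [measurable]: "f \<in> borel_measurable borel" by (intro borel_measurable_continuous_onI f)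
  have "(\<lambda>n. \<integral>z. f (x - (1 / real (Suc n)) *\<^sub>R z) * gauss z \<partial>lborel) \<longlonglongrightarrow> (\<integral>z. f x * gauss (z::'a) \<partial>lborel)"
  proof (rule integral_dominated_convergence[where w="\<lambda>z::'a. B * gauss z"])
    show "AE z in lborel. (\<lambda>n. f (x - (1 / real (Suc n)) *\<^sub>R z) * gauss z) \<longlonglongrightarrow> f x * gauss z"
    proof (rule AE_I2, intro tendsto_mult tendsto_const)
      fix z :: 'a
      have "(\<lambda>n. x - (1 / real (Suc n)) *\<^sub>R z) \<longlonglongrightarrow> x - 0 *\<^sub>R z"
        by (intro tendsto_intros LIMSEQ_Suc[OF lim_1_over_n])
      then show "(\<lambda>n. f (x - (1 / real (Suc n)) *\<^sub>R z)) \<longlonglongrightarrow> f x"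
        using f by (intro isCont_tendsto_compose[of x f]) (auto simp: continuous_on_eq_continuous_at)
    qed
  qed (auto simp: abs_mult gauss_integrable intro!: mult_right_mono B)
  then show ?thesis by (simp add: smooth_by_def gauss_integral)
qed

text \<open>The smoothed functions are determined by the transform, and they converge back to the original
functions as the width tends to 0.\<close>

lemma fourier_inject:
  fixes f g :: "'a::euclidean_space \<Rightarrow> real"
  assumes "integrable lborel f" "integrable lborel g" "continuous_on UNIV f" "continuous_on UNIV g"
    and "\<And>x. \<bar>f x\<bar> \<le> B" "\<And>x. \<bar>g x\<bar> \<le> C" and eq: "\<And>\<xi>. fourier f \<xi> = fourier g \<xi>"
  shows "f x = g x"
proof -
  have "smooth_by \<epsilon> f x = smooth_by \<epsilon> g x" if "\<epsilon> > 0" for \<epsilon>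
  proof -
    have "complex_of_real (\<epsilon> ^ DIM('a) * smooth_by \<epsilon> f x) = complex_of_real (\<epsilon> ^ DIM('a) * smooth_by \<epsilon> g x)"
      by (simp only: smooth_by_fourier[OF assms(1) that] smooth_by_fourier[OF assms(2) that] eq)
    then show ?thesis using that unfolding of_real_eq_iff by simp
  qed
  then have "(\<lambda>n. smooth_by (1 / real (Suc n)) f x) \<longlonglongrightarrow> g x"
    using smooth_by_tendsto[OF assms(4,6)] by simp
  with smooth_by_tendsto[OF assms(3,5)] show ?thesis by (rule LIMSEQ_unique)
qed

section \<open>Convolution with integrable kernels\<close>

text \<open>The kernel comes first and may be vector valued, so that one notion covers \<open>p\<^sub>t * f\<close> and
\<open>Dp\<^sub>t * f\<close>. The kernel carries the integrability, and the translation acts on \<open>f\<close>, which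
is continuous in the applications.\<close>

definition conv :: "('a::euclidean_space \<Rightarrow> 'b::euclidean_space) \<Rightarrow> ('a \<Rightarrow> real) \<Rightarrow> 'a \<Rightarrow> 'b"
  where "conv k f x = (\<integral>y. f (x - y) *\<^sub>R k y \<partial>lborel)"

definition L1_norm :: "('a::euclidean_space \<Rightarrow> 'b::euclidean_space) \<Rightarrow> real"
  where "L1_norm k = (\<integral>y. norm (k y) \<partial>lborel)"

definition bcont :: "real \<Rightarrow> ('a::euclidean_space \<Rightarrow> real) \<Rightarrow> bool"
  where "bcont B f \<longleftrightarrow> continuous_on UNIV f \<and> (\<forall>x. \<bar>f x\<bar> \<le> B)"

lemma bcontI: "continuous_on UNIV f \<Longrightarrow> (\<And>x. \<bar>f x\<bar> \<le> B) \<Longrightarrow> bcont B f"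
  by (simp add: bcont_def)

lemma bcont_abs_le: "bcont B f \<Longrightarrow> \<bar>f x\<bar> \<le> B"
  by (simp add: bcont_def)

lemma bcont_nonneg: "bcont B f \<Longrightarrow> 0 \<le> B"
  using bcont_abs_le[of B f undefined] by linarith

lemma bcont_measurable: "bcont B f \<Longrightarrow> f \<in> borel_measurable borel"
  by (auto simp: bcont_def intro: borel_measurable_continuous_onI)

lemma L1_norm_nonneg [simp]: "0 \<le> L1_norm k"
  by (simp add: L1_norm_def)

lemma L1_norm_minus_commute: "L1_norm (\<lambda>y. k y - k' y) = L1_norm (\<lambda>y. k' y - k y)"
  by (simp add: L1_norm_def norm_minus_commute)

lemma L1_norm_triangle:
  fixes k k' :: "'a::euclidean_space \<Rightarrow> 'b::euclidean_space"
  assumes "integrable lborel k" "integrable lborel k'"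
  shows "L1_norm (\<lambda>y. k y + k' y) \<le> L1_norm k + L1_norm k'"
proof -
  have "L1_norm (\<lambda>y. k y + k' y) \<le> (\<integral>y. norm (k y) + norm (k' y) \<partial>lborel)"
    unfolding L1_norm_def using assms
    by (intro Bochner_Integration.integral_mono norm_triangle_ineq integrable_norm Bochner_Integration.integrable_add)
  then show ?thesis
    using assms by (simp add: L1_norm_def)
qed

lemma L1_norm_diff_le:
  fixes k k' :: "'a::euclidean_space \<Rightarrow> 'b::euclidean_space"
  assumes "integrable lborel k" "integrable lborel k'"
  shows "L1_norm (\<lambda>y. k y - k' y) \<le> L1_norm k + L1_norm k'"
  using L1_norm_triangle[OF assms(1), of "\<lambda>y. - k' y"] assms(2) by (simp add: L1_norm_def)

lemma integrable_conv:
  fixes k :: "'a::euclidean_space \<Rightarrow> 'b::euclidean_space" and f :: "'a \<Rightarrow> real"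
  assumes k: "integrable lborel k" and f: "bcont B f"
  shows "integrable lborel (\<lambda>y. f (x - y) *\<^sub>R k y)"
proof (rule Bochner_Integration.integrable_bound)
  have [measurable]: "f \<in> borel_measurable borel" by (rule bcont_measurable[OF f])
  have [measurable]: "k \<in> borel_measurable borel" using k by auto
  show "integrable lborel (\<lambda>y. B * norm (k y))" using k by auto
  show "AE y in lborel. norm (f (x - y) *\<^sub>R k y) \<le> norm (B * norm (k y))"
    using bcont_nonneg[OF f]
    by (intro AE_I2) (auto simp: abs_mult intro!: mult_right_mono bcont_abs_le[OF f])
  show "(\<lambda>y. f (x - y) *\<^sub>R k y) \<in> borel_measurable lborel" by measurable
qed

lemma norm_conv_le:
  fixes k :: "'a::euclidean_space \<Rightarrow> 'b::euclidean_space" and f :: "'a \<Rightarrow> real"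
  assumes k: "integrable lborel k" and f: "bcont B f"
  shows "norm (conv k f x) \<le> B * L1_norm k"
proof -
  have "norm (conv k f x) \<le> (\<integral>y. B * norm (k y) \<partial>lborel)"
    unfolding conv_def using k
    by (intro Bochner_Integration.integral_norm_bound_integral integrable_conv[OF k f])
       (auto intro!: mult_right_mono bcont_abs_le[OF f])
  then show ?thesis by (simp add: L1_norm_def)
qed

lemma conv_diff_kernel:
  fixes k :: "'a::euclidean_space \<Rightarrow> 'b::euclidean_space" and f :: "'a \<Rightarrow> real"
  assumes "integrable lborel k" "integrable lborel k'" "bcont B f"
  shows "conv k f x - conv k' f x = conv (\<lambda>y. k y - k' y) f x"
  unfolding conv_def
  by (subst Bochner_Integration.integral_diff[symmetric])
     (auto simp: scaleR_diff_right intro!: integrable_conv[OF _ assms(3)] assms)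

lemma conv_diff_fun:
  fixes k :: "'a::euclidean_space \<Rightarrow> 'b::euclidean_space" and f :: "'a \<Rightarrow> real"
  assumes "integrable lborel k" "bcont B f" "bcont C g"
  shows "conv k f x - conv k g x = conv k (\<lambda>y. f y - g y) x"
  unfolding conv_def
  by (subst Bochner_Integration.integral_diff[symmetric])
     (auto simp: scaleR_diff_left intro!: integrable_conv[OF assms(1)] assms)

lemma conv_commute:
  fixes k :: "'a::euclidean_space \<Rightarrow> 'b::euclidean_space" and f :: "'a \<Rightarrow> real"
  assumes k: "integrable lborel k" and f: "bcont B f"
  shows "conv k f x = (\<integral>y. f y *\<^sub>R k (x - y) \<partial>lborel)"
proof -
  have [measurable]: "f \<in> borel_measurable borel" by (rule bcont_measurable[OF f])
  have [measurable]: "k \<in> borel_measurable borel" using k by auto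
  show ?thesis
    unfolding conv_def by (subst integral_lborel_reflect[where x=x, symmetric]) auto
qed

lemma conv_tendsto:
  fixes k :: "'a::euclidean_space \<Rightarrow> 'b::euclidean_space" and f :: "'a \<Rightarrow> real"
  assumes k: "integrable lborel k" and B: "\<And>n. bcont B (g n)" and f: "bcont B f"
    and lim: "\<And>y. (\<lambda>n. g n (X n - y)) \<longlonglongrightarrow> f (x - y)"
  shows "(\<lambda>n. conv k (g n) (X n)) \<longlonglongrightarrow> conv k f x"
  unfolding conv_def
proof (rule integral_dominated_convergence)
  have [measurable]: "f \<in> borel_measurable borel" "g n \<in> borel_measurable borel" for n
    by (rule bcont_measurable[OF f], rule bcont_measurable[OF B])
  have [measurable]: "k \<in> borel_measurable borel" using k by auto
  show "(\<lambda>y. f (x - y) *\<^sub>R k y) \<in> borel_measurable lborel"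
    "(\<lambda>y. g n (X n - y) *\<^sub>R k y) \<in> borel_measurable lborel" for n by measurable
  show "integrable lborel (\<lambda>y. B * norm (k y))" using k by auto
  show "AE y in lborel. norm (g n (X n - y) *\<^sub>R k y) \<le> B * norm (k y)" for n
    by (auto intro!: mult_right_mono bcont_abs_le[OF B])
  show "AE y in lborel. (\<lambda>n. g n (X n - y) *\<^sub>R k y) \<longlonglongrightarrow> f (x - y) *\<^sub>R k y"
    by (intro AE_I2 tendsto_intros lim)
qed

lemma continuous_on_conv:
  fixes k :: "'a::euclidean_space \<Rightarrow> 'b::euclidean_space" and f :: "'a \<Rightarrow> real"
  assumes k: "integrable lborel k" and f: "bcont B f"
  shows "continuous_on S (conv k f)"
proof (rule continuous_on_subset[OF _ subset_UNIV], rule continuous_on_sequentiallyI)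
  fix X and x :: 'a assume "X \<longlonglongrightarrow> x"
  then show "(\<lambda>n. conv k f (X n)) \<longlonglongrightarrow> conv k f x"
    using f by (intro conv_tendsto[OF k f f] continuous_on_tendsto_compose[of UNIV f] tendsto_intros)
       (auto simp: bcont_def)
qed

lemma bcont_conv:
  fixes k f :: "'a::euclidean_space \<Rightarrow> real"
  assumes k: "integrable lborel k" and f: "bcont B f"
  shows "bcont (B * L1_norm k) (conv k f)"
  using norm_conv_le[OF k f] continuous_on_conv[OF k f] by (simp add: bcont_def)

lemma conv_product_integrable:
  fixes k :: "'a::euclidean_space \<Rightarrow> 'b::euclidean_space" and f :: "'a \<Rightarrow> real"
  assumes k: "integrable lborel k" and f: "integrable lborel f"
  shows "integrable (lborel \<Otimes>\<^sub>M lborel) (\<lambda>(y, x). f (x - y) *\<^sub>R k y)"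
proof (rule lborel_pair.Fubini_integrable)
  have [measurable]: "f \<in> borel_measurable borel" "k \<in> borel_measurable borel" using k f by auto
  show "(\<lambda>(y, x). f (x - y) *\<^sub>R k y) \<in> borel_measurable (lborel \<Otimes>\<^sub>M lborel)" by measurable
  have *: "(\<integral>x. \<bar>f (x - y)\<bar> \<partial>lborel) = L1_norm f" for y
    using integral_lborel_shift[of "\<lambda>x. \<bar>f x\<bar>" "-y"] by (simp add: L1_norm_def)
  have i: "integrable lborel (\<lambda>x. f (x - y))" for y
    using integrable_lborel_shift[OF f, of "-y"] by simp
  show "integrable lborel (\<lambda>y. \<integral>x. norm (case (y, x) of (y, x) \<Rightarrow> f (x - y) *\<^sub>R k y) \<partial>lborel)"
    using k by (simp add: *)
  show "AE y in lborel. integrable lborel (\<lambda>x. case (y, x) of (y, x) \<Rightarrow> f (x - y) *\<^sub>R k y)"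
    using i by auto
qed

lemma integrable_conv_fun:
  fixes k :: "'a::euclidean_space \<Rightarrow> 'b::euclidean_space" and f :: "'a \<Rightarrow> real"
  assumes k: "integrable lborel k" and f: "integrable lborel f"
  shows "integrable lborel (conv k f)"
  unfolding conv_def
  using lborel_pair.integrable_snd[OF conv_product_integrable[OF assms]] by simp

lemma L1_norm_conv_le:
  fixes k :: "'a::euclidean_space \<Rightarrow> 'b::euclidean_space" and f :: "'a \<Rightarrow> real"
  assumes k: "integrable lborel k" and f: "integrable lborel f"
  shows "L1_norm (conv k f) \<le> L1_norm f * L1_norm k"
proof -
  have [measurable]: "f \<in> borel_measurable borel" "k \<in> borel_measurable borel" using k f by auto
  have int: "integrable (lborel \<Otimes>\<^sub>M lborel) (\<lambda>(y, x). norm (f (x - y) *\<^sub>R k y))"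
    using integrable_norm[OF conv_product_integrable[OF assms]] by (simp add: split_def)
  have *: "(\<integral>x. \<bar>f (x - y)\<bar> \<partial>lborel) = L1_norm f" for y
    using integral_lborel_shift[of "\<lambda>x. \<bar>f x\<bar>" "-y"] by (simp add: L1_norm_def)
  have "L1_norm (conv k f) \<le> (\<integral>x. (\<integral>y. norm (f (x - y) *\<^sub>R k y) \<partial>lborel) \<partial>lborel)"
    unfolding L1_norm_def
  proof (rule integral_mono)
    show "integrable lborel (\<lambda>x. norm (conv k f x))"
      using integrable_conv_fun[OF assms] by auto
    show "integrable lborel (\<lambda>x. \<integral>y. norm (f (x - y) *\<^sub>R k y) \<partial>lborel)"
      using lborel_pair.integrable_snd[OF int] by simp
    show "norm (conv k f x) \<le> (\<integral>y. norm (f (x - y) *\<^sub>R k y) \<partial>lborel)" for x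
      unfolding conv_def by (rule integral_norm_bound)
  qed
  also have "\<dots> = (\<integral>y. (\<integral>x. norm (f (x - y) *\<^sub>R k y) \<partial>lborel) \<partial>lborel)"
    by (rule lborel_pair.Fubini_integral[OF int])
  also have "\<dots> = L1_norm f * L1_norm k"
    by (simp add: *) (simp add: L1_norm_def)
  finally show ?thesis .
qed

lemma fourier_conv:
  fixes k f :: "'a::euclidean_space \<Rightarrow> real"
  assumes k: "integrable lborel k" and f: "integrable lborel f"
  shows "fourier (conv k f) \<xi> = fourier f \<xi> * fourier k \<xi>"
proof -
  have [measurable]: "f \<in> borel_measurable borel" "k \<in> borel_measurable borel" using k f by auto
  define e where "e x = exp (- (\<i> * complex_of_real (\<xi> \<bullet> x)))" for x :: 'a
  have e_add: "e x = e (x - y) * e y" for x y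
    by (simp add: e_def exp_add[symmetric] inner_diff_right algebra_simps)
  have [measurable]: "e \<in> borel_measurable borel" unfolding e_def
    by (intro borel_measurable_continuous_onI continuous_intros)
  have int: "integrable (lborel \<Otimes>\<^sub>M lborel) (\<lambda>(y, x). e x * complex_of_real (f (x - y) * k y))"
    by (rule Bochner_Integration.integrable_bound[OF conv_product_integrable[OF assms]])
       (auto simp: norm_mult e_def)
  have "fourier (conv k f) \<xi> = (\<integral>x. (\<integral>y. e x * complex_of_real (f (x - y) * k y) \<partial>lborel) \<partial>lborel)"
    unfolding fourier_def e_def[symmetric] conv_def
    by (simp only: real_scaleR_def integral_mult_right_zero integral_complex_of_real)
  also have "\<dots> = (\<integral>y. (\<integral>x. e x * complex_of_real (f (x - y) * k y) \<partial>lborel) \<partial>lborel)"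
    by (rule lborel_pair.Fubini_integral[OF int])
  also have "\<dots> = (\<integral>y. (\<integral>x. e (x - y) * complex_of_real (f (x - y)) \<partial>lborel) * (e y * complex_of_real (k y)) \<partial>lborel)"
  proof (rule Bochner_Integration.integral_cong[OF refl])
    fix y
    have "e x * complex_of_real (f (x - y) * k y) = (e (x - y) * complex_of_real (f (x - y))) * (e y * complex_of_real (k y))" for x
      by (subst e_add[of _ y]) simp
    then show "(\<integral>x. e x * complex_of_real (f (x - y) * k y) \<partial>lborel) =
        (\<integral>x. e (x - y) * complex_of_real (f (x - y)) \<partial>lborel) * (e y * complex_of_real (k y))"
      by (simp only: integral_mult_left_zero)
  qed
  also have "\<dots> = (\<integral>y. fourier f \<xi> * (e y * complex_of_real (k y)) \<partial>lborel)"
  proof (rule Bochner_Integration.integral_cong[OF refl])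
    fix y
    show "(\<integral>x. e (x - y) * complex_of_real (f (x - y)) \<partial>lborel) * (e y * complex_of_real (k y)) =
      fourier f \<xi> * (e y * complex_of_real (k y))"
      using integral_lborel_shift[of "\<lambda>x. e x * complex_of_real (f x)" "-y"]
      by (simp add: fourier_def e_def[symmetric])
  qed
  also have "\<dots> = fourier f \<xi> * fourier k \<xi>"
    by (simp add: fourier_def e_def[symmetric])
  finally show ?thesis .
qed

section \<open>Gradients and integrals\<close>

text \<open>The fundamental theorem of calculus along the segment from \<open>y\<close> to \<open>y + h\<close>.\<close>

lemma has_bochner_integral_GDERIV_line:
  fixes p :: "'a::euclidean_space \<Rightarrow> real"
  assumes D: "\<And>x. GDERIV p x :> q x" and q: "continuous_on UNIV q"
  shows "has_bochner_integral lborel (\<lambda>\<theta>. indicator {0..1::real} \<theta> *\<^sub>R (h \<bullet> q (y + \<theta> *\<^sub>R h))) (p (y + h) - p y)"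
proof -
  have "has_bochner_integral lborel (\<lambda>\<theta>. indicator {0..1::real} \<theta> *\<^sub>R (h \<bullet> q (y + \<theta> *\<^sub>R h)))
     ((\<lambda>\<theta>. p (y + \<theta> *\<^sub>R h)) 1 - (\<lambda>\<theta>. p (y + \<theta> *\<^sub>R h)) 0)"
  proof (rule has_bochner_integral_FTC_Icc)
    fix \<theta> :: real
    have "((\<lambda>\<theta>. p (y + \<theta> *\<^sub>R h)) has_derivative (\<lambda>t. (t *\<^sub>R h) \<bullet> q (y + \<theta> *\<^sub>R h))) (at \<theta> within {0..1})"
      by (rule has_derivative_compose[where g=p, OF _ D[unfolded gderiv_def]])
         (auto intro!: derivative_eq_intros)
    then show "((\<lambda>\<theta>. p (y + \<theta> *\<^sub>R h)) has_vector_derivative h \<bullet> q (y + \<theta> *\<^sub>R h)) (at \<theta> within {0..1})"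
      by (simp add: has_vector_derivative_def)
    show "continuous_on {0..1} (\<lambda>\<theta>. h \<bullet> q (y + \<theta> *\<^sub>R h))"
      by (intro continuous_intros continuous_on_compose2[OF q]) auto
  qed simp
  then show ?thesis by simp
qed

lemma Lipschitz_of_bounded_gradient:
  fixes f :: "'a::euclidean_space \<Rightarrow> real"
  assumes D: "\<And>x. GDERIV f x :> D x" and C: "\<And>x. norm (D x) \<le> C"
  shows "\<bar>f x - f y\<bar> \<le> C * norm (x - y)"
proof -
  have "norm (f x - f y) \<le> C * norm (x - y)"
  proof (rule differentiable_bound[OF convex_UNIV])
    show "(f has_derivative (\<lambda>h. h \<bullet> D z)) (at z within UNIV)" for z
      using D[of z] by (simp add: gderiv_def)
    show "onorm (\<lambda>h. h \<bullet> D z) \<le> C" for z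
    proof (rule onorm_le)
      fix h
      have "norm (h \<bullet> D z) \<le> norm h * norm (D z)" by (simp add: Cauchy_Schwarz_ineq2)
      also have "\<dots> \<le> norm h * C" by (intro mult_left_mono C) auto
      finally show "norm (h \<bullet> D z) \<le> C * norm h" by (simp add: mult.commute)
    qed
  qed auto
  then show ?thesis by simp
qed

text \<open>A converse to the fundamental theorem. It makes differentiability accessible to Fubini's theorem,
since the hypothesis only speaks of integrals.\<close>

lemma GDERIV_from_line_integral:
  fixes F :: "'a::euclidean_space \<Rightarrow> real"
  assumes G: "continuous_on UNIV G"
    and eq: "\<And>h. F (x + h) - F x = (\<integral>\<theta>. indicator {0..1::real} \<theta> *\<^sub>R (h \<bullet> G (x + \<theta> *\<^sub>R h)) \<partial>lborel)"
  shows "GDERIV F x :> G x"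
  unfolding gderiv_def has_derivative_at_alt
proof (intro conjI allI impI)
  show "bounded_linear (\<lambda>h. h \<bullet> G x)" by (rule bounded_linear_inner_left)
  fix e :: real assume e: "e > 0"
  have "isCont G x" using G by (simp add: continuous_on_eq_continuous_at)
  then obtain d where d: "d > 0" and dG: "\<And>y. norm (y - x) < d \<Longrightarrow> norm (G y - G x) < e"
    using e unfolding continuous_at_eps_delta dist_norm by blast
  show "\<exists>d>0. \<forall>y. norm (y - x) < d \<longrightarrow> norm (F y - F x - (y - x) \<bullet> G x) \<le> e * norm (y - x)"
  proof (intro exI conjI allI impI, rule d)
    fix y assume y: "norm (y - x) < d"
    define h where "h = y - x"
    have c: "continuous_on {0..1} (\<lambda>\<theta>. h \<bullet> G (x + \<theta> *\<^sub>R h))"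
      by (intro continuous_intros continuous_on_compose2[OF G]) auto
    have i1: "integrable lborel (\<lambda>\<theta>. indicator {0..1::real} \<theta> *\<^sub>R (h \<bullet> G (x + \<theta> *\<^sub>R h)))"
      using borel_integrable_compact[OF _ c] by auto
    have i2: "integrable lborel (\<lambda>\<theta>. indicator {0..1::real} \<theta> *\<^sub>R C)" for C :: real
      by auto
    have "F y - F x - h \<bullet> G x = (\<integral>\<theta>. indicator {0..1::real} \<theta> *\<^sub>R (h \<bullet> G (x + \<theta> *\<^sub>R h)) \<partial>lborel) -
          (\<integral>\<theta>. indicator {0..1::real} \<theta> *\<^sub>R (h \<bullet> G x) \<partial>lborel)"
      using eq[of h] by (simp add: h_def)
    also have "\<dots> = (\<integral>\<theta>. indicator {0..1::real} \<theta> *\<^sub>R (h \<bullet> (G (x + \<theta> *\<^sub>R h) - G x)) \<partial>lborel)"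
      by (subst Bochner_Integration.integral_diff[OF i1 i2, symmetric]) (simp add: algebra_simps inner_diff_right)
    also have "norm \<dots> \<le> (\<integral>\<theta>. indicator {0..1::real} \<theta> *\<^sub>R (e * norm h) \<partial>lborel)"
    proof (rule Bochner_Integration.integral_norm_bound_integral)
      show "integrable lborel (\<lambda>\<theta>. indicator {0..1::real} \<theta> *\<^sub>R (h \<bullet> (G (x + \<theta> *\<^sub>R h) - G x)))"
        using Bochner_Integration.integrable_diff[OF i1 i2[of "h \<bullet> G x"]] by (simp add: algebra_simps inner_diff_right)
      show "integrable lborel (\<lambda>\<theta>. indicator {0..1::real} \<theta> *\<^sub>R (e * norm h))" by (rule i2)
      fix \<theta> :: real
      show "norm (indicator {0..1} \<theta> *\<^sub>R (h \<bullet> (G (x + \<theta> *\<^sub>R h) - G x))) \<le> indicator {0..1} \<theta> *\<^sub>R (e * norm h)"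
      proof (cases "\<theta> \<in> {0..1}")
        case True
        have "norm (x + \<theta> *\<^sub>R h - x) \<le> 1 * norm h" using True mult_right_mono[of \<theta> 1 "norm h"] by simp
        then have "norm (G (x + \<theta> *\<^sub>R h) - G x) \<le> e"
          using dG[of "x + \<theta> *\<^sub>R h"] y by (simp add: h_def)
        then have "\<bar>h \<bullet> (G (x + \<theta> *\<^sub>R h) - G x)\<bar> \<le> norm h * e"
          by (intro order_trans[OF Cauchy_Schwarz_ineq2] mult_left_mono) auto
        then show ?thesis using True by (simp add: mult_ac)
      qed simp
    qed
    also have "\<dots> = e * norm h" by simp
    finally show "norm (F y - F x - (y - x) \<bullet> G x) \<le> e * norm (y - x)" by (simp add: h_def)
  qed
qed

text \<open>Testing the difference quotient in the direction of the gradient itself.\<close>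

lemma norm_gradient_le_Lipschitz:
  fixes f :: "'a::euclidean_space \<Rightarrow> real"
  assumes D: "GDERIV f x :> d" and lip: "\<And>y. \<bar>f y - f x\<bar> \<le> K * norm (y - x)"
  shows "norm d \<le> K"
proof -
  have "((\<lambda>t. f (x + t *\<^sub>R d)) has_derivative (\<lambda>t. (t *\<^sub>R d) \<bullet> d)) (at 0)"
    by (rule has_derivative_compose[where g=f])
       (use D in \<open>auto simp: gderiv_def intro!: derivative_eq_intros\<close>)
  then have "((\<lambda>t. f (x + t *\<^sub>R d)) has_real_derivative d \<bullet> d) (at 0)"
    by (simp add: has_field_derivative_def mult_commute_abs)
  then have lim: "((\<lambda>t. (f (x + t *\<^sub>R d) - f x) / t) \<longlongrightarrow> d \<bullet> d) (at 0)"
    by (simp add: DERIV_def)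
  have "(f (x + t *\<^sub>R d) - f x) / t \<le> K * norm d" if "t \<noteq> 0" for t
  proof -
    have "\<bar>(f (x + t *\<^sub>R d) - f x) / t\<bar> \<le> K * norm d"
      using lip[of "x + t *\<^sub>R d"] that by (simp add: abs_divide field_simps)
    then show ?thesis by linarith
  qed
  then have "d \<bullet> d \<le> K * norm d"
    by (intro tendsto_upperbound[OF lim]) (auto simp: eventually_at_filter)
  then have "norm d * norm d \<le> K * norm d" by (simp add: power2_norm_eq_inner[symmetric] power2_eq_square)
  moreover have "0 \<le> K" if "norm d = 0"
    using lip[of "x + (SOME b. b \<in> Basis)"] some_in_eq[of "Basis::'a set"] by auto
  ultimately show ?thesis by (cases "norm d = 0") auto
qed

text \<open>Differentiation under the integral sign: the mean value inequality bounds the difference quotients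
of \<open>f s\<close> by \<open>b s\<close>, and dominated convergence applies.\<close>

lemma GDERIV_lebesgue_integral:
  fixes f :: "'s \<Rightarrow> 'a::euclidean_space \<Rightarrow> real"
  assumes D: "\<And>s x. GDERIV (f s) x :> G s x" and b: "\<And>s x. norm (G s x) \<le> b s"
    and b_int: "integrable N b" and f_int: "\<And>x. integrable N (\<lambda>s. f s x)"
    and G_meas [measurable]: "\<And>x. (\<lambda>s. G s x) \<in> borel_measurable N"
  shows "GDERIV (\<lambda>x. \<integral>s. f s x \<partial>N) x :> (\<integral>s. G s x \<partial>N)"
  unfolding gderiv_def has_derivative_iff_norm
proof (rule conjI[OF bounded_linear_inner_left], unfold tendsto_at_iff_sequentially comp_def, intro allI impI)
  fix X assume X': "\<forall>i. X i \<in> UNIV - {x}" and lim: "X \<longlonglongrightarrow> x"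
  then have X: "X n \<noteq> x" for n by auto
  have [measurable]: "(\<lambda>s. f s x) \<in> borel_measurable N" for x using f_int by auto
  have G_int: "integrable N (\<lambda>s. G s x)"
    by (rule Bochner_Integration.integrable_bound[OF b_int]) (use b in \<open>auto intro: order_trans[OF _ abs_ge_self]\<close>)
  have lip: "norm (f s y - f s z) \<le> b s * norm (y - z)" for s y z
    using Lipschitz_of_bounded_gradient[OF D b, of s y z] by simp
  define R where "R n s = (f s (X n) - f s x - (X n - x) \<bullet> G s x) / norm (X n - x)" for n s
  have Rb: "norm (R n s) \<le> 2 * b s" for n s
  proof -
    have "norm (f s (X n) - f s x - (X n - x) \<bullet> G s x) \<le> b s * norm (X n - x) + norm (X n - x) * norm (G s x)"
      by (rule order_trans[OF norm_triangle_ineq4 add_mono[OF lip]]) (simp add: Cauchy_Schwarz_ineq2)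
    also have "\<dots> \<le> 2 * b s * norm (X n - x)"
      using mult_left_mono[OF b[of s x], of "norm (X n - x)"] by (simp add: mult.commute)
    finally show ?thesis using X[of n] by (simp add: R_def field_simps)
  qed
  have R0: "(\<lambda>n. R n s) \<longlonglongrightarrow> 0" for s
  proof -
    have "((\<lambda>y. norm (f s y - f s x - (y - x) \<bullet> G s x) / norm (y - x)) \<longlongrightarrow> 0) (at x)"
      using D[of s x] unfolding gderiv_def has_derivative_iff_norm by simp
    then have "(\<lambda>n. norm (f s (X n) - f s x - (X n - x) \<bullet> G s x) / norm (X n - x)) \<longlonglongrightarrow> 0"
      using X' lim unfolding tendsto_at_iff_sequentially comp_def by blast
    then have "(\<lambda>n. norm (R n s)) \<longlonglongrightarrow> 0" by (simp add: R_def norm_divide)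
    then show ?thesis by (rule tendsto_norm_zero_cancel)
  qed
  have "(\<lambda>n. \<integral>s. R n s \<partial>N) \<longlonglongrightarrow> (\<integral>s. 0 \<partial>N)"
  proof (rule integral_dominated_convergence[where w="\<lambda>s. 2 * b s"])
    show "R n \<in> borel_measurable N" for n unfolding R_def by measurable
  qed (use b_int R0 Rb in auto)
  moreover have "(\<integral>s. R n s \<partial>N) = ((\<integral>s. f s (X n) \<partial>N) - (\<integral>s. f s x \<partial>N) - (X n - x) \<bullet> (\<integral>s. G s x \<partial>N)) / norm (X n - x)" for n
    unfolding R_def using f_int G_int by simp
  ultimately show "(\<lambda>n. norm ((\<integral>s. f s (X n) \<partial>N) - (\<integral>s. f s x \<partial>N) - (X n - x) \<bullet> (\<integral>s. G s x \<partial>N)) / norm (X n - x)) \<longlonglongrightarrow> 0"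
    using tendsto_norm_zero[of "\<lambda>n. \<integral>s. R n s \<partial>N" sequentially] by simp
qed

lemma inner_conv:
  fixes k :: "'a::euclidean_space \<Rightarrow> 'b::euclidean_space" and f :: "'a \<Rightarrow> real"
  assumes k: "integrable lborel k" and f: "bcont B f"
  shows "h \<bullet> conv k f x = (\<integral>y. f (x - y) * (h \<bullet> k y) \<partial>lborel)"
  unfolding conv_def
  by (subst integral_inner_right[symmetric]) (auto intro!: integrable_conv[OF k f])

text \<open>The derivative falls on the kernel. A dominating function for \<open>q (x - y)\<close>, uniform for \<open>x\<close> near a
point, need not exist, so the usual differentiation under the integral does not apply. Instead
the increment of \<open>p\<close> is written as a line integral and the integrals are exchanged by Fubini's
theorem, whose hypothesis is that the gradient lies in \<open>L\<^sup>1\<close>.\<close>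

lemma GDERIV_conv:
  fixes p f :: "'a::euclidean_space \<Rightarrow> real"
  assumes D: "\<And>x. GDERIV p x :> q x" and q: "continuous_on UNIV q"
    and p_int: "integrable lborel p" and q_int: "integrable lborel q" and f: "bcont B f"
  shows "GDERIV (conv p f) x :> conv q f x"
proof (rule GDERIV_from_line_integral)
  have [measurable]: "f \<in> borel_measurable borel" by (rule bcont_measurable[OF f])
  have [measurable]: "q \<in> borel_measurable borel" "p \<in> borel_measurable borel" using q_int p_int by auto
  show "continuous_on UNIV (conv q f)" by (rule continuous_on_conv[OF q_int f])
  fix h :: 'a
  have p_sh: "integrable lborel (\<lambda>y. p (y + z))" for z
    by (rule integrable_lborel_shift[OF p_int])
  have q_sh: "integrable lborel (\<lambda>y. q (y + z))" for z
    by (rule integrable_lborel_shift[OF q_int])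
  let ?g = "\<lambda>\<theta> y. indicator {0..1::real} \<theta> *\<^sub>R (f (x - y) * (h \<bullet> q (y + \<theta> *\<^sub>R h)))"
  have g_int: "integrable lborel (?g \<theta>)" for \<theta>
  proof -
    have "integrable lborel (\<lambda>y. h \<bullet> (f (x - y) *\<^sub>R q (y + \<theta> *\<^sub>R h)))"
      by (intro integrable_inner_right impI integrable_conv[OF q_sh f])
    then show ?thesis by simp
  qed
  have sh: "(\<integral>y. f (x - y) * (h \<bullet> q (y + \<theta> *\<^sub>R h)) \<partial>lborel) = h \<bullet> conv q f (x + \<theta> *\<^sub>R h)" for \<theta>
  proof -
    have "h \<bullet> conv q f (x + \<theta> *\<^sub>R h) = (\<integral>y. f (x + \<theta> *\<^sub>R h - y) * (h \<bullet> q y) \<partial>lborel)"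
      by (rule inner_conv[OF q_int f])
    also have "\<dots> = (\<integral>y. f (x + \<theta> *\<^sub>R h - (y + \<theta> *\<^sub>R h)) * (h \<bullet> q (y + \<theta> *\<^sub>R h)) \<partial>lborel)"
      by (rule integral_lborel_shift[symmetric]) measurable
    finally show ?thesis by simp
  qed
  have norm_le: "(\<integral>y. norm (?g \<theta> y) \<partial>lborel) \<le> indicator {0..1} \<theta> * (B * (norm h * L1_norm q))" for \<theta>
  proof -
    have "(\<integral>y. norm (?g \<theta> y) \<partial>lborel) \<le> (\<integral>y. indicator {0..1} \<theta> * (B * (norm h * norm (q (y + \<theta> *\<^sub>R h)))) \<partial>lborel)"
    proof (rule integral_mono)
      show "norm (?g \<theta> y) \<le> indicator {0..1} \<theta> * (B * (norm h * norm (q (y + \<theta> *\<^sub>R h))))" for y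
        using bcont_nonneg[OF f]
        by (auto simp: abs_mult intro!: mult_left_mono mult_mono bcont_abs_le[OF f] Cauchy_Schwarz_ineq2)
    qed (use g_int q_sh in \<open>auto intro: integrable_norm\<close>)
    also have "\<dots> = indicator {0..1} \<theta> * (B * (norm h * L1_norm q))"
      using integral_lborel_shift[of "\<lambda>y. norm (q y)" "\<theta> *\<^sub>R h"] by (simp add: L1_norm_def)
    finally show ?thesis .
  qed
  have int: "integrable (lborel \<Otimes>\<^sub>M lborel) (\<lambda>(\<theta>, y). ?g \<theta> y)"
  proof (rule lborel_pair.Fubini_integrable)
    show "(\<lambda>(\<theta>, y). ?g \<theta> y) \<in> borel_measurable (lborel \<Otimes>\<^sub>M lborel)" by measurable
    show "integrable lborel (\<lambda>\<theta>. \<integral>y. norm (case (\<theta>, y) of (\<theta>, y) \<Rightarrow> ?g \<theta> y) \<partial>lborel)"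
    proof (rule Bochner_Integration.integrable_bound)
      show "integrable lborel (\<lambda>\<theta>. indicator {0..1::real} \<theta> * (B * (norm h * L1_norm q)))" by auto
      show "(\<lambda>\<theta>. \<integral>y. norm (case (\<theta>, y) of (\<theta>, y) \<Rightarrow> ?g \<theta> y) \<partial>lborel) \<in> borel_measurable lborel"
        by measurable
      show "AE \<theta> in lborel. norm (\<integral>y. norm (case (\<theta>, y) of (\<theta>, y) \<Rightarrow> ?g \<theta> y) \<partial>lborel) \<le>
        norm (indicator {0..1::real} \<theta> * (B * (norm h * L1_norm q)))"
        by (intro AE_I2) (use norm_le in \<open>auto intro: order_trans[OF _ abs_ge_self]\<close>)
    qed
    show "AE \<theta> in lborel. integrable lborel (\<lambda>y. case (\<theta>, y) of (\<theta>, y) \<Rightarrow> ?g \<theta> y)"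
      using g_int by auto
  qed
  have "conv p f (x + h) - conv p f x = (\<integral>y. f (x - y) * p (y + h) \<partial>lborel) - (\<integral>y. f (x - y) * p y \<partial>lborel)"
    using integral_lborel_shift[of "\<lambda>y. f (x + h - y) * p y" h] by (simp add: conv_def)
  also have "\<dots> = (\<integral>y. f (x - y) * (p (y + h) - p y) \<partial>lborel)"
    using integrable_conv[OF p_sh f, of x h] integrable_conv[OF p_int f, of x]
    by (subst Bochner_Integration.integral_diff[symmetric]) (auto simp: algebra_simps)
  also have "\<dots> = (\<integral>y. (\<integral>\<theta>. ?g \<theta> y \<partial>lborel) \<partial>lborel)"
    using has_bochner_integral_integral_eq[OF has_bochner_integral_GDERIV_line[OF D q], symmetric]
    by (simp add: mult.left_commute)
  also have "\<dots> = (\<integral>\<theta>. (\<integral>y. ?g \<theta> y \<partial>lborel) \<partial>lborel)"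
    by (rule lborel_pair.Fubini_integral[OF int])
  also have "\<dots> = (\<integral>\<theta>. indicator {0..1::real} \<theta> *\<^sub>R (h \<bullet> conv q f (x + \<theta> *\<^sub>R h)) \<partial>lborel)"
    by (simp add: sh)
  finally show "conv p f (x + h) - conv p f x = \<dots>" .
qed

section \<open>Time regularity of a semigroup of densities\<close>

text \<open>The facts about a heat kernel on which its regularity in time rests. The semigroup law is encoded
in the exponential form of the Fourier transform.\<close>

locale fourier_semigroup =
  fixes p :: "real \<Rightarrow> 'a::euclidean_space \<Rightarrow> real" and Dp :: "real \<Rightarrow> 'a \<Rightarrow> 'a"
    and \<psi> :: "'a \<Rightarrow> complex" and T :: real
  assumes p_nonneg: "t \<in> {0<..T} \<Longrightarrow> 0 \<le> p t x"
    and p_integrable: "t \<in> {0<..T} \<Longrightarrow> integrable lborel (p t)"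
    and p_mass: "t \<in> {0<..T} \<Longrightarrow> L1_norm (p t) = 1"
    and p_fourier: "t \<in> {0<..T} \<Longrightarrow> fourier (p t) \<xi> = exp (- (complex_of_real t * \<psi> \<xi>))"
    and p_GDERIV: "t \<in> {0<..T} \<Longrightarrow> GDERIV (p t) x :> Dp t x"
    and p_bounded: "t \<in> {0<..T} \<Longrightarrow> \<exists>B. \<forall>x. \<bar>p t x\<bar> \<le> B"
    and Dp_cont: "t \<in> {0<..T} \<Longrightarrow> continuous_on UNIV (Dp t)"
    and Dp_bounded: "t \<in> {0<..T} \<Longrightarrow> \<exists>C. \<forall>x. norm (Dp t x) \<le> C"
    and Dp_integrable: "t \<in> {0<..T} \<Longrightarrow> integrable lborel (Dp t)"
begin

lemma p_cont: "t \<in> {0<..T} \<Longrightarrow> continuous_on S (p t)"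
  using p_GDERIV unfolding gderiv_def
  by (intro continuous_at_imp_continuous_on ballI has_derivative_continuous)

lemma p_bcont: "t \<in> {0<..T} \<Longrightarrow> \<exists>B. bcont B (p t)"
  using p_bounded[of t] p_cont[of t] by (auto simp: bcont_def)

text \<open>Both sides have the Fourier transform \<open>exp (- (s + t) \<psi>)\<close>, and both are bounded and continuous.\<close>

lemma p_semigroup:
  assumes s: "s > 0" and t: "t > 0" and st: "s + t \<le> T"
  shows "p (s + t) x = conv (p s) (p t) x"
proof -
  have in': "s \<in> {0<..T}" "t \<in> {0<..T}" "s + t \<in> {0<..T}" using s t st by auto
  obtain B where B: "bcont B (p t)" using p_bcont[OF in'(2)] by auto
  obtain C where C: "bcont C (p (s + t))" using p_bcont[OF in'(3)] by auto
  have D: "bcont (B * L1_norm (p s)) (conv (p s) (p t))"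
    by (rule bcont_conv[OF p_integrable[OF in'(1)] B])
  show ?thesis
  proof (rule fourier_inject[where f="p (s + t)" and g="conv (p s) (p t)" and x=x])
    show "integrable lborel (p (s + t))" "integrable lborel (conv (p s) (p t))"
      by (intro p_integrable integrable_conv_fun in')+
    show "continuous_on UNIV (p (s + t))" by (rule p_cont[OF in'(3)])
    show "continuous_on UNIV (conv (p s) (p t))" using D by (simp add: bcont_def)
    show "\<bar>p (s + t) x\<bar> \<le> C" for x by (rule bcont_abs_le[OF C])
    show "\<bar>conv (p s) (p t) x\<bar> \<le> B * L1_norm (p s)" for x by (rule bcont_abs_le[OF D])
    show "fourier (p (s + t)) \<xi> = fourier (conv (p s) (p t)) \<xi>" for \<xi>
      using in' by (simp add: fourier_conv p_integrable p_fourier exp_add[symmetric] algebra_simps)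
  qed
qed

lemma p_semigroup_diff:
  assumes "0 < r" "r < s" "s \<le> T"
  shows "p s = conv (p r) (p (s - r))"
  using p_semigroup[of r "s - r"] assms by auto

lemma Dp_semigroup:
  assumes "0 < r" "r < s" "s \<le> T"
  shows "Dp s = conv (Dp r) (p (s - r))"
proof
  fix x
  have r: "r \<in> {0<..T}" "s \<in> {0<..T}" "s - r \<in> {0<..T}" using assms by auto
  obtain B where "bcont B (p (s - r))" using p_bcont[OF r(3)] by auto
  then have "GDERIV (p s) x :> conv (Dp r) (p (s - r)) x"
    unfolding p_semigroup_diff[OF assms]
    by (intro GDERIV_conv p_GDERIV Dp_cont p_integrable Dp_integrable r)
  from has_derivative_unique[OF this[unfolded gderiv_def] p_GDERIV[OF r(2), unfolded gderiv_def]]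
  show "Dp s x = conv (Dp r) (p (s - r)) x"
    by (metis inner_commute vector_eq_rdot)
qed

text \<open>For \<open>s > r\<close> the density \<open>p s\<close> is an average of translates of \<open>p r\<close>, so it inherits the sup bound
and the Lipschitz constant of \<open>p r\<close>.\<close>

lemma p_equi_bounds:
  assumes r: "r \<in> {0<..T}"
  obtains B C where "\<And>s x. s \<in> {r..T} \<Longrightarrow> \<bar>p s x\<bar> \<le> B"
    and "\<And>s x y. s \<in> {r..T} \<Longrightarrow> \<bar>p s x - p s y\<bar> \<le> C * norm (x - y)"
proof -
  obtain B where B: "bcont B (p r)" using p_bcont[OF r] by auto
  obtain C where C: "\<And>x. norm (Dp r x) \<le> C" using Dp_bounded[OF r] by auto
  have eq: "p s x = conv (p (s - r)) (p r) x" "L1_norm (p (s - r)) = 1" "integrable lborel (p (s - r))"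
    if "s \<in> {r<..T}" for s x
    using p_semigroup[of "s - r" r x] that r p_mass[of "s - r"] p_integrable[of "s - r"] by auto
  have "\<bar>p s x\<bar> \<le> B" if s: "s \<in> {r..T}" for s x
  proof (cases "s = r")
    case False
    then have "s \<in> {r<..T}" using s by auto
    from norm_conv_le[OF eq(3)[OF this] B] show ?thesis using eq[OF \<open>s \<in> {r<..T}\<close>] by simp
  qed (use bcont_abs_le[OF B] in auto)
  moreover have "\<bar>p s x - p s y\<bar> \<le> C * norm (x - y)" if s: "s \<in> {r..T}" for s x y
  proof (cases "s = r")
    case True then show ?thesis using Lipschitz_of_bounded_gradient[OF p_GDERIV[OF r] C] by simp
  next
    case False
    then have s': "s \<in> {r<..T}" using s by auto
    note e = eq[OF s']
    have bc: "bcont (C * norm (x - y)) (\<lambda>z. p r (z + (x - y)) - p r z)"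
    proof (rule bcontI)
      show "continuous_on UNIV (\<lambda>z. p r (z + (x - y)) - p r z)"
        by (intro continuous_intros p_cont[OF r] continuous_on_compose2[OF p_cont[OF r, of UNIV]]) auto
      show "\<bar>p r (z + (x - y)) - p r z\<bar> \<le> C * norm (x - y)" for z
        using Lipschitz_of_bounded_gradient[OF p_GDERIV[OF r] C, of "z + (x - y)" z] by simp
    qed
    have sh: "bcont B (\<lambda>z. p r (z + (x - y)))"
      using B by (auto simp: bcont_def intro!: continuous_intros p_cont[OF r] continuous_on_compose2[OF p_cont[OF r, of UNIV]])
    have "p s x - p s y = conv (p (s - r)) (\<lambda>z. p r (z + (x - y)) - p r z) y"
      unfolding conv_diff_fun[OF e(3) sh B, symmetric] e(1)
      by (simp add: conv_def algebra_simps)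
    also have "\<bar>\<dots>\<bar> \<le> C * norm (x - y) * L1_norm (p (s - r))"
      using norm_conv_le[OF e(3) bc] by simp
    finally show ?thesis using e(2) by simp
  qed
  ultimately show thesis by (rule that)
qed

text \<open>In the Fourier representation of the smoothed density time enters only through \<open>exp (- t \<psi>)\<close>,
which is continuous in \<open>t\<close> and has modulus at most 1.\<close>

lemma smooth_by_p_tendsto:
  assumes t: "t \<in> {0<..T}" and S: "\<And>n. S n \<in> {0<..T}" and lim: "S \<longlonglongrightarrow> t" and \<epsilon>: "\<epsilon> > 0"
  shows "(\<lambda>n. smooth_by \<epsilon> (p (S n)) x) \<longlonglongrightarrow> smooth_by \<epsilon> (p t) x"
proof -
  let ?I = "\<lambda>s. (\<integral>\<xi>. complex_of_real (gauss \<xi>) * exp (\<i> * complex_of_real (\<xi> \<bullet> x / \<epsilon>)) * fourier (p s) (\<xi> /\<^sub>R \<epsilon>) \<partial>lborel)"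
  have fm: "fourier (p s) \<in> borel_measurable borel" if "s \<in> {0<..T}" for s
  proof -
    have [measurable]: "p s \<in> borel_measurable borel" using p_integrable[OF that] by auto
    have [measurable]: "(\<lambda>(\<xi>::'a, x). exp (- (\<i> * complex_of_real (\<xi> \<bullet> x)))) \<in> borel_measurable (borel \<Otimes>\<^sub>M borel)"
      unfolding split_def by (simp add: borel_prod)
        (intro borel_measurable_continuous_onI continuous_intros)
    have "(\<lambda>\<xi>. fourier (p s) \<xi>) \<in> borel_measurable borel"
      unfolding fourier_def by measurable
    then show ?thesis by simp
  qed
  have fb: "norm (fourier (p s) \<xi>) \<le> 1" if "s \<in> {0<..T}" for s \<xi>
  proof -
    have "norm (fourier (p s) \<xi>) \<le> (\<integral>x. norm (exp (- (\<i> * complex_of_real (\<xi> \<bullet> x))) * complex_of_real (p s x)) \<partial>lborel)"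
      unfolding fourier_def by (rule integral_norm_bound)
    also have "\<dots> = L1_norm (p s)" by (simp add: norm_mult L1_norm_def)
    finally show ?thesis using p_mass[OF that] by simp
  qed
  have "(\<lambda>n. ?I (S n)) \<longlonglongrightarrow> ?I t"
  proof (rule integral_dominated_convergence)
    show "AE \<xi> in lborel. (\<lambda>n. complex_of_real (gauss \<xi>) * exp (\<i> * complex_of_real (\<xi> \<bullet> x / \<epsilon>)) * fourier (p (S n)) (\<xi> /\<^sub>R \<epsilon>))
      \<longlonglongrightarrow> complex_of_real (gauss \<xi>) * exp (\<i> * complex_of_real (\<xi> \<bullet> x / \<epsilon>)) * fourier (p t) (\<xi> /\<^sub>R \<epsilon>)"
      unfolding p_fourier[OF t] p_fourier[OF S] by (intro AE_I2 tendsto_intros lim)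
    show "integrable lborel (gauss :: 'a \<Rightarrow> real)" by (rule gauss_integrable)
    have m: "(\<lambda>\<xi>. complex_of_real (gauss \<xi>) * exp (\<i> * complex_of_real (\<xi> \<bullet> x / \<epsilon>)) * fourier (p s) (\<xi> /\<^sub>R \<epsilon>)) \<in> borel_measurable lborel"
      if "s \<in> {0<..T}" for s
      using fm[OF that] by measurable
    show "(\<lambda>\<xi>. complex_of_real (gauss \<xi>) * exp (\<i> * complex_of_real (\<xi> \<bullet> x / \<epsilon>)) * fourier (p t) (\<xi> /\<^sub>R \<epsilon>)) \<in> borel_measurable lborel"
      by (rule m[OF t])
    show "(\<lambda>\<xi>. complex_of_real (gauss \<xi>) * exp (\<i> * complex_of_real (\<xi> \<bullet> x / \<epsilon>)) * fourier (p (S n)) (\<xi> /\<^sub>R \<epsilon>)) \<in> borel_measurable lborel" for n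
      by (rule m[OF S])
    show "AE \<xi> in lborel. norm (complex_of_real (gauss \<xi>) * exp (\<i> * complex_of_real (\<xi> \<bullet> x / \<epsilon>)) * fourier (p (S n)) (\<xi> /\<^sub>R \<epsilon>)) \<le> gauss \<xi>" for n
      by (intro AE_I2) (use fb[OF S] in \<open>auto simp: norm_mult intro!: mult_left_le\<close>)
  qed
  then have "(\<lambda>n. Re (complex_of_real (gauss (0::'a)) * ?I (S n)) / \<epsilon> ^ DIM('a)) \<longlonglongrightarrow>
      Re (complex_of_real (gauss (0::'a)) * ?I t) / \<epsilon> ^ DIM('a)"
    using \<epsilon> by (intro tendsto_intros) auto
  then show ?thesis
    unfolding smooth_by_fourier[OF p_integrable[OF t] \<epsilon>, symmetric] smooth_by_fourier[OF p_integrable[OF S] \<epsilon>, symmetric]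
    using \<epsilon> by simp
qed

text \<open>An \<open>\<epsilon>/3\<close> argument: the equi-Lipschitz bound makes the smoothing error small uniformly for times in
\<open>[t/2, T]\<close>, and the smoothed densities converge.\<close>

lemma p_tendsto:
  assumes t: "t \<in> {0<..T}" and S: "\<And>n. S n \<in> {0<..T}" and lim: "S \<longlonglongrightarrow> t"
  shows "(\<lambda>n. p (S n) x) \<longlonglongrightarrow> p t x"
proof (rule tendstoI)
  fix e :: real assume e: "e > 0"
  have r: "t / 2 \<in> {0<..T}" using t by auto
  obtain B C where B: "\<And>s x. s \<in> {t/2..T} \<Longrightarrow> \<bar>p s x\<bar> \<le> B"
    and C: "\<And>s x y. s \<in> {t/2..T} \<Longrightarrow> \<bar>p s x - p s y\<bar> \<le> C * norm (x - y)"
    using p_equi_bounds[OF r] by blast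
  define m where "m \<epsilon> = (\<integral>z. min (C * norm (\<epsilon> *\<^sub>R z)) (2 * B) * gauss (z::'a) \<partial>lborel)" for \<epsilon>
  have tin: "t \<in> {t/2..T}" using t by auto
  have B0: "B \<ge> 0" using B[OF tin, of undefined] by linarith
  have C0: "0 \<le> C * norm (z::'a)" for z
    using order_trans[OF abs_ge_zero C[OF tin, of z 0]] by simp
  have sm: "\<bar>smooth_by \<epsilon> (p s) x - p s x\<bar> \<le> m \<epsilon>" if s: "s \<in> {t/2..T}" for s \<epsilon>
  proof -
    have s': "s \<in> {0<..T}" using s t by auto
    have [measurable]: "p s \<in> borel_measurable borel" using p_integrable[OF s'] by auto
    have i1: "integrable lborel (\<lambda>z. p s (x - \<epsilon> *\<^sub>R z) * gauss z)"
      by (rule Bochner_Integration.integrable_bound[of _ "\<lambda>z. B * gauss z"])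
         (auto simp: gauss_integrable abs_mult intro!: mult_right_mono order_trans[OF B[OF s] abs_ge_self])
    have i2: "integrable lborel (\<lambda>z. p s x * gauss (z::'a))" by (simp add: gauss_integrable)
    have i3: "integrable lborel (\<lambda>z. min (C * norm (\<epsilon> *\<^sub>R z)) (2 * B) * gauss (z::'a))"
      by (rule Bochner_Integration.integrable_bound[of _ "\<lambda>z. 2 * B * gauss z"])
         (use B0 C0[of "\<epsilon> *\<^sub>R _"] in \<open>auto simp: gauss_integrable abs_mult intro!: mult_right_mono\<close>)
    have "smooth_by \<epsilon> (p s) x - p s x = (\<integral>z. p s (x - \<epsilon> *\<^sub>R z) * gauss z - p s x * gauss z \<partial>lborel)"
      using i1 i2 by (simp add: smooth_by_def gauss_integral)
    also have "norm \<dots> \<le> m \<epsilon>"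
      unfolding m_def
    proof (rule Bochner_Integration.integral_norm_bound_integral[OF Bochner_Integration.integrable_diff[OF i1 i2] i3])
      fix z :: 'a
      have "\<bar>p s (x - \<epsilon> *\<^sub>R z) - p s x\<bar> \<le> C * norm (\<epsilon> *\<^sub>R z)"
        using C[OF s, of "x - \<epsilon> *\<^sub>R z" x] by simp
      moreover have "\<bar>p s (x - \<epsilon> *\<^sub>R z) - p s x\<bar> \<le> 2 * B"
        using B[OF s, of "x - \<epsilon> *\<^sub>R z"] B[OF s, of x] by linarith
      ultimately show "norm (p s (x - \<epsilon> *\<^sub>R z) * gauss z - p s x * gauss z) \<le> min (C * norm (\<epsilon> *\<^sub>R z)) (2 * B) * gauss z"
        unfolding left_diff_distrib[symmetric] norm_mult by (intro mult_mono) auto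
    qed
    finally show ?thesis by simp
  qed
  have "(\<lambda>n. m (1 / real (Suc n))) \<longlonglongrightarrow> (\<integral>z. 0 \<partial>(lborel :: 'a measure))"
    unfolding m_def
  proof (rule integral_dominated_convergence[where w="\<lambda>z::'a. 2 * B * gauss z"])
    show "AE z in lborel. (\<lambda>n. min (C * norm ((1 / real (Suc n)) *\<^sub>R z)) (2 * B) * gauss (z::'a)) \<longlonglongrightarrow> 0"
    proof (rule AE_I2)
      fix z :: 'a
      have "(\<lambda>n. min (C * norm ((1 / real (Suc n)) *\<^sub>R z)) (2 * B) * gauss z) \<longlonglongrightarrow> min (C * norm (0 *\<^sub>R z)) (2 * B) * gauss z"
        by (intro tendsto_intros LIMSEQ_Suc[OF lim_1_over_n])
      then show "(\<lambda>n. min (C * norm ((1 / real (Suc n)) *\<^sub>R z)) (2 * B) * gauss z) \<longlonglongrightarrow> 0"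
        using B0 by simp
    qed
    show "AE z in lborel. norm (min (C * norm ((1 / real (Suc n)) *\<^sub>R z)) (2 * B) * gauss (z::'a)) \<le> 2 * B * gauss z" for n
    proof (rule AE_I2)
      fix z :: 'a
      have "0 \<le> C * norm ((1 / real (Suc n)) *\<^sub>R z)" by (rule C0)
      then show "norm (min (C * norm ((1 / real (Suc n)) *\<^sub>R z)) (2 * B) * gauss z) \<le> 2 * B * gauss z"
        using B0 unfolding norm_mult by (intro mult_mono) auto
    qed
  qed (auto simp: gauss_integrable)
  then have "(\<lambda>n. m (1 / real (Suc n))) \<longlonglongrightarrow> 0" by simp
  then have "eventually (\<lambda>n. m (1 / real (Suc n)) < e / 3) sequentially"
    using e by (intro order_tendstoD(2)) auto
  then obtain N where N: "m (1 / real (Suc N)) < e / 3" by (auto simp: eventually_sequentially)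
  \<comment> \<open>A smoothing width, valid for all times in \<open>[t/2, T]\<close> at once.\<close>
  define \<epsilon> where "\<epsilon> = 1 / real (Suc N)"
  have \<epsilon>: "\<epsilon> > 0" "m \<epsilon> < e / 3" using N by (auto simp: \<epsilon>_def)
  have "eventually (\<lambda>n. dist (smooth_by \<epsilon> (p (S n)) x) (smooth_by \<epsilon> (p t) x) < e / 3) sequentially"
    using e by (intro tendstoD[OF smooth_by_p_tendsto[OF t S lim \<epsilon>(1)]]) auto
  moreover have "eventually (\<lambda>n. S n > t / 2) sequentially"
    using t by (intro order_tendstoD(1)[OF lim]) auto
  ultimately show "eventually (\<lambda>n. dist (p (S n) x) (p t x) < e) sequentially"
  proof eventually_elim
    case (elim n)
    have "S n \<in> {t/2..T}" using elim(2) S[of n] by auto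
    from sm[OF this, of \<epsilon>] sm[OF tin, of \<epsilon>] elim(1) \<epsilon>(2)
    show ?case unfolding dist_real_def by linarith
  qed
qed

text \<open>Scheffe's lemma: pointwise convergence of densities with equal masses implies convergence in \<open>L\<^sup>1\<close>.\<close>

lemma p_L1_continuous:
  assumes t: "t \<in> {0<..T}"
  shows "((\<lambda>s. L1_norm (\<lambda>y. p s y - p t y)) \<longlongrightarrow> 0) (at t within {0<..T})"
  unfolding tendsto_at_iff_sequentially comp_def
proof (intro allI impI)
  fix S assume S': "\<forall>i. S i \<in> {0<..T} - {t}" and lim: "S \<longlonglongrightarrow> t"
  then have S: "S n \<in> {0<..T}" for n by auto
  have m: "(\<integral>\<^sup>+x. ennreal (norm (p s x)) \<partial>lborel) = 1" if "s \<in> {0<..T}" for s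
    using p_mass[OF that] nn_integral_eq_integral[OF integrable_norm[OF p_integrable[OF that]]]
    by (simp add: L1_norm_def)
  have "(\<lambda>n. \<integral>\<^sup>+x. norm (p (S n) x - p t x) \<partial>lborel) \<longlonglongrightarrow> 0"
    using p_tendsto[OF t S lim] m[OF t] m[OF S] p_integrable[OF S] p_integrable[OF t]
    by (intro Scheffe_lemma2) auto
  moreover have "(\<integral>\<^sup>+x. norm (p (S n) x - p t x) \<partial>lborel) = ennreal (L1_norm (\<lambda>x. p (S n) x - p t x))" for n
    unfolding L1_norm_def
    by (intro nn_integral_eq_integral integrable_norm Bochner_Integration.integrable_diff p_integrable S t) auto
  ultimately have "(\<lambda>n. ennreal (L1_norm (\<lambda>x. p (S n) x - p t x))) \<longlonglongrightarrow> ennreal 0" by simp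
  then show "(\<lambda>n. L1_norm (\<lambda>x. p (S n) x - p t x)) \<longlonglongrightarrow> 0"
    by (rule tendsto_ennrealD) auto
qed

text \<open>With \<open>r = t/2\<close> the semigroup law gives \<open>Dp s - Dp t = Dp r * (p (s - r) - p (t - r))\<close>, and the \<open>L\<^sup>1\<close>
norm of a convolution is at most the product of the norms.\<close>

lemma Dp_L1_continuous:
  assumes t: "t \<in> {0<..T}"
  shows "((\<lambda>s. L1_norm (\<lambda>y. Dp s y - Dp t y)) \<longlongrightarrow> 0) (at t within {0<..T})"
proof -
  \<comment> \<open>Any \<open>r\<close> strictly between 0 and \<open>t\<close> would do.\<close>
  define r where "r = t / 2"
  have r: "0 < r" "r < t" "r \<in> {0<..T}" "t - r \<in> {0<..T}" using t by (auto simp: r_def)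
  have ev: "eventually (\<lambda>s. s > r \<and> s \<in> {0<..T}) (at t within {0<..T})"
    using order_tendstoD(1)[OF tendsto_ident_at[of t "{0<..T}"] r(2)] by (auto simp: eventually_at_filter elim!: eventually_mono)
  have bound: "L1_norm (\<lambda>y. Dp s y - Dp t y) \<le> L1_norm (\<lambda>y. p (s - r) y - p (t - r) y) * L1_norm (Dp r)"
    if s: "s > r" "s \<in> {0<..T}" for s
  proof -
    have sr: "s - r \<in> {0<..T}" using s r by auto
    obtain B where B: "bcont B (p (s - r))" using p_bcont[OF sr] by auto
    obtain C where C: "bcont C (p (t - r))" using p_bcont[OF r(4)] by auto
    have "(\<lambda>y. Dp s y - Dp t y) = conv (Dp r) (\<lambda>y. p (s - r) y - p (t - r) y)"
      using s t r Dp_semigroup[of r s] Dp_semigroup[of r t]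
      by (auto simp: conv_diff_fun[OF Dp_integrable[OF r(3)] B C])
    then show ?thesis
      using L1_norm_conv_le[OF Dp_integrable[OF r(3)] Bochner_Integration.integrable_diff[OF p_integrable[OF sr] p_integrable[OF r(4)]]]
      by simp
  qed
  have "filterlim (\<lambda>s. s - r) (at (t - r) within {0<..T}) (at t within {0<..T})"
    unfolding filterlim_at using ev r(1)
    by (auto intro!: tendsto_intros elim!: eventually_mono simp: eventually_at_filter)
  from filterlim_compose[OF p_L1_continuous[OF r(4)] this]
  have "((\<lambda>s. L1_norm (\<lambda>y. p (s - r) y - p (t - r) y) * L1_norm (Dp r)) \<longlongrightarrow> 0) (at t within {0<..T})"
    by (rule tendsto_mult_left_zero)
  then show ?thesis
    by (rule Lim_null_comparison[rotated]) (use ev bound in \<open>auto elim!: eventually_mono\<close>)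
qed

end

section \<open>The Duhamel integral of a weakly singular kernel\<close>

text \<open>The kernel of the Riemann-Liouville fractional integral of order \<open>1 - \<gamma>\<close>, cut off at \<open>b\<close>. It serves as
the dominating function for all time integrals below.\<close>

definition riesz :: "real \<Rightarrow> real \<Rightarrow> real \<Rightarrow> real"
  where "riesz \<gamma> b \<tau> = indicator {0<..b} \<tau> * \<tau> powr (- \<gamma>)"

lemma riesz_nonneg [simp]: "0 \<le> riesz \<gamma> b \<tau>"
  by (simp add: riesz_def)

lemma riesz_eq: "0 < \<tau> \<Longrightarrow> \<tau> \<le> b \<Longrightarrow> riesz \<gamma> b \<tau> = \<tau> powr (- \<gamma>)"
  by (simp add: riesz_def)

lemma riesz_integral:
  assumes \<gamma>: "\<gamma> < 1" and b: "0 \<le> b"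
  shows "has_bochner_integral lborel (riesz \<gamma> b) (b powr (1 - \<gamma>) / (1 - \<gamma>))"
proof (rule has_bochner_integral_nn_integral)
  show "riesz \<gamma> b \<in> borel_measurable lborel" unfolding riesz_def by measurable
  show "AE x in lborel. 0 \<le> riesz \<gamma> b x" by simp
  show "0 \<le> b powr (1 - \<gamma>) / (1 - \<gamma>)" using \<gamma> by simp
  have "((\<lambda>x. x powr (- \<gamma>)) has_integral (b powr (1 - \<gamma>) / (1 - \<gamma>))) {0..b}"
    using has_integral_powr_from_0[of "- \<gamma>" b] \<gamma> b by (simp add: add.commute)
  then have "(\<integral>\<^sup>+x. ennreal (indicator {0..b} x * x powr (- \<gamma>)) \<partial>lborel) = ennreal (b powr (1 - \<gamma>) / (1 - \<gamma>))"
    by (intro nn_integral_has_integral_lebesgue) auto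
  also have "(\<integral>\<^sup>+x. ennreal (indicator {0..b} x * x powr (- \<gamma>)) \<partial>lborel) = (\<integral>\<^sup>+x. ennreal (riesz \<gamma> b x) \<partial>lborel)"
    by (rule nn_integral_cong) (auto simp: riesz_def indicator_def)
  finally show "(\<integral>\<^sup>+x. ennreal (riesz \<gamma> b x) \<partial>lborel) = ennreal (b powr (1 - \<gamma>) / (1 - \<gamma>))" .
qed

lemma riesz_reflect:
  assumes \<gamma>: "\<gamma> < 1" and b: "0 \<le> b"
  shows "integrable lborel (\<lambda>s. riesz \<gamma> b (t - s))"
    and "(\<integral>s. riesz \<gamma> b (t - s) \<partial>lborel) = b powr (1 - \<gamma>) / (1 - \<gamma>)"
proof -
  have i: "integrable lborel (riesz \<gamma> b)" using riesz_integral[OF assms] by (simp add: has_bochner_integral_iff)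
  show "integrable lborel (\<lambda>s. riesz \<gamma> b (t - s))" by (rule integrable_lborel_reflect[OF i])
  have "riesz \<gamma> b \<in> borel_measurable borel" using i by auto
  from integral_lborel_reflect[OF this, of t]
  show "(\<integral>s. riesz \<gamma> b (t - s) \<partial>lborel) = b powr (1 - \<gamma>) / (1 - \<gamma>)"
    using riesz_integral[OF assms] by (simp add: has_bochner_integral_iff)
qed

text \<open>The condition is imposed on the open interval \<open>(0, t)\<close> only, because initial data that are merely
Lipschitz give a forcing term without a limit at time 0.\<close>

definition source_on :: "real \<Rightarrow> real \<Rightarrow> (real \<Rightarrow> 'a::euclidean_space \<Rightarrow> real) \<Rightarrow> bool"
  where "source_on t M F \<longleftrightarrow> continuous_on ({0<..<t} \<times> UNIV) (\<lambda>(s, x). F s x) \<and>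
     (\<forall>s\<in>{0<..<t}. \<forall>x. \<bar>F s x\<bar> \<le> M)"

lemma source_on_mono: "source_on t M F \<Longrightarrow> t' \<le> t \<Longrightarrow> source_on t' M F"
  unfolding source_on_def by (auto elim!: continuous_on_subset)

lemma source_on_bcont:
  assumes F: "source_on t M F" and s: "s \<in> {0<..<t}"
  shows "bcont M (F s)"
proof (rule bcontI)
  have "continuous_on UNIV (\<lambda>x. (\<lambda>(s, x). F s x) (s, x))"
    using s F[unfolded source_on_def, THEN conjunct1]
    by (rule_tac continuous_on_compose2[where g="\<lambda>(s, x). F s x"]) (auto intro!: continuous_intros)
  then show "continuous_on UNIV (F s)" by simp
  show "\<bar>F s x\<bar> \<le> M" for x using F s by (auto simp: source_on_def)
qed

lemma source_on_tendsto:
  assumes F: "source_on t M F" and s: "s \<in> {0<..<t}" "\<And>n. S n \<in> {0<..<t}" "S \<longlonglongrightarrow> s" "X \<longlonglongrightarrow> x"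
  shows "(\<lambda>n. F (S n) (X n)) \<longlonglongrightarrow> F s x"
proof -
  have "(\<lambda>n. (\<lambda>(s, x). F s x) (S n, X n)) \<longlonglongrightarrow> (\<lambda>(s, x). F s x) (s, x)"
    using s F[unfolded source_on_def, THEN conjunct1]
    by (intro continuous_on_tendsto_compose[where f="\<lambda>(s, x). F s x"]) (auto intro!: tendsto_intros)
  then show ?thesis by simp
qed

text \<open>The Duhamel integral is continuous in time uniformly in space; this leads back to the joint
continuity that sources are required to have.\<close>

lemma continuous_on_Times_uniform_limit:
  fixes w :: "'t::metric_space \<Rightarrow> 'a::metric_space \<Rightarrow> 'b::metric_space"
  assumes c: "\<And>t. t \<in> S \<Longrightarrow> continuous_on UNIV (w t)"
    and u: "\<And>t. t \<in> S \<Longrightarrow> uniform_limit UNIV w (w t) (at t within S)"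
  shows "continuous_on (S \<times> UNIV) (\<lambda>(t, x). w t x)"
proof (rule continuous_on_sequentiallyI, clarify)
  fix U :: "nat \<Rightarrow> 't \<times> 'a" and t x
  assume U: "\<forall>n. U n \<in> S \<times> UNIV" and t: "t \<in> S" and lim: "U \<longlonglongrightarrow> (t, x)"
  have lt: "(\<lambda>n. fst (U n)) \<longlonglongrightarrow> t" and lx: "(\<lambda>n. snd (U n)) \<longlonglongrightarrow> x"
    using tendsto_fst[OF lim] tendsto_snd[OF lim] by auto
  show "(\<lambda>n. case U n of (t, x) \<Rightarrow> w t x) \<longlonglongrightarrow> w t x"
  proof (rule tendstoI)
    fix e :: real assume e: "e > 0"
    have "eventually (\<lambda>s. \<forall>x. dist (w s x) (w t x) < e / 2) (at t within S)"
      using u[OF t] e unfolding uniform_limit_iff by (auto dest!: spec[of _ "e/2"])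
    then obtain d where d: "d > 0" "\<And>s x. s \<in> S \<Longrightarrow> s \<noteq> t \<Longrightarrow> dist s t < d \<Longrightarrow> dist (w s x) (w t x) < e / 2"
      unfolding eventually_at by auto
    have "eventually (\<lambda>n. dist (fst (U n)) t < d) sequentially" by (rule tendstoD[OF lt d(1)])
    moreover have "(\<lambda>n. w t (snd (U n))) \<longlonglongrightarrow> w t x"
      using c[OF t] lx by (intro continuous_on_tendsto_compose[of UNIV "w t"]) auto
    then have "eventually (\<lambda>n. dist (w t (snd (U n))) (w t x) < e / 2) sequentially"
      using e by (intro tendstoD) auto
    ultimately show "eventually (\<lambda>n. dist (case U n of (t, x) \<Rightarrow> w t x) (w t x) < e) sequentially"
    proof eventually_elim
      case (elim n)
      have "dist (w (fst (U n)) (snd (U n))) (w t (snd (U n))) < e / 2"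
        using d(2)[of "fst (U n)" "snd (U n)"] elim(1) U e by (cases "fst (U n) = t") (auto simp: mem_Times_iff)
      then show ?case
        using elim(2) dist_triangle[of "w (fst (U n)) (snd (U n))" "w t x" "w t (snd (U n))"]
        by (auto simp: split_def)
    qed
  qed
qed

definition duhamel :: "(real \<Rightarrow> 'a::euclidean_space \<Rightarrow> 'b::euclidean_space) \<Rightarrow> (real \<Rightarrow> 'a \<Rightarrow> real) \<Rightarrow> real \<Rightarrow> 'a \<Rightarrow> 'b"
  where "duhamel k F t x = (LINT s:{0<..<t}|lborel. conv (k (t - s)) (F s) x)"

text \<open>The properties shared by \<open>p\<^sub>t\<close> (with \<open>c = 1\<close>, \<open>\<gamma> = 0\<close>) and \<open>Dp\<^sub>t\<close> (with \<open>c = c\<^sub>0\<close>, \<open>\<gamma> = 1/\<alpha>\<close>) from which the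
estimates on the mild formula follow.\<close>

locale l1_kernel =
  fixes k :: "real \<Rightarrow> 'a::euclidean_space \<Rightarrow> 'b::euclidean_space" and T c \<gamma> :: real
  assumes c_nonneg: "0 \<le> c" and \<gamma>_nonneg: "0 \<le> \<gamma>" and \<gamma>_less: "\<gamma> < 1"
    and k_integrable: "\<tau> \<in> {0<..T} \<Longrightarrow> integrable lborel (k \<tau>)"
    and k_bound: "\<tau> \<in> {0<..T} \<Longrightarrow> L1_norm (k \<tau>) \<le> c * \<tau> powr (- \<gamma>)"
    and k_L1_continuous: "\<tau> \<in> {0<..T} \<Longrightarrow> ((\<lambda>\<sigma>. L1_norm (\<lambda>y. k \<sigma> y - k \<tau> y)) \<longlongrightarrow> 0) (at \<tau> within {0<..T})"
begin

lemma k_L1_tendsto: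
  assumes "\<tau> \<in> {0<..T}" "\<And>n. S n \<in> {0<..T}" "S \<longlonglongrightarrow> \<tau>"
  shows "(\<lambda>n. L1_norm (\<lambda>y. k (S n) y - k \<tau> y)) \<longlonglongrightarrow> 0"
proof -
  have "continuous (at \<tau> within {0<..T}) (\<lambda>\<sigma>. L1_norm (\<lambda>y. k \<sigma> y - k \<tau> y))"
    unfolding continuous_within using k_L1_continuous[OF assms(1)] by (simp add: L1_norm_def)
  from continuous_within_tendsto_compose[OF this, of S sequentially] assms
  show ?thesis by (simp add: L1_norm_def)
qed

lemma uniform_limit_conv:
  assumes f: "bcont B f" and t: "t \<in> {0<..T}"
  shows "uniform_limit UNIV (\<lambda>s. conv (k s) f) (conv (k t) f) (at t within {0<..T})"
  unfolding uniform_limit_iff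
proof (intro allI impI)
  fix e :: real assume e: "e > 0"
  have "((\<lambda>s. B * L1_norm (\<lambda>y. k s y - k t y)) \<longlongrightarrow> 0) (at t within {0<..T})"
    by (intro tendsto_mult_right_zero k_L1_continuous t)
  then have "eventually (\<lambda>s. B * L1_norm (\<lambda>y. k s y - k t y) < e) (at t within {0<..T})"
    by (rule order_tendstoD(2)) (rule e)
  moreover have "eventually (\<lambda>s. s \<in> {0<..T}) (at t within {0<..T})"
    by (auto simp: eventually_at_filter)
  ultimately show "eventually (\<lambda>s. \<forall>x\<in>UNIV. dist (conv (k s) f x) (conv (k t) f x) < e) (at t within {0<..T})"
  proof eventually_elim
    case (elim s)
    show ?case
      unfolding dist_norm conv_diff_kernel[OF k_integrable[OF elim(2)] k_integrable[OF t] f]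
      using norm_conv_le[OF Bochner_Integration.integrable_diff[OF k_integrable[OF elim(2)] k_integrable[OF t]] f] elim(1)
      by (auto intro: le_less_trans)
  qed
qed

text \<open>Kernel and source vary together. The variation of the kernel is controlled in \<open>L\<^sup>1\<close>, that of the
source pointwise and by dominated convergence.\<close>

lemma continuous_on_conv_time:
  assumes F: "source_on t M F" and t: "t \<le> T"
  shows "continuous_on {0<..<t} (\<lambda>s. conv (k (t - s)) (F s) x)"
proof (rule continuous_on_sequentiallyI)
  fix S s assume S': "\<forall>n. S n \<in> {0<..<t}" and s: "s \<in> {0<..<t}" and lim: "S \<longlonglongrightarrow> s"
  have S: "S n \<in> {0<..<t}" for n using S' by auto
  have ts: "t - s \<in> {0<..T}" "t - S n \<in> {0<..T}" for n using s S[of n] t by auto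
  have b: "bcont M (F s)" "bcont M (F (S n))" for n using source_on_bcont[OF F] s S by auto
  have "(\<lambda>n. conv (\<lambda>y. k (t - S n) y - k (t - s) y) (F (S n)) x) \<longlonglongrightarrow> 0"
  proof (rule Lim_null_comparison)
    show "(\<lambda>n. M * L1_norm (\<lambda>y. k (t - S n) y - k (t - s) y)) \<longlonglongrightarrow> 0"
      by (intro tendsto_mult_right_zero k_L1_tendsto ts tendsto_intros lim)
    show "eventually (\<lambda>n. norm (conv (\<lambda>y. k (t - S n) y - k (t - s) y) (F (S n)) x) \<le> M * L1_norm (\<lambda>y. k (t - S n) y - k (t - s) y)) sequentially"
      by (intro always_eventually allI norm_conv_le b Bochner_Integration.integrable_diff k_integrable ts)
  qed
  moreover have "(\<lambda>n. conv (k (t - s)) (F (S n)) x) \<longlonglongrightarrow> conv (k (t - s)) (F s) x"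
    by (intro conv_tendsto[where B=M] k_integrable ts b source_on_tendsto[OF F s S lim] tendsto_const)
  ultimately have "(\<lambda>n. conv (\<lambda>y. k (t - S n) y - k (t - s) y) (F (S n)) x + conv (k (t - s)) (F (S n)) x) \<longlonglongrightarrow> 0 + conv (k (t - s)) (F s) x"
    by (rule tendsto_add)
  then show "(\<lambda>n. conv (k (t - S n)) (F (S n)) x) \<longlonglongrightarrow> conv (k (t - s)) (F s) x"
    by (simp add: conv_diff_kernel[OF k_integrable[OF ts(2)] k_integrable[OF ts(1)] b(2), symmetric])
qed

lemma duhamel_measurable:
  assumes F: "source_on t M F" and t: "t \<le> T"
  shows "(\<lambda>s. indicator {0<..<t} s *\<^sub>R conv (k (t - s)) (F s) x) \<in> borel_measurable lborel"
  using borel_measurable_continuous_on_indicator[OF _ continuous_on_conv_time[OF F t, of x]] by simp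

lemma norm_conv_kernel_le:
  assumes F: "bcont m f" and t: "t \<le> T" and s: "0 \<le> a" "s \<in> {a<..<t}"
  shows "norm (conv (k (t - s)) f x) \<le> m * c * riesz \<gamma> (t - a) (t - s)"
proof -
  have ts: "t - s \<in> {0<..T}" using s t by auto
  have "norm (conv (k (t - s)) f x) \<le> m * L1_norm (k (t - s))"
    by (rule norm_conv_le[OF k_integrable[OF ts] F])
  also have "\<dots> \<le> m * (c * (t - s) powr (- \<gamma>))"
    by (intro mult_left_mono k_bound ts bcont_nonneg[OF F])
  finally show ?thesis using s by (simp add: riesz_eq)
qed

lemma duhamel_integrable:
  assumes F: "source_on t M F" and t: "0 < t" "t \<le> T"
  shows "set_integrable lborel {0<..<t} (\<lambda>s. conv (k (t - s)) (F s) x)"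
  unfolding set_integrable_def
proof (rule Bochner_Integration.integrable_bound)
  have M: "0 \<le> M" using bcont_nonneg[OF source_on_bcont[OF F, of "t/2"]] t by auto
  show "integrable lborel (\<lambda>s. M * c * riesz \<gamma> (t - 0) (t - s))"
    using t \<gamma>_less by (intro integrable_mult_right riesz_reflect) auto
  show "AE s in lborel. norm (indicator {0<..<t} s *\<^sub>R conv (k (t - s)) (F s) x) \<le> norm (M * c * riesz \<gamma> (t - 0) (t - s))"
  proof (rule AE_I2)
    fix s
    show "norm (indicator {0<..<t} s *\<^sub>R conv (k (t - s)) (F s) x) \<le> norm (M * c * riesz \<gamma> (t - 0) (t - s))"
      using norm_conv_kernel_le[OF source_on_bcont[OF F] t(2), of s 0 s x] M c_nonneg
      by (cases "s \<in> {0<..<t}") (auto simp: abs_mult)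
  qed
qed (rule duhamel_measurable[OF F t(2)])

text \<open>Sources that agree up to time \<open>a\<close> only interact over a duration \<open>t - a\<close>. The case \<open>a = 0\<close> gives the
contraction estimate, and general \<open>a\<close> allows uniqueness to be propagated step by step.\<close>

lemma norm_duhamel_diff_le:
  assumes F: "source_on t M F" and G: "source_on t N G" and t: "0 < t" "t \<le> T" and a: "0 \<le> a" "a \<le> t"
    and eq: "\<And>s x. s \<in> {0<..<t} \<Longrightarrow> s \<le> a \<Longrightarrow> F s x = G s x"
    and le: "\<And>s x. s \<in> {a<..<t} \<Longrightarrow> \<bar>F s x - G s x\<bar> \<le> m" and m: "0 \<le> m"
  shows "norm (duhamel k F t x - duhamel k G t x) \<le> m * c * ((t - a) powr (1 - \<gamma>) / (1 - \<gamma>))"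
proof -
  have "norm (duhamel k F t x - duhamel k G t x) = norm (\<integral>s. indicator {0<..<t} s *\<^sub>R conv (k (t - s)) (F s) x
      - indicator {0<..<t} s *\<^sub>R conv (k (t - s)) (G s) x \<partial>lborel)"
    using duhamel_integrable[OF F t, of x] duhamel_integrable[OF G t, of x]
    by (simp add: duhamel_def set_lebesgue_integral_def set_integrable_def)
  also have "\<dots> \<le> (\<integral>s. m * c * riesz \<gamma> (t - a) (t - s) \<partial>lborel)"
  proof (rule Bochner_Integration.integral_norm_bound_integral)
    show "integrable lborel (\<lambda>s. indicator {0<..<t} s *\<^sub>R conv (k (t - s)) (F s) x
      - indicator {0<..<t} s *\<^sub>R conv (k (t - s)) (G s) x)"
      using duhamel_integrable[OF F t, of x] duhamel_integrable[OF G t, of x]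
      by (simp add: set_integrable_def)
    show "integrable lborel (\<lambda>s. m * c * riesz \<gamma> (t - a) (t - s))"
      using a \<gamma>_less by (intro integrable_mult_right riesz_reflect) auto
    fix s :: real
    show "norm (indicator {0<..<t} s *\<^sub>R conv (k (t - s)) (F s) x
      - indicator {0<..<t} s *\<^sub>R conv (k (t - s)) (G s) x) \<le> m * c * riesz \<gamma> (t - a) (t - s)"
    proof (cases "s \<in> {0<..<t}")
      case s: True
      have ts: "t - s \<in> {0<..T}" using s t by auto
      show ?thesis
      proof (cases "s \<le> a")
        case True
        then have "F s = G s" using eq[OF s] by auto
        then show ?thesis using m c_nonneg by simp
      next
        case False
        have "bcont m (\<lambda>y. F s y - G s y)"
          using source_on_bcont[OF F s] source_on_bcont[OF G s] le[of s] False s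
          by (auto simp: bcont_def intro!: continuous_intros)
        then show ?thesis
          using norm_conv_kernel_le[of m "\<lambda>y. F s y - G s y" t a s x] t a s False
          by (simp add: conv_diff_fun[OF k_integrable[OF ts] source_on_bcont[OF F s] source_on_bcont[OF G s]])
      qed
    qed (use m c_nonneg in auto)
  qed
  also have "\<dots> = m * c * ((t - a) powr (1 - \<gamma>) / (1 - \<gamma>))"
    using a \<gamma>_less riesz_reflect(2)[of \<gamma> "t - a" t] by simp
  finally show ?thesis .
qed

lemma norm_duhamel_le:
  assumes F: "source_on t M F" and t: "0 < t" "t \<le> T"
  shows "norm (duhamel k F t x) \<le> M * c * (t powr (1 - \<gamma>) / (1 - \<gamma>))"
proof -
  have M: "0 \<le> M" using bcont_nonneg[OF source_on_bcont[OF F, of "t/2"]] t by auto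
  have G: "source_on t 0 (\<lambda>_ _. 0)" by (simp add: source_on_def)
  have "duhamel k (\<lambda>_ _. 0) t x = 0" by (simp add: duhamel_def conv_def set_lebesgue_integral_def)
  then show ?thesis
    using norm_duhamel_diff_le[OF F G t, of 0 M x] M F t by (auto simp: source_on_def)
qed

lemma continuous_on_duhamel:
  assumes F: "source_on t M F" and t: "0 < t" "t \<le> T"
  shows "continuous_on UNIV (duhamel k F t)"
proof (rule continuous_on_sequentiallyI)
  fix X and x :: 'a assume lim: "X \<longlonglongrightarrow> x"
  show "(\<lambda>n. duhamel k F t (X n)) \<longlonglongrightarrow> duhamel k F t x"
    unfolding duhamel_def set_lebesgue_integral_def
  proof (rule integral_dominated_convergence)
    show "(\<lambda>s. indicator {0<..<t} s *\<^sub>R conv (k (t - s)) (F s) x) \<in> borel_measurable lborel"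
      "(\<lambda>s. indicator {0<..<t} s *\<^sub>R conv (k (t - s)) (F s) (X n)) \<in> borel_measurable lborel" for n
      by (rule duhamel_measurable[OF F t(2)])+
    show "integrable lborel (\<lambda>s. M * c * riesz \<gamma> (t - 0) (t - s))"
      using t \<gamma>_less by (intro integrable_mult_right riesz_reflect) auto
    have M: "0 \<le> M" using bcont_nonneg[OF source_on_bcont[OF F, of "t/2"]] t by auto
    show "AE s in lborel. norm (indicator {0<..<t} s *\<^sub>R conv (k (t - s)) (F s) (X n)) \<le> M * c * riesz \<gamma> (t - 0) (t - s)" for n
    proof (rule AE_I2)
      fix s
      show "norm (indicator {0<..<t} s *\<^sub>R conv (k (t - s)) (F s) (X n)) \<le> M * c * riesz \<gamma> (t - 0) (t - s)"
        using norm_conv_kernel_le[OF source_on_bcont[OF F] t(2), of s 0 s "X n"] M c_nonneg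
        by (cases "s \<in> {0<..<t}") (auto simp: abs_mult)
    qed
    show "AE s in lborel. (\<lambda>n. indicator {0<..<t} s *\<^sub>R conv (k (t - s)) (F s) (X n)) \<longlonglongrightarrow> indicator {0<..<t} s *\<^sub>R conv (k (t - s)) (F s) x"
    proof (rule AE_I2)
      fix s
      show "(\<lambda>n. indicator {0<..<t} s *\<^sub>R conv (k (t - s)) (F s) (X n)) \<longlonglongrightarrow> indicator {0<..<t} s *\<^sub>R conv (k (t - s)) (F s) x"
      proof (cases "s \<in> {0<..<t}")
        case s: True
        have "continuous_on UNIV (conv (k (t - s)) (F s))"
          using s t by (intro continuous_on_conv[OF k_integrable source_on_bcont[OF F s]]) auto
        then show ?thesis
          using lim by (intro tendsto_intros continuous_on_tendsto_compose[of UNIV "conv (k (t - s)) (F s)"]) auto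
      qed simp
    qed
  qed
qed

text \<open>The \<open>L\<^sup>1\<close> distance between the kernel at time \<open>\<tau>\<close> and the kernel at the later time \<open>\<tau> + h\<close>. Its time integral is the
modulus of continuity of the Duhamel integral, apart from the contribution of the last piece of
length \<open>h\<close>.\<close>

definition shift_modulus :: "real \<Rightarrow> real \<Rightarrow> real"
  where "shift_modulus h \<tau> = indicator {0<..<T - h} \<tau> * L1_norm (\<lambda>y. k (\<tau> + h) y - k \<tau> y)"

lemma shift_modulus_nonneg [simp]: "0 \<le> shift_modulus h \<tau>"
  by (simp add: shift_modulus_def)

lemma shift_modulus_measurable:
  assumes h: "h \<ge> 0"
  shows "shift_modulus h \<in> borel_measurable borel"
proof -
  have "continuous_on {0<..<T - h} (\<lambda>\<tau>. L1_norm (\<lambda>y. k (\<tau> + h) y - k \<tau> y))"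
  proof (rule continuous_on_sequentiallyI)
    fix S \<tau> assume S': "\<forall>n. S n \<in> {0<..<T - h}" and \<tau>: "\<tau> \<in> {0<..<T - h}" and lim: "S \<longlonglongrightarrow> \<tau>"
    have S: "S n \<in> {0<..<T - h}" for n using S' by auto
    have i: "\<tau> \<in> {0<..T}" "S n \<in> {0<..T}" "\<tau> + h \<in> {0<..T}" "S n + h \<in> {0<..T}" for n
      using \<tau> S[of n] h by auto
    note ki = k_integrable[OF i(1)] k_integrable[OF i(2)] k_integrable[OF i(3)] k_integrable[OF i(4)]
    let ?d = "\<lambda>a b. L1_norm (\<lambda>y. k a y - k b y)"
    have tri: "?d a e \<le> ?d a b + ?d b e" if "integrable lborel (k a)" "integrable lborel (k b)" "integrable lborel (k e)" for a b e
      using L1_norm_triangle[of "\<lambda>y. k a y - k b y" "\<lambda>y. k b y - k e y"] that by simp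
    have "(\<lambda>n. ?d (S n + h) (S n) - ?d (\<tau> + h) \<tau>) \<longlonglongrightarrow> 0"
    proof (rule Lim_null_comparison)
      show "(\<lambda>n. ?d (S n + h) (\<tau> + h) + ?d (S n) \<tau>) \<longlonglongrightarrow> 0"
        by (intro tendsto_add_zero k_L1_tendsto i tendsto_intros lim)
      show "eventually (\<lambda>n. norm (?d (S n + h) (S n) - ?d (\<tau> + h) \<tau>) \<le> ?d (S n + h) (\<tau> + h) + ?d (S n) \<tau>) sequentially"
      proof (intro always_eventually allI)
        fix n
        have "?d (S n + h) (S n) \<le> ?d (S n + h) (\<tau> + h) + (?d (\<tau> + h) \<tau> + ?d \<tau> (S n))"
          using tri[OF ki(4) ki(3) ki(2), of n n] tri[OF ki(3) ki(1) ki(2), of n] by linarith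
        moreover have "?d (\<tau> + h) \<tau> \<le> ?d (\<tau> + h) (S n + h) + (?d (S n + h) (S n) + ?d (S n) \<tau>)"
          using tri[OF ki(3) ki(4) ki(1), of n] tri[OF ki(4) ki(2) ki(1), of n n] by linarith
        moreover have "?d (\<tau> + h) (S n + h) = ?d (S n + h) (\<tau> + h)" "?d \<tau> (S n) = ?d (S n) \<tau>"
          by (rule L1_norm_minus_commute)+
        ultimately show "norm (?d (S n + h) (S n) - ?d (\<tau> + h) \<tau>) \<le> ?d (S n + h) (\<tau> + h) + ?d (S n) \<tau>"
          unfolding real_norm_def by linarith
      qed
    qed
    then show "(\<lambda>n. ?d (S n + h) (S n)) \<longlonglongrightarrow> ?d (\<tau> + h) \<tau>"
      by (simp add: LIM_zero_iff)
  qed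
  from borel_measurable_continuous_on_indicator[OF _ this]
  show ?thesis by (simp add: shift_modulus_def[abs_def])
qed

text \<open>Since \<open>\<tau> powr (- \<gamma>)\<close> decreases, a forward shift does not worsen the singularity, and the dominating
function does not depend on \<open>h\<close>.\<close>

lemma shift_modulus_le:
  assumes h: "h \<ge> 0"
  shows "shift_modulus h \<tau> \<le> 2 * c * riesz \<gamma> T \<tau>"
proof (cases "\<tau> \<in> {0<..<T - h}")
  case True
  then have i: "\<tau> \<in> {0<..T}" "\<tau> + h \<in> {0<..T}" using h by auto
  have "L1_norm (\<lambda>y. k (\<tau> + h) y - k \<tau> y) \<le> L1_norm (k (\<tau> + h)) + L1_norm (k \<tau>)"
    by (intro L1_norm_diff_le k_integrable i)
  also have "\<dots> \<le> c * (\<tau> + h) powr (- \<gamma>) + c * \<tau> powr (- \<gamma>)"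
    by (intro add_mono k_bound i)
  also have "\<dots> \<le> c * \<tau> powr (- \<gamma>) + c * \<tau> powr (- \<gamma>)"
    using i h \<gamma>_nonneg c_nonneg by (intro add_right_mono mult_left_mono powr_mono2') auto
  finally show ?thesis using True i by (simp add: shift_modulus_def riesz_eq)
qed (use c_nonneg in \<open>auto simp: shift_modulus_def\<close>)

lemma shift_modulus_integrable:
  assumes h: "h \<ge> 0" and T: "T > 0"
  shows "integrable lborel (shift_modulus h)"
proof (rule Bochner_Integration.integrable_bound)
  show "integrable lborel (\<lambda>\<tau>. 2 * c * riesz \<gamma> T \<tau>)"
    using riesz_integral[OF \<gamma>_less, of T] T by (auto simp: has_bochner_integral_iff)
  show "AE \<tau> in lborel. norm (shift_modulus h \<tau>) \<le> norm (2 * c * riesz \<gamma> T \<tau>)"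
    using shift_modulus_le[OF h] by (auto intro: order_trans[OF _ abs_ge_self])
qed (use shift_modulus_measurable[OF h] in simp)

lemma shift_modulus_tendsto:
  assumes T: "T > 0"
  shows "((\<lambda>h. \<integral>\<tau>. shift_modulus h \<tau> \<partial>lborel) \<longlongrightarrow> 0) (at_right 0)"
  unfolding tendsto_at_iff_sequentially comp_def
proof (intro allI impI)
  fix h :: "nat \<Rightarrow> real" assume h': "\<forall>i. h i \<in> {0<..} - {0}" and lim: "h \<longlonglongrightarrow> 0"
  have h: "h n > 0" for n using h' by auto
  have "(\<lambda>n. \<integral>\<tau>. shift_modulus (h n) \<tau> \<partial>lborel) \<longlonglongrightarrow> (\<integral>\<tau>. 0 \<partial>(lborel :: real measure))"
  proof (rule integral_dominated_convergence)
    show "shift_modulus (h n) \<in> borel_measurable lborel" for n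
      using shift_modulus_measurable[of "h n"] h[of n] by simp
    show "integrable lborel (\<lambda>\<tau>. 2 * c * riesz \<gamma> T \<tau>)"
      using riesz_integral[OF \<gamma>_less, of T] T by (auto simp: has_bochner_integral_iff)
    show "AE \<tau> in lborel. norm (shift_modulus (h n) \<tau>) \<le> 2 * c * riesz \<gamma> T \<tau>" for n
      using shift_modulus_le[OF less_imp_le[OF h]] by auto
    show "AE \<tau> in lborel. (\<lambda>n. shift_modulus (h n) \<tau>) \<longlonglongrightarrow> 0"
    proof (rule AE_I2)
      fix \<tau> :: real
      show "(\<lambda>n. shift_modulus (h n) \<tau>) \<longlonglongrightarrow> 0"
      proof (cases "\<tau> \<in> {0<..<T}")
        case \<tau>: True
        \<comment> \<open>Truncation at \<open>T\<close> keeps the whole sequence in the domain of the kernel; it is inactive where the indicator is 1.\<close>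
        define S where "S n = min (\<tau> + h n) T" for n
        have "S \<longlonglongrightarrow> min (\<tau> + 0) T" unfolding S_def by (intro tendsto_intros lim)
        then have "S \<longlonglongrightarrow> \<tau>" using \<tau> by simp
        moreover have "S n \<in> {0<..T}" for n
          using \<tau> less_imp_le[OF h] by (auto simp: S_def intro: add_pos_nonneg)
        ultimately have L: "(\<lambda>n. L1_norm (\<lambda>y. k (S n) y - k \<tau> y)) \<longlonglongrightarrow> 0"
          using \<tau> by (intro k_L1_tendsto) auto
        have le: "norm (shift_modulus (h n) \<tau>) \<le> L1_norm (\<lambda>y. k (S n) y - k \<tau> y)" for n
          by (auto simp: shift_modulus_def S_def indicator_def)
        show ?thesis by (rule Lim_null_comparison[OF always_eventually L]) (intro allI le)
      next
        case False
        then have "shift_modulus (h n) \<tau> = 0" for n using h[of n] by (auto simp: shift_modulus_def indicator_def)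
        then show ?thesis by simp
      qed
    qed
  qed auto
  then show "(\<lambda>n. \<integral>\<tau>. shift_modulus (h n) \<tau> \<partial>lborel) \<longlonglongrightarrow> 0" by simp
qed

text \<open>On \<open>(0, t)\<close> both integrands are present and differ by the time shift of the kernel; on \<open>[t, t')\<close> only
the later one is.\<close>

lemma norm_duhamel_time_diff_le:
  assumes F: "source_on t' M F" and t: "0 < t" "t < t'" "t' \<le> T"
  shows "norm (duhamel k F t' x - duhamel k F t x) \<le>
    M * ((\<integral>\<tau>. shift_modulus (t' - t) \<tau> \<partial>lborel) + c * ((t' - t) powr (1 - \<gamma>) / (1 - \<gamma>)))"
proof -
  define h where "h = t' - t"
  have h: "h > 0" using t by (simp add: h_def)
  have M: "0 \<le> M" using bcont_nonneg[OF source_on_bcont[OF F, of t]] t by auto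
  have F': "source_on t M F" using F t by (auto intro: source_on_mono)
  have t'0: "0 < t'" and tT: "t \<le> T" using t by auto
  have i1: "integrable lborel (\<lambda>s. shift_modulus h (t - s))"
    using h t by (intro integrable_lborel_reflect shift_modulus_integrable) auto
  have i2: "integrable lborel (\<lambda>s. riesz \<gamma> h (t' - s))"
    using h \<gamma>_less by (intro riesz_reflect) auto
  have "norm (duhamel k F t' x - duhamel k F t x) = norm (\<integral>s. indicator {0<..<t'} s *\<^sub>R conv (k (t' - s)) (F s) x
      - indicator {0<..<t} s *\<^sub>R conv (k (t - s)) (F s) x \<partial>lborel)"
    using duhamel_integrable[OF F t'0 t(3), of x] duhamel_integrable[OF F' t(1) tT, of x]
    by (simp add: duhamel_def set_lebesgue_integral_def set_integrable_def)
  also have "\<dots> \<le> (\<integral>s. M * (shift_modulus h (t - s) + c * riesz \<gamma> h (t' - s)) \<partial>lborel)"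
  proof (rule Bochner_Integration.integral_norm_bound_integral)
    show "integrable lborel (\<lambda>s. indicator {0<..<t'} s *\<^sub>R conv (k (t' - s)) (F s) x
      - indicator {0<..<t} s *\<^sub>R conv (k (t - s)) (F s) x)"
      using duhamel_integrable[OF F t'0 t(3), of x] duhamel_integrable[OF F' t(1) tT, of x]
      by (simp add: set_integrable_def)
    show "integrable lborel (\<lambda>s. M * (shift_modulus h (t - s) + c * riesz \<gamma> h (t' - s)))"
      using i1 i2 by auto
    fix s :: real
    consider "s \<in> {0<..<t}" | "s \<in> {t..<t'}" | "s \<notin> {0<..<t'}" by force
    then show "norm (indicator {0<..<t'} s *\<^sub>R conv (k (t' - s)) (F s) x
      - indicator {0<..<t} s *\<^sub>R conv (k (t - s)) (F s) x) \<le> M * (shift_modulus h (t - s) + c * riesz \<gamma> h (t' - s))"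
    proof cases
      case 1
      then have i: "t' - s \<in> {0<..T}" "t - s \<in> {0<..T}" using t by auto
      have "norm (conv (k (t' - s)) (F s) x - conv (k (t - s)) (F s) x) \<le> M * L1_norm (\<lambda>y. k (t' - s) y - k (t - s) y)"
        using 1 unfolding conv_diff_kernel[OF k_integrable[OF i(1)] k_integrable[OF i(2)] source_on_bcont[OF F' 1]]
        by (intro norm_conv_le Bochner_Integration.integrable_diff k_integrable i source_on_bcont[OF F'])
      also have "\<dots> = M * shift_modulus h (t - s)"
        using 1 t by (simp add: shift_modulus_def h_def)
      also have "\<dots> \<le> M * (shift_modulus h (t - s) + c * riesz \<gamma> h (t' - s))"
        using M c_nonneg by (intro mult_left_mono) auto
      finally show ?thesis using 1 t by simp
    next
      case 2
      then have i: "t' - s \<in> {0<..T}" "s \<in> {0<..<t'}" using t by auto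
      have "norm (conv (k (t' - s)) (F s) x) \<le> M * L1_norm (k (t' - s))"
        by (intro norm_conv_le k_integrable i source_on_bcont[OF F])
      also have "\<dots> \<le> M * (c * (t' - s) powr (- \<gamma>))"
        by (intro mult_left_mono k_bound i M)
      also have "\<dots> = M * (c * riesz \<gamma> h (t' - s))"
        using 2 by (simp add: riesz_eq h_def)
      also have "\<dots> \<le> M * (shift_modulus h (t - s) + c * riesz \<gamma> h (t' - s))"
        using M by (intro mult_left_mono) auto
      finally show ?thesis using 2 t by simp
    next
      case 3
      then show ?thesis using t M c_nonneg by (auto intro!: mult_nonneg_nonneg add_nonneg_nonneg)
    qed
  qed
  also have "\<dots> = M * ((\<integral>s. shift_modulus h (t - s) \<partial>lborel) + c * (\<integral>s. riesz \<gamma> h (t' - s) \<partial>lborel))"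
    using i1 i2 by simp
  also have "\<dots> = M * ((\<integral>\<tau>. shift_modulus h \<tau> \<partial>lborel) + c * (h powr (1 - \<gamma>) / (1 - \<gamma>)))"
    using h \<gamma>_less by (simp add: integral_lborel_reflect[OF shift_modulus_measurable] riesz_reflect)
  finally show ?thesis by (simp add: h_def)
qed

lemma uniform_limit_duhamel:
  assumes F: "source_on T' M F" and T': "T' \<le> T" and t: "t \<in> {0<..T'}"
  shows "uniform_limit UNIV (duhamel k F) (duhamel k F t) (at t within {0<..T'})"
  unfolding uniform_limit_iff
proof (intro allI impI)
  fix e :: real assume e: "e > 0"
  define \<Omega> where "\<Omega> h = M * ((\<integral>\<tau>. shift_modulus h \<tau> \<partial>lborel) + c * (h powr (1 - \<gamma>) / (1 - \<gamma>)))" for h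
  have T: "T > 0" using t T' by auto
  have p0: "((\<lambda>h::real. h powr (1 - \<gamma>)) \<longlongrightarrow> 0 powr (1 - \<gamma>)) (at_right 0)"
    using \<gamma>_less eventually_at_right_less[of "0::real"]
    by (intro tendsto_powr' tendsto_intros) (auto elim!: eventually_mono)
  have "((\<lambda>h. M * ((\<integral>\<tau>. shift_modulus h \<tau> \<partial>lborel) + c * (h powr (1 - \<gamma>) / (1 - \<gamma>)))) \<longlongrightarrow> M * (0 + c * (0 powr (1 - \<gamma>) / (1 - \<gamma>)))) (at_right 0)"
    using \<gamma>_less by (intro tendsto_mult tendsto_add tendsto_divide tendsto_const p0 shift_modulus_tendsto T) auto
  then have "(\<Omega> \<longlongrightarrow> 0) (at_right 0)" using \<gamma>_less by (simp add: \<Omega>_def[abs_def])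
  then have "eventually (\<lambda>h. \<Omega> h < e) (at_right 0)" using e by (rule order_tendstoD(2))
  then obtain d where d: "d > 0" "\<And>h. 0 < h \<Longrightarrow> h < d \<Longrightarrow> \<Omega> h < e"
    unfolding eventually_at by (auto simp: dist_real_def)
  have le: "norm (duhamel k F b x - duhamel k F a x) \<le> \<Omega> (b - a)" if "0 < a" "a < b" "b \<le> T'" for a b x
    unfolding \<Omega>_def using that T' by (intro norm_duhamel_time_diff_le source_on_mono[OF F]) auto
  show "eventually (\<lambda>s. \<forall>x\<in>UNIV. dist (duhamel k F s x) (duhamel k F t x) < e) (at t within {0<..T'})"
    unfolding eventually_at
  proof (intro exI[of _ d] conjI ballI impI d(1))
    fix s x assume s: "s \<in> {0<..T'}" "s \<noteq> t \<and> dist s t < d"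
    show "dist (duhamel k F s x) (duhamel k F t x) < e"
    proof (cases "s < t")
      case True
      then show ?thesis using le[of s t x] d(2)[of "t - s"] s t by (auto simp: dist_norm norm_minus_commute)
    next
      case False
      then show ?thesis using le[of t s x] d(2)[of "s - t"] s t by (auto simp: dist_norm)
    qed
  qed
qed

end

section \<open>The fixed point problem for the gradient\<close>

locale heat_gradient = fourier_semigroup p Dp \<psi> T
  for p :: "real \<Rightarrow> 'a::euclidean_space \<Rightarrow> real" and Dp \<psi> T +
  fixes c \<gamma> :: real
  assumes Dc_nonneg: "0 \<le> c" and D\<gamma>_nonneg: "0 \<le> \<gamma>" and D\<gamma>_less: "\<gamma> < 1"
    and Dp_bound: "t \<in> {0<..T} \<Longrightarrow> L1_norm (Dp t) \<le> c * t powr (- \<gamma>)"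
begin

sublocale P: l1_kernel p T 1 0
  by unfold_locales (auto simp: p_mass intro: p_integrable p_L1_continuous)

sublocale D: l1_kernel Dp T c \<gamma>
  by unfold_locales
    (auto simp: Dc_nonneg D\<gamma>_nonneg D\<gamma>_less intro: Dp_integrable Dp_L1_continuous Dp_bound)

lemma GDERIV_semigroup:
  assumes "t \<in> {0<..T}" "bcont B f"
  shows "GDERIV (conv (p t) f) x :> conv (Dp t) f x"
  using assms by (intro GDERIV_conv p_GDERIV Dp_cont p_integrable Dp_integrable)

lemma GDERIV_duhamel:
  assumes F: "source_on t M F" and t: "0 < t" "t \<le> T"
  shows "GDERIV (duhamel p F t) x :> duhamel Dp F t x"
  unfolding duhamel_def set_lebesgue_integral_def
proof (rule GDERIV_lebesgue_integral)
  have M: "0 \<le> M" using bcont_nonneg[OF source_on_bcont[OF F, of "t/2"]] t by auto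
  show "GDERIV (\<lambda>x. indicator {0<..<t} s *\<^sub>R conv (p (t - s)) (F s) x) x :> indicator {0<..<t} s *\<^sub>R conv (Dp (t - s)) (F s) x" for s x
  proof (cases "s \<in> {0<..<t}")
    case True
    then have "t - s \<in> {0<..T}" using t by auto
    with GDERIV_semigroup[OF this source_on_bcont[OF F True], of x] True show ?thesis by simp
  qed (simp add: GDERIV_const)
  show "integrable lborel (\<lambda>s. M * c * riesz \<gamma> (t - 0) (t - s))"
    using t D\<gamma>_less by (intro integrable_mult_right riesz_reflect) auto
  show "norm (indicator {0<..<t} s *\<^sub>R conv (Dp (t - s)) (F s) x) \<le> M * c * riesz \<gamma> (t - 0) (t - s)" for s x
    using D.norm_conv_kernel_le[OF source_on_bcont[OF F] t(2), of s 0 s x] M Dc_nonneg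
    by (cases "s \<in> {0<..<t}") (auto simp: abs_mult)
  show "integrable lborel (\<lambda>s. indicator {0<..<t} s *\<^sub>R conv (p (t - s)) (F s) x)" for x
    using P.duhamel_integrable[OF F t, of x] by (simp add: set_integrable_def)
  show "(\<lambda>s. indicator {0<..<t} s *\<^sub>R conv (Dp (t - s)) (F s) x) \<in> borel_measurable lborel" for x
    by (rule D.duhamel_measurable[OF F t(2)])
qed

end

text \<open>The candidates for the gradient of a solution on \<open>(0, \<tau>]\<close>.\<close>

definition field_on :: "real \<Rightarrow> real \<Rightarrow> (real \<Rightarrow> 'a::euclidean_space \<Rightarrow> 'a) \<Rightarrow> bool"
  where "field_on \<tau> R w \<longleftrightarrow> continuous_on ({0<..\<tau>} \<times> UNIV) (\<lambda>(t, x). w t x) \<and>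
     (\<forall>t\<in>{0<..\<tau>}. \<forall>x. norm (w t x) \<le> R)"

lemma field_on_mono: "field_on \<tau> R w \<Longrightarrow> R \<le> R' \<Longrightarrow> field_on \<tau> R' w"
  unfolding field_on_def by (meson order_trans)

text \<open>The analytic content of the hypotheses on the Hamiltonian and the initial datum, with \<open>Dp\<close> kept
abstract, so that the fixed point argument takes place in an arbitrary Euclidean space.\<close>

locale hamilton_jacobi = heat_gradient p Dp \<psi> T c \<gamma>
  for p :: "real \<Rightarrow> 'a::euclidean_space \<Rightarrow> real" and Dp \<psi> T c \<gamma> +
  fixes H :: "real \<Rightarrow> 'a \<Rightarrow> 'a \<Rightarrow> real" and u\<^sub>0 :: "'a \<Rightarrow> real" and H\<^sub>0 B K :: real
  assumes T_pos: "0 < T"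
    and H_cont: "continuous_on ({0<..<T} \<times> UNIV \<times> UNIV) (\<lambda>(t, x, q). H t x q)"
    and H_zero: "\<And>t x. t \<in> {0<..<T} \<Longrightarrow> \<bar>H t x 0\<bar> \<le> H\<^sub>0"
    and H_lip: "\<And>R. \<exists>L\<ge>0. \<forall>t\<in>{0<..<T}. \<forall>x q r. norm q \<le> R \<longrightarrow> norm r \<le> R \<longrightarrow>
        \<bar>H t x q - H t x r\<bar> \<le> L * norm (q - r)"
    and u0_bcont: "bcont B u\<^sub>0"
    and u0_lip: "\<And>x y. \<bar>u\<^sub>0 x - u\<^sub>0 y\<bar> \<le> K * norm (x - y)"
begin

definition H_lipschitz :: "real \<Rightarrow> real \<Rightarrow> bool"
  where "H_lipschitz R L \<longleftrightarrow> 0 \<le> L \<and> (\<forall>t\<in>{0<..<T}. \<forall>x q r. norm q \<le> R \<longrightarrow> norm r \<le> R \<longrightarrow>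
        \<bar>H t x q - H t x r\<bar> \<le> L * norm (q - r))"

lemma ex_H_lipschitz: "\<exists>L. H_lipschitz R L"
  using H_lip[of R] by (auto simp: H_lipschitz_def)

lemma H_lipschitzD:
  "H_lipschitz R L \<Longrightarrow> t \<in> {0<..<T} \<Longrightarrow> norm q \<le> R \<Longrightarrow> norm r \<le> R \<Longrightarrow> \<bar>H t x q - H t x r\<bar> \<le> L * norm (q - r)"
  by (auto simp: H_lipschitz_def)

definition forcing :: "(real \<Rightarrow> 'a \<Rightarrow> 'a) \<Rightarrow> real \<Rightarrow> 'a \<Rightarrow> real"
  where "forcing w s y = H s y (w s y)"

definition mild_map :: "(real \<Rightarrow> 'a \<Rightarrow> 'a) \<Rightarrow> real \<Rightarrow> 'a \<Rightarrow> real"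
  where "mild_map w t x = conv (p t) u\<^sub>0 x + duhamel p (forcing w) t x"

definition grad_map :: "(real \<Rightarrow> 'a \<Rightarrow> 'a) \<Rightarrow> real \<Rightarrow> 'a \<Rightarrow> 'a"
  where "grad_map w t x = conv (Dp t) u\<^sub>0 x + duhamel Dp (forcing w) t x"

lemma source_on_forcing:
  assumes w: "field_on \<tau> R w" and \<tau>: "\<tau> \<le> T" and L: "H_lipschitz R L" and R: "0 \<le> R"
  shows "source_on \<tau> (H\<^sub>0 + L * R) (forcing w)"
  unfolding source_on_def
proof (intro conjI ballI allI)
  have "continuous_on ({0<..<\<tau>} \<times> UNIV) (\<lambda>z. w (fst z) (snd z))"
    using w by (auto simp: field_on_def split_def elim!: continuous_on_subset)
  then have "continuous_on ({0<..<\<tau>} \<times> UNIV) (\<lambda>z. (\<lambda>(t, x, q). H t x q) (fst z, snd z, w (fst z) (snd z)))"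
    using \<tau> by (intro continuous_on_compose2[OF H_cont] continuous_intros) auto
  then show "continuous_on ({0<..<\<tau>} \<times> UNIV) (\<lambda>(s, x). forcing w s x)"
    by (simp add: forcing_def split_def)
  fix s x assume s: "s \<in> {0<..<\<tau>}"
  then have s': "s \<in> {0<..<T}" using \<tau> by auto
  have nw: "norm (w s x) \<le> R" using w s by (auto simp: field_on_def)
  have "\<bar>H s x (w s x) - H s x 0\<bar> \<le> L * norm (w s x - 0)"
    using nw R by (intro H_lipschitzD[OF L s']) auto
  also have "\<dots> \<le> L * R" using nw L by (intro mult_left_mono) (auto simp: H_lipschitz_def)
  finally show "\<bar>forcing w s x\<bar> \<le> H\<^sub>0 + L * R"
    using H_zero[OF s', of x] unfolding forcing_def by linarith
qed

lemma ex_source_on_forcing: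
  assumes w: "field_on \<tau> R w" and \<tau>: "\<tau> \<le> T" and R: "0 \<le> R"
  shows "\<exists>M. source_on \<tau> M (forcing w)"
  using ex_H_lipschitz[of R] source_on_forcing[OF w \<tau> _ R] by blast

text \<open>The bound by a multiple of \<open>t\<^sup>-\<^sup>\<gamma>\<close> blows up at time 0. Instead, averaging against a probability density
preserves the Lipschitz constant of \<open>u\<^sub>0\<close>.\<close>

lemma norm_conv_Dp_u0_le:
  assumes t: "t \<in> {0<..T}"
  shows "norm (conv (Dp t) u\<^sub>0 x) \<le> K"
proof (rule norm_gradient_le_Lipschitz[OF GDERIV_semigroup[OF t u0_bcont]])
  fix y
  have sh: "bcont B (\<lambda>z. u\<^sub>0 (z + (y - x)))"
    using u0_bcont by (auto simp: bcont_def intro!: continuous_intros elim!: continuous_on_compose2)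
  have bc: "bcont (K * norm (y - x)) (\<lambda>z. u\<^sub>0 (z + (y - x)) - u\<^sub>0 z)"
  proof (rule bcontI)
    show "continuous_on UNIV (\<lambda>z. u\<^sub>0 (z + (y - x)) - u\<^sub>0 z)"
      using sh u0_bcont by (auto simp: bcont_def intro!: continuous_intros)
    show "\<bar>u\<^sub>0 (z + (y - x)) - u\<^sub>0 z\<bar> \<le> K * norm (y - x)" for z
      using u0_lip[of "z + (y - x)" z] by simp
  qed
  have "conv (p t) u\<^sub>0 y - conv (p t) u\<^sub>0 x = conv (p t) (\<lambda>z. u\<^sub>0 (z + (y - x)) - u\<^sub>0 z) x"
    unfolding conv_diff_fun[OF p_integrable[OF t] sh u0_bcont, symmetric]
    by (simp add: conv_def algebra_simps)
  also have "\<bar>\<dots>\<bar> \<le> K * norm (y - x) * L1_norm (p t)"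
    using norm_conv_le[OF p_integrable[OF t] bc] by simp
  finally show "\<bar>conv (p t) u\<^sub>0 y - conv (p t) u\<^sub>0 x\<bar> \<le> K * norm (y - x)" using p_mass[OF t] by simp
qed

lemma GDERIV_mild_map:
  assumes w: "field_on \<tau> R w" and t: "t \<in> {0<..\<tau>}" and \<tau>: "\<tau> \<le> T" and R: "0 \<le> R"
  shows "GDERIV (mild_map w t) x :> grad_map w t x"
proof -
  obtain M where M: "source_on \<tau> M (forcing w)" using ex_source_on_forcing[OF w \<tau> R] by auto
  have "source_on t M (forcing w)" using source_on_mono[OF M] t by auto
  then have "GDERIV (\<lambda>x. conv (p t) u\<^sub>0 x + duhamel p (forcing w) t x) x :> conv (Dp t) u\<^sub>0 x + duhamel Dp (forcing w) t x"
    using t \<tau> by (intro GDERIV_add GDERIV_semigroup[OF _ u0_bcont] GDERIV_duhamel) auto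
  then show ?thesis by (simp add: mild_map_def[abs_def] grad_map_def)
qed

lemma uniform_limit_mild_map:
  assumes w: "field_on \<tau> R w" and t: "t \<in> {0<..\<tau>}" and \<tau>: "\<tau> \<le> T" and R: "0 \<le> R"
  shows "uniform_limit UNIV (mild_map w) (mild_map w t) (at t within {0<..\<tau>})"
    and "uniform_limit UNIV (grad_map w) (grad_map w t) (at t within {0<..\<tau>})"
proof -
  obtain M where M: "source_on \<tau> M (forcing w)" using ex_source_on_forcing[OF w \<tau> R] by auto
  have le: "at t within {0<..\<tau>} \<le> at t within {0<..T}" using \<tau> by (intro at_le) auto
  have t': "t \<in> {0<..T}" using t \<tau> by auto
  have "uniform_limit UNIV (\<lambda>t x. conv (p t) u\<^sub>0 x + duhamel p (forcing w) t x) (\<lambda>x. conv (p t) u\<^sub>0 x + duhamel p (forcing w) t x) (at t within {0<..\<tau>})"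
    by (intro uniform_limit_intros filterlim_mono[OF P.uniform_limit_conv[OF u0_bcont t'] order_refl le]
        P.uniform_limit_duhamel[OF M \<tau> t])
  then show "uniform_limit UNIV (mild_map w) (mild_map w t) (at t within {0<..\<tau>})"
    by (simp add: mild_map_def[abs_def])
  have "uniform_limit UNIV (\<lambda>t x. conv (Dp t) u\<^sub>0 x + duhamel Dp (forcing w) t x) (\<lambda>x. conv (Dp t) u\<^sub>0 x + duhamel Dp (forcing w) t x) (at t within {0<..\<tau>})"
    by (intro uniform_limit_intros filterlim_mono[OF D.uniform_limit_conv[OF u0_bcont t'] order_refl le]
        D.uniform_limit_duhamel[OF M \<tau> t])
  then show "uniform_limit UNIV (grad_map w) (grad_map w t) (at t within {0<..\<tau>})"
    by (simp add: grad_map_def[abs_def])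
qed

lemma continuous_on_grad_map:
  assumes w: "field_on \<tau> R w" and t: "t \<in> {0<..\<tau>}" and \<tau>: "\<tau> \<le> T" and R: "0 \<le> R"
  shows "continuous_on UNIV (grad_map w t)"
proof -
  obtain M where M: "source_on \<tau> M (forcing w)" using ex_source_on_forcing[OF w \<tau> R] by auto
  have "source_on t M (forcing w)" using source_on_mono[OF M] t by auto
  then have "continuous_on UNIV (\<lambda>x. conv (Dp t) u\<^sub>0 x + duhamel Dp (forcing w) t x)"
    using t \<tau> by (intro continuous_on_add continuous_on_conv[OF _ u0_bcont] D.continuous_on_duhamel Dp_integrable) auto
  then show ?thesis by (simp add: grad_map_def[abs_def])
qed

lemma abs_mild_map_le:
  assumes F: "source_on \<tau> M (forcing w)" and t: "t \<in> {0<..\<tau>}" and \<tau>: "\<tau> \<le> T"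
  shows "\<bar>mild_map w t x\<bar> \<le> B + M * T"
proof -
  have tT: "t \<in> {0<..T}" using t \<tau> by auto
  have s: "source_on t M (forcing w)" using F t by (auto intro: source_on_mono)
  have M: "0 \<le> M" using bcont_nonneg[OF source_on_bcont[OF s, of "t/2"]] t by auto
  have "\<bar>conv (p t) u\<^sub>0 x\<bar> \<le> B" using norm_conv_le[OF p_integrable[OF tT] u0_bcont, of x] p_mass[OF tT] by simp
  moreover have "\<bar>duhamel p (forcing w) t x\<bar> \<le> M * T"
    using P.norm_duhamel_le[OF s, of x] tT mult_left_mono[of t T M] M by auto
  ultimately show ?thesis unfolding mild_map_def by linarith
qed

lemma norm_grad_map_le:
  assumes F: "source_on \<tau> M (forcing w)" and t: "t \<in> {0<..\<tau>}" and \<tau>: "\<tau> \<le> T"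
  shows "norm (grad_map w t x) \<le> K + M * c * (\<tau> powr (1 - \<gamma>) / (1 - \<gamma>))"
proof -
  have s: "source_on t M (forcing w)" using F t by (auto intro: source_on_mono)
  have M: "0 \<le> M" using bcont_nonneg[OF source_on_bcont[OF s, of "t/2"]] t by auto
  have "norm (duhamel Dp (forcing w) t x) \<le> M * c * (t powr (1 - \<gamma>) / (1 - \<gamma>))"
    using t \<tau> by (intro D.norm_duhamel_le s) auto
  also have "\<dots> \<le> M * c * (\<tau> powr (1 - \<gamma>) / (1 - \<gamma>))"
    using t D\<gamma>_less M Dc_nonneg by (intro mult_left_mono divide_right_mono powr_mono2) auto
  finally show ?thesis
    unfolding grad_map_def using t \<tau> by (intro norm_triangle_le add_mono norm_conv_Dp_u0_le) auto
qed

text \<open>The contraction estimate on a time step so short that the factor is \<open>1/2\<close>.\<close>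

lemma norm_grad_map_diff_le:
  assumes w: "field_on \<tau> R w" and v: "field_on \<tau> R v" and L: "H_lipschitz R L" and \<tau>: "\<tau> \<le> T" and R: "0 \<le> R"
    and t: "t \<in> {0<..\<tau>}" and a: "0 \<le> a" "a \<le> t" and \<delta>: "t - a \<le> \<delta>" "L * c * (\<delta> powr (1 - \<gamma>) / (1 - \<gamma>)) \<le> 1 / 2"
    and eq: "\<And>s x. s \<in> {0<..<t} \<Longrightarrow> s \<le> a \<Longrightarrow> w s x = v s x"
    and le: "\<And>s x. s \<in> {a<..<t} \<Longrightarrow> norm (w s x - v s x) \<le> m" and m: "0 \<le> m"
  shows "norm (grad_map w t x - grad_map v t x) \<le> m / 2"
proof -
  have L0: "0 \<le> L" using L by (simp add: H_lipschitz_def)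
  have "norm (grad_map w t x - grad_map v t x) = norm (duhamel Dp (forcing w) t x - duhamel Dp (forcing v) t x)"
    by (simp add: grad_map_def)
  also have "\<dots> \<le> (L * m) * c * ((t - a) powr (1 - \<gamma>) / (1 - \<gamma>))"
  proof (rule D.norm_duhamel_diff_le)
    show "source_on t (H\<^sub>0 + L * R) (forcing w)" "source_on t (H\<^sub>0 + L * R) (forcing v)"
      using t by (auto intro!: source_on_mono[OF source_on_forcing] w v L R \<tau>)
    fix s x
    show "forcing w s x = forcing v s x" if "s \<in> {0<..<t}" "s \<le> a"
      using eq[OF that] by (simp add: forcing_def)
    show "\<bar>forcing w s x - forcing v s x\<bar> \<le> L * m" if s: "s \<in> {a<..<t}"
    proof -
      have s': "s \<in> {0<..<T}" "s \<in> {0<..\<tau>}" using s t a \<tau> by auto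
      have "\<bar>forcing w s x - forcing v s x\<bar> \<le> L * norm (w s x - v s x)"
        unfolding forcing_def using w v s' by (intro H_lipschitzD[OF L]) (auto simp: field_on_def)
      also have "\<dots> \<le> L * m" by (intro mult_left_mono le s L0)
      finally show ?thesis .
    qed
  qed (use t \<tau> a m L0 in auto)
  also have "\<dots> \<le> (L * m) * c * (\<delta> powr (1 - \<gamma>) / (1 - \<gamma>))"
    using a \<delta> D\<gamma>_less m L0 Dc_nonneg by (intro mult_left_mono divide_right_mono powr_mono2) auto
  also have "\<dots> = m * (L * c * (\<delta> powr (1 - \<gamma>) / (1 - \<gamma>)))" by simp
  also have "\<dots> \<le> m * (1 / 2)" by (intro mult_left_mono \<delta> m)
  finally show ?thesis by simp
qed

text \<open>Here \<open>\<gamma> < 1\<close> is essential: the accumulated singularity \<open>\<delta> powr (1 - \<gamma>)\<close> tends to 0 with \<open>\<delta>\<close>.\<close>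

lemma ex_small_time:
  assumes "0 \<le> M"
  shows "\<exists>\<delta>>0. \<delta> \<le> T \<and> M * c * (\<delta> powr (1 - \<gamma>) / (1 - \<gamma>)) \<le> 1 / 2"
proof -
  define e where "e = (1 - \<gamma>) / (2 * (M * c + 1))"
  have Mc: "0 \<le> M * c" using assms Dc_nonneg by simp
  have e: "e > 0" using D\<gamma>_less Mc by (auto simp: e_def intro!: divide_pos_pos add_nonneg_pos)
  define \<delta> where "\<delta> = min T (e powr (1 / (1 - \<gamma>)))"
  have \<delta>: "0 < \<delta>" "\<delta> \<le> T" using T_pos e by (auto simp: \<delta>_def)
  have "\<delta> powr (1 - \<gamma>) \<le> (e powr (1 / (1 - \<gamma>))) powr (1 - \<gamma>)"
    using \<delta> D\<gamma>_less by (intro powr_mono2) (auto simp: \<delta>_def)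
  also have "\<dots> = e" using e D\<gamma>_less by (simp add: powr_powr)
  finally have "M * c * (\<delta> powr (1 - \<gamma>) / (1 - \<gamma>)) \<le> M * c * (e / (1 - \<gamma>))"
    using D\<gamma>_less Mc by (intro mult_left_mono divide_right_mono) auto
  also have "\<dots> = (M * c) / (2 * (M * c + 1))" using D\<gamma>_less by (simp add: e_def)
  also have "\<dots> \<le> 1 / 2" using Mc by (simp add: field_simps)
  finally show ?thesis using \<delta> by blast
qed

text \<open>Two fixed points that agree up to time \<open>n \<delta>\<close> agree up to time \<open>(n + 1) \<delta>\<close>: on the next step
their distance is bounded by \<open>2 R\<close>, and each application of the fixed point equation halves the
bound. The step length \<open>\<delta>\<close> depends only on \<open>R\<close>, so every time is reached.\<close>

lemma grad_map_fixpoint_unique: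
  assumes w: "field_on \<tau> R w" and v: "field_on \<tau> R v" and \<tau>: "\<tau> \<le> T" and R: "0 \<le> R"
    and fw: "\<And>t x. t \<in> {0<..\<tau>} \<Longrightarrow> w t x = grad_map w t x"
    and fv: "\<And>t x. t \<in> {0<..\<tau>} \<Longrightarrow> v t x = grad_map v t x"
    and t: "t \<in> {0<..\<tau>}"
  shows "w t x = v t x"
proof -
  obtain L where L: "H_lipschitz R L" using ex_H_lipschitz by auto
  then have "0 \<le> L" by (simp add: H_lipschitz_def)
  then obtain \<delta> where \<delta>: "0 < \<delta>" "L * c * (\<delta> powr (1 - \<gamma>) / (1 - \<gamma>)) \<le> 1 / 2"
    using ex_small_time by blast
  have "\<forall>t\<in>{0<..\<tau>}. t \<le> real n * \<delta> \<longrightarrow> (\<forall>x. w t x = v t x)" for n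
  proof (induction n)
    case 0 then show ?case by auto
  next
    case (Suc n)
    have *: "\<forall>t\<in>{0<..\<tau>}. t \<le> real (Suc n) * \<delta> \<longrightarrow> (\<forall>x. norm (w t x - v t x) \<le> 2 * R / 2 ^ j)" for j
    proof (induction j)
      case 0
      show ?case
      proof (intro ballI impI allI)
        fix t x assume t: "t \<in> {0<..\<tau>}"
        then have "norm (w t x) \<le> R" "norm (v t x) \<le> R" using w v by (auto simp: field_on_def)
        then show "norm (w t x - v t x) \<le> 2 * R / 2 ^ 0"
          using norm_triangle_ineq4[of "w t x" "v t x"] by simp
      qed
    next
      case (Suc j)
      show ?case
      proof (intro ballI impI allI)
        fix t x assume t: "t \<in> {0<..\<tau>}" "t \<le> real (Suc n) * \<delta>"
        show "norm (w t x - v t x) \<le> 2 * R / 2 ^ Suc j"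
        proof (cases "t \<le> real n * \<delta>")
          case True
          then show ?thesis using Suc.prems \<open>\<forall>t\<in>{0<..\<tau>}. t \<le> real n * \<delta> \<longrightarrow> (\<forall>x. w t x = v t x)\<close> t R by auto
        next
          case False
          have "norm (grad_map w t x - grad_map v t x) \<le> (2 * R / 2 ^ j) / 2"
          proof (rule norm_grad_map_diff_le[OF w v L \<tau> R t(1), where a="real n * \<delta>" and \<delta>=\<delta>])
            show "t - real n * \<delta> \<le> \<delta>" using t(2) by (simp add: algebra_simps)
            show "w s x = v s x" if "s \<in> {0<..<t}" "s \<le> real n * \<delta>" for s x
              using that t \<open>\<forall>t\<in>{0<..\<tau>}. t \<le> real n * \<delta> \<longrightarrow> (\<forall>x. w t x = v t x)\<close> by auto
            show "norm (w s x - v s x) \<le> 2 * R / 2 ^ j" if s: "s \<in> {real n * \<delta><..<t}" for s x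
            proof -
              have "0 \<le> real n * \<delta>" using \<delta> by simp
              then have "s \<in> {0<..\<tau>}" "s \<le> real (Suc n) * \<delta>" using s t by auto
              then show ?thesis using Suc.IH by blast
            qed
          qed (use \<delta> False R in auto)
          then show ?thesis using fw[OF t(1)] fv[OF t(1)] by simp
        qed
      qed
    qed
    show ?case
    proof (intro ballI impI allI)
      fix t x assume t: "t \<in> {0<..\<tau>}" "t \<le> real (Suc n) * \<delta>"
      have "(\<lambda>j. 2 * R * (1 / 2) ^ j) \<longlonglongrightarrow> 2 * R * 0"
        by (intro tendsto_intros LIMSEQ_realpow_zero) auto
      then have "norm (w t x - v t x) \<le> 2 * R * 0"
        by (rule LIMSEQ_le_const) (use * t in \<open>auto simp: power_divide\<close>)
      then show "w t x = v t x" by simp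
    qed
  qed
  moreover obtain n where "t / \<delta> \<le> real n" using real_arch_simple by blast
  ultimately show ?thesis using t \<delta>(1) by (auto simp: field_simps)
qed

text \<open>Picard iteration from 0 among the fields bounded by \<open>K + 1\<close>. Successive differences decrease
geometrically, so the iterates converge uniformly on \<open>(0, \<tau>] \<times> \<real>\<^sup>n\<close> and the limit is again
jointly continuous.\<close>

lemma grad_map_fixpoint_exists:
  "\<exists>\<tau>\<in>{0<..T}. \<exists>R\<ge>0. \<exists>w. field_on \<tau> R w \<and> (\<forall>t\<in>{0<..\<tau>}. \<forall>x. w t x = grad_map w t x)"
proof -
  have K: "0 \<le> K" using order_trans[OF norm_ge_zero norm_conv_Dp_u0_le[of T]] T_pos by auto
  \<comment> \<open>The linear term accounts for \<open>K\<close>, and the integral term is kept below 1 by the choice of \<open>\<tau>\<close>.\<close>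
  define R where "R = K + 1"
  have R: "0 \<le> R" using K by (simp add: R_def)
  obtain L where L: "H_lipschitz R L" using ex_H_lipschitz by auto
  then have L0: "0 \<le> L" by (simp add: H_lipschitz_def)
  have H0: "0 \<le> H\<^sub>0" using order_trans[OF abs_ge_zero H_zero[of "T/2"]] T_pos by auto
  define M where "M = H\<^sub>0 + L * R"
  have M: "0 \<le> M" using H0 L0 R by (simp add: M_def)
  \<comment> \<open>One smallness condition serves both the invariance of the ball (through \<open>M\<close>) and the contraction (through \<open>L\<close>).\<close>
  obtain \<tau> where \<tau>: "0 < \<tau>" "\<tau> \<le> T" and small: "(M + L) * c * (\<tau> powr (1 - \<gamma>) / (1 - \<gamma>)) \<le> 1 / 2"
    using ex_small_time[of "M + L"] M L0 by auto
  have \<rho>: "0 \<le> c * (\<tau> powr (1 - \<gamma>) / (1 - \<gamma>))" using Dc_nonneg D\<gamma>_less by simp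
  have smallM: "M * c * (\<tau> powr (1 - \<gamma>) / (1 - \<gamma>)) \<le> 1" and smallL: "L * c * (\<tau> powr (1 - \<gamma>) / (1 - \<gamma>)) \<le> 1 / 2"
    using small mult_nonneg_nonneg[OF M \<rho>] mult_nonneg_nonneg[OF L0 \<rho>]
    unfolding distrib_right mult.assoc by linarith+
  have step: "field_on \<tau> R (grad_map w)" if w: "field_on \<tau> R w" for w
    unfolding field_on_def
  proof (intro conjI ballI allI)
    show "continuous_on ({0<..\<tau>} \<times> UNIV) (\<lambda>(t, x). grad_map w t x)"
      by (intro continuous_on_Times_uniform_limit continuous_on_grad_map[OF w _ \<tau>(2) R] uniform_limit_mild_map[OF w _ \<tau>(2) R])
    fix t x assume t: "t \<in> {0<..\<tau>}"
    show "norm (grad_map w t x) \<le> R"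
      using norm_grad_map_le[OF source_on_forcing[OF w \<tau>(2) L R] t \<tau>(2), of x] smallM
      by (simp add: R_def M_def)
  qed
  have contr: "norm (grad_map w t x - grad_map v t x) \<le> m / 2"
    if w: "field_on \<tau> R w" and v: "field_on \<tau> R v" and t: "t \<in> {0<..\<tau>}"
      and m: "0 \<le> m" "\<And>s x. s \<in> {0<..\<tau>} \<Longrightarrow> norm (w s x - v s x) \<le> m" for w v t x m
    by (rule norm_grad_map_diff_le[OF w v L \<tau>(2) R t, where a=0 and \<delta>=\<tau>]) (use t m smallL in auto)
  define W where "W n = (grad_map ^^ n) (\<lambda>_ _. 0)" for n
  have W_Suc: "W (Suc n) = grad_map (W n)" for n by (simp add: W_def)
  have W: "field_on \<tau> R (W n)" for n
  proof (induction n)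
    case 0 show ?case using R by (simp add: W_def field_on_def split_def)
  next
    case (Suc n) then show ?case unfolding W_Suc by (rule step)
  qed
  have W_diff: "norm (W (Suc n) t x - W n t x) \<le> 2 * R * (1 / 2) ^ n" if "t \<in> {0<..\<tau>}" for n t x
    using that
  proof (induction n arbitrary: t x)
    case 0
    then have "norm (W (Suc 0) t x) \<le> R" "norm (W 0 t x) \<le> R" using W unfolding field_on_def by blast+
    then show ?case using norm_triangle_ineq4[of "W (Suc 0) t x" "W 0 t x"] by simp
  next
    case (Suc n)
    have "norm (grad_map (W (Suc n)) t x - grad_map (W n) t x) \<le> (2 * R * (1 / 2) ^ n) / 2"
      using R Suc by (intro contr W) auto
    then show ?case by (simp add: W_Suc)
  qed
  define S where "S = {0<..\<tau>} \<times> (UNIV :: 'a set)"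
  define w where "w t x = (\<Sum>n. W (Suc n) t x - W n t x)" for t x
  have "uniform_limit S (\<lambda>n z. \<Sum>i<n. W (Suc i) (fst z) (snd z) - W i (fst z) (snd z)) (\<lambda>z. w (fst z) (snd z)) sequentially"
    unfolding w_def
  proof (rule Weierstrass_m_test)
    show "summable (\<lambda>n. 2 * R * (1 / 2 :: real) ^ n)" by (intro summable_mult summable_geometric) auto
  qed (auto simp: S_def intro!: W_diff)
  moreover have "(\<Sum>i<n. W (Suc i) (fst z) (snd z) - W i (fst z) (snd z)) = W n (fst z) (snd z)" for n z
    by (subst sum_lessThan_telescope) (simp add: W_def)
  ultimately have ul: "uniform_limit S (\<lambda>n z. W n (fst z) (snd z)) (\<lambda>z. w (fst z) (snd z)) sequentially"
    by simp
  have lim: "(\<lambda>n. W n t x) \<longlonglongrightarrow> w t x" if "t \<in> {0<..\<tau>}" for t x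
    using tendsto_uniform_limitI[OF ul, of "(t, x)"] that by (simp add: S_def)
  have w: "field_on \<tau> R w"
    unfolding field_on_def
  proof (intro conjI ballI allI)
    have "continuous_on S (\<lambda>z. w (fst z) (snd z))"
      by (rule uniform_limit_theorem[OF _ ul])
         (use W in \<open>auto simp: field_on_def S_def split_def\<close>)
    then show "continuous_on ({0<..\<tau>} \<times> UNIV) (\<lambda>(t, x). w t x)" by (simp add: S_def split_def)
    show "norm (w t x) \<le> R" if "t \<in> {0<..\<tau>}" for t x
      by (rule LIMSEQ_le_const2[OF tendsto_norm[OF lim[OF that]]]) (use W that in \<open>auto simp: field_on_def\<close>)
  qed
  have "w t x = grad_map w t x" if t: "t \<in> {0<..\<tau>}" for t x
  proof -
    have "(\<lambda>n. W (Suc n) t x) \<longlonglongrightarrow> grad_map w t x"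
    proof (rule tendstoI)
      fix e :: real assume e: "e > 0"
      show "eventually (\<lambda>n. dist (W (Suc n) t x) (grad_map w t x) < e) sequentially"
        using uniform_limitD[OF ul e]
      proof eventually_elim
        case (elim n)
        have "norm (grad_map (W n) t x - grad_map w t x) \<le> e / 2"
          using elim e by (intro contr W w t) (auto simp: S_def dist_norm intro: less_imp_le)
        then show ?case using e by (simp add: W_Suc dist_norm)
      qed
    qed
    moreover have "(\<lambda>n. W (Suc n) t x) \<longlonglongrightarrow> w t x" by (rule LIMSEQ_Suc[OF lim[OF t]])
    ultimately show ?thesis using LIMSEQ_unique by blast
  qed
  then show ?thesis using w R \<tau> by (intro bexI[of _ \<tau>] exI[of _ R] exI[of _ w]) auto
qed

end

section \<open>The space of bounded functions with bounded continuous gradient\<close>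

lemma partial_deriv_GDERIV:
  assumes "GDERIV f x :> D"
  shows "partial_deriv i f x = D $ i"
  using frechet_derivative_at[OF assms[unfolded gderiv_def], symmetric]
  by (simp add: partial_deriv_def inner_axis' )

lemma grad_GDERIV: "GDERIV f x :> D \<Longrightarrow> grad f x = D"
  by (simp add: grad_def vec_eq_iff partial_deriv_GDERIV)

lemma GDERIV_grad:
  fixes f :: "real^'n::finite \<Rightarrow> real"
  assumes "f differentiable (at x)"
  shows "GDERIV f x :> grad f x"
proof -
  let ?D = "frechet_derivative f (at x)"
  have D: "(f has_derivative ?D) (at x)" using assms by (simp add: frechet_derivative_works)
  then have lin: "linear ?D" by (simp add: has_derivative_linear)
  have "?D h = h \<bullet> grad f x" for h
  proof -
    have "?D h = ?D (\<Sum>i\<in>UNIV. h $ i *\<^sub>R axis i 1)"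
      by (simp add: basis_expansion flip: scalar_mult_eq_scaleR)
    also have "\<dots> = (\<Sum>i\<in>UNIV. h $ i * ?D (axis i 1))"
      using lin by (simp add: linear_sum linear_scale)
    also have "\<dots> = h \<bullet> grad f x" by (simp add: inner_vec_def grad_def partial_deriv_def)
    finally show ?thesis .
  qed
  then have "?D = (\<lambda>h. h \<bullet> grad f x)" by auto
  then show ?thesis using D by (simp add: gderiv_def)
qed

text \<open>The arguments above treat the gradient as one vector field, whereas the space is defined through
its coordinates; in finite dimension the two descriptions agree.\<close>

lemma Cb1_iff:
  "f \<in> Cb 1 \<longleftrightarrow> (\<exists>B. bcont B f) \<and> (\<forall>x. f differentiable (at x)) \<and>
     continuous_on UNIV (grad f) \<and> (\<exists>C. \<forall>x. norm (grad f x) \<le> C)" (is "?l \<longleftrightarrow> ?r")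
proof -
  have b: "continuous_on UNIV g \<and> bounded (range g) \<longleftrightarrow> (\<exists>B. bcont B g)" for g :: "real^'a \<Rightarrow> real"
    by (auto simp: bcont_def bounded_iff)
  have c: "continuous_on UNIV (grad f) \<longleftrightarrow> (\<forall>i. continuous_on UNIV (partial_deriv i f))"
  proof
    assume "continuous_on UNIV (grad f)"
    then have "continuous_on UNIV (\<lambda>x. grad f x $ i)" for i by (intro continuous_intros)
    then show "\<forall>i. continuous_on UNIV (partial_deriv i f)" by (simp add: grad_def)
  next
    assume "\<forall>i. continuous_on UNIV (partial_deriv i f)"
    then show "continuous_on UNIV (grad f)"
      unfolding grad_def[abs_def] by (intro continuous_on_vec_lambda) auto
  qed
  have d: "(\<exists>C. \<forall>x. norm (grad f x) \<le> C) \<longleftrightarrow> (\<forall>i. bounded (range (partial_deriv i f)))"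
  proof
    assume "\<exists>C. \<forall>x. norm (grad f x) \<le> C"
    then obtain C where C: "norm (grad f x) \<le> C" for x by auto
    have "norm (partial_deriv i f x) \<le> C" for i x
      using component_le_norm_cart[of "grad f x" i] C[of x] by (simp add: grad_def)
    then show "\<forall>i. bounded (range (partial_deriv i f))" by (auto simp: bounded_iff)
  next
    assume "\<forall>i. bounded (range (partial_deriv i f))"
    then obtain C where C: "\<And>i x. norm (partial_deriv i f x) \<le> C i"
      unfolding bounded_iff by (metis UNIV_I image_eqI)
    have "norm (grad f x) \<le> (\<Sum>i\<in>UNIV. C i)" for x
      by (rule order_trans[OF norm_le_l1_cart sum_mono]) (use C in \<open>simp add: grad_def\<close>)
    then show "\<exists>C. \<forall>x. norm (grad f x) \<le> C" by blast
  qed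
  show ?thesis unfolding c d using b[of f] by auto
qed

lemma Cb1_I:
  assumes "\<And>x. GDERIV f x :> D x" "continuous_on UNIV D" "\<And>x. \<bar>f x\<bar> \<le> B" "\<And>x. norm (D x) \<le> C"
  shows "f \<in> Cb 1"
proof -
  have g: "grad f = D" by (rule ext, rule grad_GDERIV[OF assms(1)])
  have d: "f differentiable (at x)" for x
    using assms(1)[of x] unfolding gderiv_def differentiable_def by blast
  then have "continuous_on UNIV f"
    by (intro continuous_at_imp_continuous_on ballI differentiable_imp_continuous_within) auto
  then show ?thesis unfolding Cb1_iff g using assms d by (auto simp: bcont_def)
qed

lemma Cb1_GDERIV: "f \<in> Cb 1 \<Longrightarrow> GDERIV f x :> grad f x"
  unfolding Cb1_iff by (intro GDERIV_grad) auto

lemma Cb1_continuous_grad: "f \<in> Cb 1 \<Longrightarrow> continuous_on UNIV (grad f)"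
  unfolding Cb1_iff by blast

lemma Cb1_bounded: "f \<in> Cb 1 \<Longrightarrow> \<exists>B. \<forall>x. \<bar>f x\<bar> \<le> B"
  unfolding Cb1_iff bcont_def by blast

lemma Cb1_bounded_grad: "f \<in> Cb 1 \<Longrightarrow> \<exists>C. \<forall>x. norm (grad f x) \<le> C"
  unfolding Cb1_iff by blast

lemma Cb1_diff:
  assumes f: "f \<in> Cb 1" and g: "g \<in> Cb 1"
  shows "(\<lambda>x. f x - g x) \<in> Cb 1" and "grad (\<lambda>x. f x - g x) x = grad f x - grad g x"
proof -
  have D: "GDERIV (\<lambda>x. f x - g x) x :> grad f x - grad g x" for x
    by (intro GDERIV_diff Cb1_GDERIV f g)
  then show "grad (\<lambda>x. f x - g x) x = grad f x - grad g x" by (rule grad_GDERIV)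
  obtain A1 B1 A2 B2 where b: "bcont A1 f" "\<And>x. norm (grad f x) \<le> B1" "bcont A2 g" "\<And>x. norm (grad g x) \<le> B2"
    using f g unfolding Cb1_iff by blast
  show "(\<lambda>x. f x - g x) \<in> Cb 1"
  proof (rule Cb1_I[OF D])
    show "continuous_on UNIV (\<lambda>x. grad f x - grad g x)"
      by (intro continuous_intros Cb1_continuous_grad f g)
    show "\<bar>f x - g x\<bar> \<le> A1 + A2" for x using bcont_abs_le[OF b(1), of x] bcont_abs_le[OF b(3), of x] by linarith
    show "norm (grad f x - grad g x) \<le> B1 + B2" for x
      by (rule order_trans[OF norm_triangle_ineq4 add_mono[OF b(2) b(4)]])
  qed
qed

lemma sup_norm_upper: "(\<And>x. \<bar>f x\<bar> \<le> B) \<Longrightarrow> \<bar>f x\<bar> \<le> sup_norm f"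
  unfolding sup_norm_def by (rule cSUP_upper) (auto simp: bdd_above_def)

lemma sup_norm_least: "(\<And>x. \<bar>f x\<bar> \<le> B) \<Longrightarrow> sup_norm f \<le> B"
  unfolding sup_norm_def by (rule cSUP_least) auto

lemma Cb1_norm_le:
  assumes "\<And>x. \<bar>f x\<bar> \<le> A" "\<And>x. norm (grad f x) \<le> B"
  shows "Cb1_norm f \<le> A + B"
proof -
  have "sup_norm (partial_deriv i f) \<le> B" for i
  proof (rule sup_norm_least)
    fix x show "\<bar>partial_deriv i f x\<bar> \<le> B"
      using component_le_norm_cart[of "grad f x" i] assms(2)[of x] by (simp add: grad_def)
  qed
  then show ?thesis unfolding Cb1_norm_def
    by (intro add_mono sup_norm_least assms(1)) auto
qed

text \<open>The norm takes the maximum over coordinates, so the Euclidean length of the gradient costs a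
factor of at most the dimension.\<close>

lemma Cb1_norm_ge:
  fixes f :: "real^'n::finite \<Rightarrow> real"
  assumes f: "f \<in> Cb 1"
  shows "\<bar>f x\<bar> \<le> Cb1_norm f" and "norm (grad f x) \<le> real CARD('n) * Cb1_norm f"
proof -
  obtain A B where b: "bcont A f" "\<And>x. norm (grad f x) \<le> B" using f unfolding Cb1_iff by blast
  let ?m = "Max (range (\<lambda>i. sup_norm (partial_deriv i f)))"
  have pb: "\<bar>partial_deriv i f y\<bar> \<le> B" for i y
    using component_le_norm_cart[of "grad f y" i] b(2)[of y] by (simp add: grad_def)
  have p: "\<bar>partial_deriv i f y\<bar> \<le> ?m" for i y
    by (rule order_trans[OF sup_norm_upper[OF pb] Max_ge]) auto
  have m: "0 \<le> ?m" using p[of undefined undefined] by linarith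
  have s: "\<bar>f y\<bar> \<le> sup_norm f" for y by (rule sup_norm_upper[OF bcont_abs_le[OF b(1)]])
  then have s0: "0 \<le> sup_norm f" using s[of undefined] by linarith
  show "\<bar>f x\<bar> \<le> Cb1_norm f" using s[of x] m unfolding Cb1_norm_def by linarith
  have "norm (grad f x) \<le> (\<Sum>i\<in>(UNIV::'n set). Cb1_norm f)"
    using p s0 by (intro order_trans[OF norm_le_l1_cart sum_mono]) (auto simp: grad_def Cb1_norm_def intro: add_increasing)
  then show "norm (grad f x) \<le> real CARD('n) * Cb1_norm f" by simp
qed

lemma C_time_Cb1_uniform_limit_grad:
  fixes u :: "real \<Rightarrow> real^'n::finite \<Rightarrow> real"
  assumes u: "u \<in> C_time_Cb1 T" and t: "t \<in> {0<..T}"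
  shows "uniform_limit UNIV (\<lambda>s. grad (u s)) (grad (u t)) (at t within {0<..T})"
  unfolding uniform_limit_iff
proof (intro allI impI)
  fix e :: real assume e: "e > 0"
  have C: "u s \<in> Cb 1" if "s \<in> {0<..T}" for s using u that by (auto simp: C_time_Cb1_def)
  have "((\<lambda>s. real CARD('n) * Cb1_norm (\<lambda>x. u s x - u t x)) \<longlongrightarrow> 0) (at t within {0<..T})"
    using u t by (intro tendsto_mult_right_zero) (auto simp: C_time_Cb1_def)
  then have "eventually (\<lambda>s. real CARD('n) * Cb1_norm (\<lambda>x. u s x - u t x) < e) (at t within {0<..T})"
    by (rule order_tendstoD(2)) (rule e)
  moreover have "eventually (\<lambda>s. s \<in> {0<..T}) (at t within {0<..T})"
    by (auto simp: eventually_at_filter)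
  ultimately show "eventually (\<lambda>s. \<forall>x\<in>UNIV. dist (grad (u s) x) (grad (u t) x) < e) (at t within {0<..T})"
  proof eventually_elim
    case (elim s)
    show ?case
      using Cb1_norm_ge(2)[OF Cb1_diff(1)[OF C[OF elim(2)] C[OF t]]] elim(1)
      unfolding dist_norm Cb1_diff(2)[OF C[OF elim(2)] C[OF t]] by (auto intro: le_less_trans)
  qed
qed

lemma C_time_Cb1_I:
  fixes u :: "real \<Rightarrow> real^'n::finite \<Rightarrow> real"
  assumes C: "\<And>t. t \<in> {0<..T} \<Longrightarrow> u t \<in> Cb 1"
    and u: "\<And>t. t \<in> {0<..T} \<Longrightarrow> uniform_limit UNIV u (u t) (at t within {0<..T})"
    and g: "\<And>t. t \<in> {0<..T} \<Longrightarrow> uniform_limit UNIV (\<lambda>s. grad (u s)) (grad (u t)) (at t within {0<..T})"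
  shows "u \<in> C_time_Cb1 T"
  unfolding C_time_Cb1_def
proof (intro CollectI conjI ballI C, assumption)
  fix t assume t: "t \<in> {0<..T}"
  show "((\<lambda>s. Cb1_norm (\<lambda>x. u s x - u t x)) \<longlongrightarrow> 0) (at t within {0<..T})"
  proof (rule tendstoI)
    fix e :: real assume e: "e > 0"
    have "eventually (\<lambda>s. s \<in> {0<..T}) (at t within {0<..T})"
      by (auto simp: eventually_at_filter)
    moreover have "eventually (\<lambda>s. \<forall>x\<in>UNIV. dist (u s x) (u t x) < e / 3) (at t within {0<..T})"
      using e by (intro uniform_limitD[OF u[OF t]]) auto
    moreover have "eventually (\<lambda>s. \<forall>x\<in>UNIV. dist (grad (u s) x) (grad (u t) x) < e / 3) (at t within {0<..T})"
      using e by (intro uniform_limitD[OF g[OF t]]) auto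
    ultimately show "eventually (\<lambda>s. dist (Cb1_norm (\<lambda>x. u s x - u t x)) 0 < e) (at t within {0<..T})"
    proof eventually_elim
      case (elim s)
      note d = Cb1_diff[OF C[OF elim(1)] C[OF t]]
      have "Cb1_norm (\<lambda>x. u s x - u t x) \<le> e / 3 + e / 3"
        using elim by (intro Cb1_norm_le) (auto simp: d(2) dist_norm intro: less_imp_le)
      moreover have "0 \<le> Cb1_norm (\<lambda>x. u s x - u t x)"
        using order_trans[OF abs_ge_zero Cb1_norm_ge(1)[OF d(1)]] .
      ultimately show ?case using e by (simp add: dist_real_def)
    qed
  qed
qed

section \<open>Existence and uniqueness of the mild solution\<close>

lemma semigroup_eq_conv:
  assumes "integrable lborel (p t)" "bcont B \<phi>"
  shows "semigroup p t \<phi> x = conv (p t) \<phi> x"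
  unfolding semigroup_def conv_commute[OF assms] by (simp add: mult.commute)

lemma Cb_infinity_Cb1: "f \<in> Cb_infinity \<Longrightarrow> f \<in> Cb 1"
  unfolding Cb_infinity_def by blast

lemma heat_kernel_density:
  assumes hk: "heat_kernel A mu p" and t: "0 < t"
  shows "integrable lborel (p t)" and "L1_norm (p t) = 1"
    and "fourier (p t) \<xi> = exp (- (complex_of_real t * levy_symbol A mu \<xi>))"
proof -
  have m [measurable]: "p t \<in> borel_measurable borel" and nn: "\<And>x. 0 \<le> p t x"
    and ps: "prob_space (density lborel (\<lambda>x. ennreal (p t x)))"
    and ft: "(\<integral>x. exp (- (\<i> * complex_of_real (\<xi> \<bullet> x))) \<partial>density lborel (\<lambda>x. ennreal (p t x)))
            = exp (- (complex_of_real t * levy_symbol A mu \<xi>))"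
    using hk t by (auto simp: heat_kernel_def)
  interpret prob_space "density lborel (\<lambda>x. ennreal (p t x))" by (rule ps)
  have one: "(\<integral>\<^sup>+x. ennreal (p t x) \<partial>lborel) = 1"
    using emeasure_space_1 by (simp add: emeasure_density)
  show int: "integrable lborel (p t)"
    by (rule integrableI_nn_integral_finite[where x=1]) (use nn one in auto)
  show "L1_norm (p t) = 1"
    using nn one nn_integral_eq_integral[OF int] by (simp add: L1_norm_def)
  have "fourier (p t) \<xi> = (\<integral>x. exp (- (\<i> * complex_of_real (\<xi> \<bullet> x))) \<partial>density lborel (\<lambda>x. ennreal (p t x)))"
    unfolding fourier_def using nn
    by (subst integral_density) (auto simp: scaleR_conv_of_real mult.commute intro!: borel_measurable_continuous_onI continuous_intros)
  then show "fourier (p t) \<xi> = exp (- (complex_of_real t * levy_symbol A mu \<xi>))" using ft by simp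
qed

context
  fixes p :: "real \<Rightarrow> real^'n::finite \<Rightarrow> real" and \<psi> T c \<gamma> H u\<^sub>0 H\<^sub>0 B K
  assumes hj: "hamilton_jacobi p (\<lambda>t. grad (p t)) \<psi> T c \<gamma> H u\<^sub>0 H\<^sub>0 B K"
begin

interpretation hamilton_jacobi p "\<lambda>t. grad (p t)" \<psi> T c \<gamma> H u\<^sub>0 H\<^sub>0 B K by (rule hj)

text \<open>The integrability demanded of mild solutions is automatic once the gradient is bounded and jointly
continuous; what remains is the fixed point equation.\<close>

lemma mild_solution_iff:
  assumes \<tau>: "\<tau> \<le> T" and R: "0 \<le> R" and w: "field_on \<tau> R (\<lambda>t. grad (u t))" and u: "u \<in> C_time_Cb1 \<tau>"
  shows "mild_solution p H u\<^sub>0 \<tau> u \<longleftrightarrow> (\<forall>t\<in>{0<..\<tau>}. \<forall>x. u t x = mild_map (\<lambda>t. grad (u t)) t x)"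
proof -
  let ?F = "forcing (\<lambda>t. grad (u t))"
  obtain M where M: "source_on \<tau> M ?F" using ex_source_on_forcing[OF w \<tau> R] by auto
  have "set_integrable lborel {0<..<t} (\<lambda>s. semigroup p (t - s) (\<lambda>y. H s y (grad (u s) y)) x) \<and>
      (LINT s:{0<..<t}|lborel. semigroup p (t - s) (\<lambda>y. H s y (grad (u s) y)) x) = duhamel p ?F t x \<and>
      semigroup p t u\<^sub>0 x = conv (p t) u\<^sub>0 x"
    if t: "t \<in> {0<..\<tau>}" for t x
  proof (intro conjI)
    have tT: "t \<in> {0<..T}" using t \<tau> by auto
    have Mt: "source_on t M ?F" using source_on_mono[OF M] t by auto
    have eq: "semigroup p (t - s) (\<lambda>y. H s y (grad (u s) y)) x = conv (p (t - s)) (?F s) x" if s: "s \<in> {0<..<t}" for s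
    proof -
      have "t - s \<in> {0<..T}" using s tT by auto
      from semigroup_eq_conv[of p, OF p_integrable[OF this] source_on_bcont[OF Mt s]]
      show ?thesis by (simp add: forcing_def[abs_def])
    qed
    have "set_integrable lborel {0<..<t} (\<lambda>s. conv (p (t - s)) (?F s) x)"
      using tT by (intro P.duhamel_integrable[OF Mt]) auto
    then show "set_integrable lborel {0<..<t} (\<lambda>s. semigroup p (t - s) (\<lambda>y. H s y (grad (u s) y)) x)"
      by (subst set_integrable_cong[OF refl refl eq])
    show "(LINT s:{0<..<t}|lborel. semigroup p (t - s) (\<lambda>y. H s y (grad (u s) y)) x) = duhamel p ?F t x"
      unfolding duhamel_def by (rule set_lebesgue_integral_cong) (use eq in auto)
    show "semigroup p t u\<^sub>0 x = conv (p t) u\<^sub>0 x"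
      by (rule semigroup_eq_conv[of p, OF p_integrable[OF tT] u0_bcont])
  qed
  then show ?thesis
    using u unfolding mild_solution_def mild_map_def by auto
qed

text \<open>Continuity of \<open>t \<mapsto> v t\<close> in \<open>C\<^sub>b\<^sup>1\<close> is uniform convergence of the gradients, which makes the gradient jointly
continuous and hence a legitimate argument of the fixed point map.\<close>

lemma field_on_grad:
  fixes v :: "real \<Rightarrow> real^'n \<Rightarrow> real"
  assumes v: "v \<in> Cb_time_Cb1 \<tau>"
  shows "\<exists>R\<ge>0. field_on \<tau> R (\<lambda>t. grad (v t))"
proof -
  have vC: "v \<in> C_time_Cb1 \<tau>" and C: "\<And>t. t \<in> {0<..\<tau>} \<Longrightarrow> v t \<in> Cb 1"
    using v by (auto simp: Cb_time_Cb1_def C_time_Cb1_def)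
  obtain M where M: "\<And>t. t \<in> {0<..\<tau>} \<Longrightarrow> Cb1_norm (v t) \<le> M"
    using v unfolding Cb_time_Cb1_def by blast
  have "norm (grad (v t) x) \<le> real CARD('n) * max M 0" if t: "t \<in> {0<..\<tau>}" for t x
    by (rule order_trans[OF Cb1_norm_ge(2)[OF C[OF t]] mult_left_mono]) (use M[OF t] in auto)
  moreover have "continuous_on ({0<..\<tau>} \<times> UNIV) (\<lambda>(t, x). grad (v t) x)"
    by (intro continuous_on_Times_uniform_limit C_time_Cb1_uniform_limit_grad[OF vC] Cb1_continuous_grad C)
  ultimately show ?thesis
    by (intro exI[of _ "real CARD('n) * max M 0"]) (auto simp: field_on_def)
qed

text \<open>The fixed point \<open>w\<close> yields \<open>u = mild_map w\<close>, whose gradient is \<open>grad_map w = w\<close>; hence \<open>u\<close> is mild.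
Conversely the gradient of a mild solution is a fixed point, so it equals \<open>w\<close>, and the mild formula
determines the solution from its gradient.\<close>

lemma mild_solution_exists_unique:
  "\<exists>\<tau>\<in>{0<..T}. \<exists>u. (mild_solution p H u\<^sub>0 \<tau> u \<and> u \<in> Cb_time_Cb1 \<tau>) \<and>
     (\<forall>v. mild_solution p H u\<^sub>0 \<tau> v \<and> v \<in> Cb_time_Cb1 \<tau> \<longrightarrow> (\<forall>t\<in>{0<..\<tau>}. \<forall>x. v t x = u t x))"
proof -
  obtain \<tau> R w where \<tau>: "0 < \<tau>" "\<tau> \<le> T" and R: "0 \<le> R" and w: "field_on \<tau> R w"
    and fix_w: "\<And>t x. t \<in> {0<..\<tau>} \<Longrightarrow> w t x = grad_map w t x"
    using grad_map_fixpoint_exists by auto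
  define u where "u = mild_map w"
  have Du: "GDERIV (u t) x :> w t x" if "t \<in> {0<..\<tau>}" for t x
    using GDERIV_mild_map[OF w that \<tau>(2) R, of x] fix_w[OF that, of x] by (simp add: u_def)
  have gu: "grad (u t) = w t" if "t \<in> {0<..\<tau>}" for t
    by (rule ext, rule grad_GDERIV[OF Du[OF that]])
  have gu_field: "field_on \<tau> R (\<lambda>t. grad (u t))"
  proof -
    have "continuous_on ({0<..\<tau>} \<times> UNIV) (\<lambda>(t, x). grad (u t) x) \<longleftrightarrow> continuous_on ({0<..\<tau>} \<times> UNIV) (\<lambda>(t, x). w t x)"
      by (rule continuous_on_cong) (auto simp: gu)
    then show ?thesis using w unfolding field_on_def by (auto simp: gu)
  qed
  obtain M where M: "source_on \<tau> M (forcing w)" using ex_source_on_forcing[OF w \<tau>(2) R] by auto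
  have u_le: "\<bar>u t x\<bar> \<le> B + M * T" if "t \<in> {0<..\<tau>}" for t x
    unfolding u_def by (rule abs_mild_map_le[OF M that \<tau>(2)])
  have w_le: "norm (w t x) \<le> R" if "t \<in> {0<..\<tau>}" for t x
    using w that by (auto simp: field_on_def)
  have uC: "u t \<in> Cb 1" if t: "t \<in> {0<..\<tau>}" for t
  proof (rule Cb1_I[OF Du[OF t] _ u_le[OF t] w_le[OF t]])
    have "w t = grad_map w t" using fix_w[OF t] by auto
    then show "continuous_on UNIV (w t)" using continuous_on_grad_map[OF w t \<tau>(2) R] by simp
  qed
  have ev: "eventually (\<lambda>s. s \<in> {0<..\<tau>}) (at t within {0<..\<tau>})" for t
    by (auto simp: eventually_at_filter)
  have uT: "u \<in> C_time_Cb1 \<tau>"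
  proof (rule C_time_Cb1_I[OF uC])
    fix t assume t: "t \<in> {0<..\<tau>}"
    show "uniform_limit UNIV u (u t) (at t within {0<..\<tau>})"
      unfolding u_def by (rule uniform_limit_mild_map[OF w t \<tau>(2) R])
    have "eventually (\<lambda>s. \<forall>x\<in>UNIV. grad_map w s x = grad (u s) x) (at t within {0<..\<tau>})"
      using ev by eventually_elim (use fix_w in \<open>auto simp: gu\<close>)
    moreover have "\<forall>x\<in>UNIV. grad_map w t x = grad (u t) x"
      using fix_w[OF t] gu[OF t] by auto
    ultimately show "uniform_limit UNIV (\<lambda>s. grad (u s)) (grad (u t)) (at t within {0<..\<tau>})"
      using uniform_limit_mild_map(2)[OF w t \<tau>(2) R] by (subst (asm) uniform_limit_cong) auto
  qed
  have mm: "mild_map v t x = mild_map v' t x" if "t \<in> {0<..\<tau>}" "\<And>s x. s \<in> {0<..\<tau>} \<Longrightarrow> v s x = v' s x" for v v' t x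
  proof -
    have "duhamel p (forcing v) t x = duhamel p (forcing v') t x"
      unfolding duhamel_def by (rule set_lebesgue_integral_cong) (use that in \<open>auto simp: forcing_def[abs_def]\<close>)
    then show ?thesis by (simp add: mild_map_def)
  qed
  have u_mild: "mild_solution p H u\<^sub>0 \<tau> u"
    unfolding mild_solution_iff[OF \<tau>(2) R gu_field uT]
  proof (intro ballI allI)
    fix t x assume t: "t \<in> {0<..\<tau>}"
    have "mild_map w t x = mild_map (\<lambda>t. grad (u t)) t x"
      by (rule mm[OF t]) (simp add: gu)
    then show "u t x = mild_map (\<lambda>t. grad (u t)) t x" by (simp add: u_def)
  qed
  have "Cb1_norm (u t) \<le> (B + M * T) + R" if t: "t \<in> {0<..\<tau>}" for t
    using u_le[OF t] w_le[OF t] by (intro Cb1_norm_le) (auto simp: gu[OF t])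
  then have uCb: "u \<in> Cb_time_Cb1 \<tau>" using uT unfolding Cb_time_Cb1_def by blast
  have "v t x = u t x" if v: "mild_solution p H u\<^sub>0 \<tau> v" "v \<in> Cb_time_Cb1 \<tau>" and t: "t \<in> {0<..\<tau>}" for v t x
  proof -
    obtain R' where R': "0 \<le> R'" "field_on \<tau> R' (\<lambda>t. grad (v t))" using field_on_grad[OF v(2)] by auto
    \<comment> \<open>A bound common to both gradients, so that one Lipschitz constant of the Hamiltonian applies.\<close>
    define R'' where "R'' = max R R'"
    have R'': "0 \<le> R''" "field_on \<tau> R'' (\<lambda>t. grad (v t))" "field_on \<tau> R'' w"
      using R R' w by (auto simp: R''_def intro: field_on_mono)
    have vT: "v \<in> C_time_Cb1 \<tau>" using v(2) by (simp add: Cb_time_Cb1_def)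
    have v_eq: "v t x = mild_map (\<lambda>t. grad (v t)) t x" if "t \<in> {0<..\<tau>}" for t x
      using v(1) that unfolding mild_solution_iff[OF \<tau>(2) R''(1,2) vT] by blast
    have gv: "grad (v t) x = grad_map (\<lambda>t. grad (v t)) t x" if s: "t \<in> {0<..\<tau>}" for t x
    proof -
      have "v t = mild_map (\<lambda>t. grad (v t)) t" using v_eq[OF s] by auto
      then have "GDERIV (v t) x :> grad_map (\<lambda>t. grad (v t)) t x"
        using GDERIV_mild_map[OF R''(2) s \<tau>(2) R''(1), of x] by simp
      then show ?thesis by (rule grad_GDERIV)
    qed
    have g: "grad (v s) y = w s y" if "s \<in> {0<..\<tau>}" for s y
      by (rule grad_map_fixpoint_unique[OF R''(2,3) \<tau>(2) R''(1) gv fix_w that])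
    have "v t x = mild_map (\<lambda>t. grad (v t)) t x" by (rule v_eq[OF t])
    also have "\<dots> = mild_map w t x" by (rule mm[OF t g])
    finally show ?thesis by (simp add: u_def)
  qed
  with u_mild uCb have "(mild_solution p H u\<^sub>0 \<tau> u \<and> u \<in> Cb_time_Cb1 \<tau>) \<and>
     (\<forall>v. mild_solution p H u\<^sub>0 \<tau> v \<and> v \<in> Cb_time_Cb1 \<tau> \<longrightarrow> (\<forall>t\<in>{0<..\<tau>}. \<forall>x. v t x = u t x))"
    by blast
  moreover have "\<tau> \<in> {0<..T}" using \<tau> by simp
  ultimately show ?thesis by blast
qed

end

theorem theorem3p4:
  fixes Tstar \<alpha> c\<^sub>0 H\<^sub>0 :: real
    and H :: "real \<Rightarrow> real^'n::finite \<Rightarrow> real^'n \<Rightarrow> real"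
    and L :: "(real^'n \<Rightarrow> real) \<Rightarrow> real^'n \<Rightarrow> real"
    and A :: "real^'n^'n"
    and mu :: "(real^'n) measure"
    and p :: "real \<Rightarrow> real^'n \<Rightarrow> real"
    and u\<^sub>0 :: "real^'n \<Rightarrow> real"
  assumes "Tstar > 0"
    and "levy_operator L A mu"
    and "heat_kernel A mu p"
    and "\<forall>t\<in>{0<..Tstar}. p t \<in> Cb_infinity"
    and "1 < \<alpha>" and "\<alpha> \<le> 2" and "c\<^sub>0 > 0"
    and "\<forall>t\<in>{0<..Tstar}.
           (\<integral>\<^sup>+y. ennreal (norm (grad (p t) y)) \<partial>lborel) \<le> ennreal (c\<^sub>0 * t powr (- 1 / \<alpha>))"
    and "continuous_on ({0..Tstar} \<times> UNIV \<times> UNIV) (\<lambda>(t, x, q). H t x q)"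
    and "H\<^sub>0 > 0"
    and "\<forall>t\<in>{0<..<Tstar}. \<forall>x. \<bar>H t x 0\<bar> \<le> H\<^sub>0"
    and "\<forall>R>0. \<exists>L\<^sub>R>0. \<forall>t\<in>{0<..<Tstar}. \<forall>x. \<forall>q\<in>ball 0 R. \<forall>r\<in>ball 0 R.
           \<bar>H t x q - H t x r\<bar> \<le> L\<^sub>R * norm (q - r)"
    and "bounded (range u\<^sub>0)"
    and "\<exists>K. K-lipschitz_on UNIV u\<^sub>0"
  shows "\<exists>T\<in>{0<..Tstar}. \<exists>u.
           (mild_solution p H u\<^sub>0 T u \<and> u \<in> Cb_time_Cb1 T) \<and>
           (\<forall>v. mild_solution p H u\<^sub>0 T v \<and> v \<in> Cb_time_Cb1 T \<longrightarrow>
                (\<forall>t\<in>{0<..T}. \<forall>x. v t x = u t x))"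
proof -
  obtain K where K: "K-lipschitz_on UNIV u\<^sub>0" using assms by blast
  obtain B where B: "\<And>x. \<bar>u\<^sub>0 x\<bar> \<le> B" using \<open>bounded (range u\<^sub>0)\<close> by (auto simp: bounded_iff)
  have C1: "p t \<in> Cb 1" if "t \<in> {0<..Tstar}" for t using assms(4) that by (intro Cb_infinity_Cb1) blast
  note hk = heat_kernel_density[OF \<open>heat_kernel A mu p\<close>]
  have Dint: "integrable lborel (grad (p t)) \<and> L1_norm (grad (p t)) \<le> c\<^sub>0 * t powr (- (1 / \<alpha>))"
    if t: "t \<in> {0<..Tstar}" for t
  proof
    have "continuous_on UNIV (grad (p t))" by (rule Cb1_continuous_grad[OF C1[OF t]])
    then have m: "grad (p t) \<in> borel_measurable lborel" using borel_measurable_continuous_onI by auto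
    have le: "(\<integral>\<^sup>+y. ennreal (norm (grad (p t) y)) \<partial>lborel) \<le> ennreal (c\<^sub>0 * t powr (- (1 / \<alpha>)))"
      using assms(8) t by simp
    show int: "integrable lborel (grad (p t))"
      using le_less_trans[OF le ennreal_less_top] by (intro integrableI_bounded[OF m]) simp
    show "L1_norm (grad (p t)) \<le> c\<^sub>0 * t powr (- (1 / \<alpha>))"
      using le nn_integral_eq_integral[OF integrable_norm[OF int]] \<open>c\<^sub>0 > 0\<close> by (simp add: L1_norm_def ennreal_le_iff)
  qed
  have "hamilton_jacobi p (\<lambda>t. grad (p t)) (levy_symbol A mu) Tstar c\<^sub>0 (1 / \<alpha>) H u\<^sub>0 H\<^sub>0 B K"
  proof
    fix t x \<xi> assume t: "t \<in> {0<..Tstar}"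
    show "0 \<le> p t x" using \<open>heat_kernel A mu p\<close> t by (simp add: heat_kernel_def)
    show "integrable lborel (p t)" "L1_norm (p t) = 1" using hk(1,2) t by auto
    show "fourier (p t) \<xi> = exp (- (complex_of_real t * levy_symbol A mu \<xi>))" using hk(3) t by auto
    show "GDERIV (p t) x :> grad (p t) x" by (rule Cb1_GDERIV[OF C1[OF t]])
    show "\<exists>B. \<forall>x. \<bar>p t x\<bar> \<le> B" "continuous_on UNIV (grad (p t))" "\<exists>C. \<forall>x. norm (grad (p t) x) \<le> C"
      by (rule Cb1_bounded[OF C1[OF t]], rule Cb1_continuous_grad[OF C1[OF t]], rule Cb1_bounded_grad[OF C1[OF t]])
    show "integrable lborel (grad (p t))" "L1_norm (grad (p t)) \<le> c\<^sub>0 * t powr (- (1 / \<alpha>))"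
      using Dint[OF t] by auto
  next
    show "0 \<le> c\<^sub>0" "0 \<le> 1 / \<alpha>" "1 / \<alpha> < 1" "0 < Tstar"
      using \<open>1 < \<alpha>\<close> \<open>c\<^sub>0 > 0\<close> \<open>Tstar > 0\<close> by auto
    show "continuous_on ({0<..<Tstar} \<times> UNIV \<times> UNIV) (\<lambda>(t, x, q). H t x q)"
      using \<open>continuous_on ({0..Tstar} \<times> UNIV \<times> UNIV) (\<lambda>(t, x, q). H t x q)\<close> by (rule continuous_on_subset) auto
    show "\<bar>H t x 0\<bar> \<le> H\<^sub>0" if "t \<in> {0<..<Tstar}" for t x
      using \<open>\<forall>t\<in>{0<..<Tstar}. \<forall>x. \<bar>H t x 0\<bar> \<le> H\<^sub>0\<close> that by blast
    show "\<exists>L\<ge>0. \<forall>t\<in>{0<..<Tstar}. \<forall>x q r. norm q \<le> R \<longrightarrow> norm r \<le> R \<longrightarrow> \<bar>H t x q - H t x r\<bar> \<le> L * norm (q - r)" for R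
    proof -
      \<comment> \<open>Lipschitz bounds are given on open balls, hence the radius is enlarged by 1; the absolute value covers negative \<open>R\<close>.\<close>
      obtain L where "L > 0" "\<forall>t\<in>{0<..<Tstar}. \<forall>x. \<forall>q\<in>ball 0 (\<bar>R\<bar> + 1). \<forall>r\<in>ball 0 (\<bar>R\<bar> + 1). \<bar>H t x q - H t x r\<bar> \<le> L * norm (q - r)"
        using assms(12)[THEN spec, of "\<bar>R\<bar> + 1"] by force
      then show ?thesis by (intro exI[of _ L]) (auto simp: dist_norm)
    qed
    show "bcont B u\<^sub>0" using lipschitz_on_continuous_on[OF K] B by (rule bcontI)
    show "\<bar>u\<^sub>0 x - u\<^sub>0 y\<bar> \<le> K * norm (x - y)" for x y
      using lipschitz_onD[OF K, of x y] by (simp add: dist_norm)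
  qed
  from mild_solution_exists_unique[OF this] show ?thesis .
qed

end
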